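(* For every admissible signed measure $\mu$ on $\mathbb{R}$, $\tilde{\mathcal{G}}[\mu]\ge\frac12$, with equality if and only if $\mu$ is of Type I, i.e. $\mu=\mu_{\mathrm I}(\cdot/\lambda)$ for some $\lambda>0$.
   Context: Let $\tilde W(x)=-\log|x|$ on $\mathbb{R}$. Signed measures: $\mu_{\mathrm I}=-1+\frac{\sqrt{x^2-\pi^{-2}}}{|x|}\chi_{\{|x|\ge\pi^{-1}\}}+\delta_0$; $\mu_{\mathrm{II},R}=-1+\frac{\sqrt{(x^2-R^2)x^2}}{|x^2-1|}\chi_{\{|x|\ge R\}}+\frac{\pi\sqrt{R^2-1}}2(\delta_1+\delta_{-1})$; $\mu_{\mathrm{III},L,R}=-1+\frac{\sqrt{(x^2-R^2)(x^2-L^2)}}{|x^2-1|}\chi_{\{|x|\in[0,L]\cup[R,\infty)\}}+\frac{\pi\sqrt{(R^2-1)(1-L^2)}}2(\delta_1+\delta_{-1})$ for $0<L<1<R$. Let $\Phi(L,R)=\mathrm{p.v.}\int_L^R\frac{\pi\sqrt{(R^2-x^2)(x^2-L^2)}}{x^2-1}dx$; $R_c>1$ is the unique root of $\sqrt{R^2-1}\ln(R+\sqrt{R^2-1})-R=0$, and for $1<R<R_c$, $L(R)\in(0,1)$ is the unique number with $\Phi(L(R),R)=0$. For $\lambda>0$, $\mu(\cdot/\lambda)$ denotes $\lambda$ times the push-forward of $\mu$ under $x\mapsto\lambda x$ (density $f(x/\lambda)$, and each mass $a\delta_p$ becomes $\lambda a\delta_{\lambda p}$). $\mu$ is admissible if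 it equals $\mu_{\mathrm I}(\cdot/\lambda)$, or $\mu_{\mathrm{II},R}(\cdot/\lambda)$ with $R\ge R_c$, or $\mu_{\mathrm{III},L(R),R}(\cdot/\lambda)$ with $1<R<R_c$, for some $\lambda>0$. Define $\tilde{\mathcal{H}}[\mu]=\int_{\mathbb{R}}(\tilde W*\mu)(x)\,dx$ with $(\tilde W*\mu)(x)=\int-\log|x-y|\,d\mu(y)$; $\tilde{\mathcal{D}}[\mu_{\mathrm I}(\cdot/\lambda)]=\lambda$; $\tilde{\mathcal{D}}[\mu]=\mu([-\lambda,\lambda])$ for $\mu$ of the second or third kind with scaling $\lambda$; and $\tilde{\mathcal{G}}[\mu]=\tilde{\mathcal{H}}[\mu]/\tilde{\mathcal{D}}[\mu]^2$. *)

theory Defs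
  imports "HOL-Analysis.Analysis"
begin

text \<open>A (locally finite) signed measure on the real line with a density part and
finitely many point masses: the pair (f, atoms), where atoms is a list of
(mass, point) pairs; it represents  f(x) dx + sum of  m * delta_p.\<close>
type_synonym sm = "(real \<Rightarrow> real) \<times> (real \<times> real) list"

definition sm_interval :: "sm \<Rightarrow> real \<Rightarrow> real \<Rightarrow> real" where
  "sm_interval \<mu> a b =
     (LINT y:{a..b}|lborel. fst \<mu> y)
     + sum_list (map (\<lambda>(m, p). if p \<in> {a..b} then m else 0) (snd \<mu>))"

definition sm_eq :: "sm \<Rightarrow> sm \<Rightarrow> bool" where
  "sm_eq \<mu> \<nu> \<longleftrightarrow> (\<forall>a b. a \<le> b \<longrightarrow> sm_interval \<mu> a b = sm_interval \<nu> a b)"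

definition sm_scale :: "real \<Rightarrow> sm \<Rightarrow> sm" where
  "sm_scale lam \<mu> = ((\<lambda>x. fst \<mu> (x / lam)), map (\<lambda>(m, p). (lam * m, lam * p)) (snd \<mu>))"

definition muI :: sm where
  "muI = ((\<lambda>x. -1 + (if \<bar>x\<bar> \<ge> 1 / pi then sqrt (x\<^sup>2 - (1 / pi)\<^sup>2) / \<bar>x\<bar> else 0)),
          [(1, 0)])"

definition muII :: "real \<Rightarrow> sm" where
  "muII R = ((\<lambda>x. -1 + (if \<bar>x\<bar> \<ge> R then sqrt ((x\<^sup>2 - R\<^sup>2) * x\<^sup>2) / \<bar>x\<^sup>2 - 1\<bar> else 0)),
          [(pi * sqrt (R\<^sup>2 - 1) / 2, 1), (pi * sqrt (R\<^sup>2 - 1) / 2, -1)])"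

definition muIII :: "real \<Rightarrow> real \<Rightarrow> sm" where
  "muIII L R = ((\<lambda>x. -1 + (if \<bar>x\<bar> \<le> L \<or> \<bar>x\<bar> \<ge> R
                  then sqrt ((x\<^sup>2 - R\<^sup>2) * (x\<^sup>2 - L\<^sup>2)) / \<bar>x\<^sup>2 - 1\<bar> else 0)),
          [(pi * sqrt ((R\<^sup>2 - 1) * (1 - L\<^sup>2)) / 2, 1),
           (pi * sqrt ((R\<^sup>2 - 1) * (1 - L\<^sup>2)) / 2, -1)])"

definition Phi :: "real \<Rightarrow> real \<Rightarrow> real" where
  "Phi L R = Lim (at_right 0) (\<lambda>\<epsilon>.
      integral {L..1 - \<epsilon>} (\<lambda>x. pi * sqrt ((R\<^sup>2 - x\<^sup>2) * (x\<^sup>2 - L\<^sup>2)) / (x\<^sup>2 - 1))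
    + integral {1 + \<epsilon>..R} (\<lambda>x. pi * sqrt ((R\<^sup>2 - x\<^sup>2) * (x\<^sup>2 - L\<^sup>2)) / (x\<^sup>2 - 1)))"

definition Rc :: real where
  "Rc = (THE R. R > 1 \<and> sqrt (R\<^sup>2 - 1) * ln (R + sqrt (R\<^sup>2 - 1)) - R = 0)"

definition Lof :: "real \<Rightarrow> real" where
  "Lof R = (THE L. 0 < L \<and> L < 1 \<and> Phi L R = 0)"

datatype adm = AdmI real | AdmII real real | AdmIII real real

fun adm_sm :: "adm \<Rightarrow> sm" where
  "adm_sm (AdmI lam) = sm_scale lam muI"
| "adm_sm (AdmII lam R) = sm_scale lam (muII R)"
| "adm_sm (AdmIII lam R) = sm_scale lam (muIII (Lof R) R)"

fun admissible :: "adm \<Rightarrow> bool" where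
  "admissible (AdmI lam) \<longleftrightarrow> lam > 0"
| "admissible (AdmII lam R) \<longleftrightarrow> lam > 0 \<and> R \<ge> Rc"
| "admissible (AdmIII lam R) \<longleftrightarrow> lam > 0 \<and> 1 < R \<and> R < Rc"

definition Wconv :: "sm \<Rightarrow> real \<Rightarrow> real" where
  "Wconv \<mu> x = (\<integral>y. - ln \<bar>x - y\<bar> * fst \<mu> y \<partial>lborel)
     + sum_list (map (\<lambda>(m, p). m * (- ln \<bar>x - p\<bar>)) (snd \<mu>))"

definition Hfun :: "sm \<Rightarrow> real" where
  "Hfun \<mu> = (\<integral>x. Wconv \<mu> x \<partial>lborel)"

fun Dfun :: "adm \<Rightarrow> real" where
  "Dfun (AdmI lam) = lam"
| "Dfun (AdmII lam R) = sm_interval (adm_sm (AdmII lam R)) (-lam) lam"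
| "Dfun (AdmIII lam R) = sm_interval (adm_sm (AdmIII lam R)) (-lam) lam"

definition Gfun :: "adm \<Rightarrow> real" where
  "Gfun a = Hfun (adm_sm a) / (Dfun a)\<^sup>2"

end

theory Submission
  imports Defs "HOL-Complex_Analysis.Complex_Analysis"
begin

text \<open>
  The density of each admissible measure is the boundary value of the real part of an algebraic function
  \<open>G\<close> that is holomorphic in the upper half plane, decays like \<open>c / z\<^sup>2\<close>, and whose imaginary part vanishes on
  the real axis outside \<open>{-R..R}\<close>; the atoms are the boundary poles of \<open>G\<close>. Integrating \<open>G\<close> times
  \<open>z \<mapsto> \<integral>\<^bsub>a\<^esub>\<^bsup>b\<^esup> log (z - x) dx\<close> over the boundary of a large half disc evaluates the integral of the
  potential over \<open>{a..b}\<close>. Thus the potential vanishes outside \<open>{-R..R}\<close>, the energy is \<open>- \<pi>\<^sup>2 c\<close>, and the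
  measure is neutral. For type I this gives exactly \<open>1/2\<close>; type II is the case \<open>L = 0\<close> of type III.

  For type III put \<open>\<sigma> = R\<^sup>2 + L\<^sup>2 - 2\<close> and \<open>m = sqrt ((R\<^sup>2 - 1) (1 - L\<^sup>2))\<close>, so the energy is \<open>\<pi>\<^sup>2 \<sigma> / 2\<close>. Writing
  \<open>1 / (x\<^sup>2 - 1) = x / (x\<^sup>2 - 1) - 1 / (x + 1)\<close> makes the singular part of \<open>Phi\<close> elementary, and \<open>Phi L R = 0\<close> becomes
  \<open>\<pi> \<sigma> / 4 = \<integral>\<^bsub>L\<^esub>\<^bsup>R\<^esup> sqrt ((R\<^sup>2 - x\<^sup>2) (x\<^sup>2 - L\<^sup>2)) / (x + 1) dx\<close>. Bounding this integral from above gives \<open>L R \<le> 1\<close>, hence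
  a nonpositive density and mass at most \<open>\<pi> m - 2 (1 - L)\<close> in \<open>{-1..1}\<close>; bounding it from below makes \<open>\<sigma>\<close> large
  enough that this mass is less than \<open>\<pi> sqrt \<sigma>\<close>. Neutrality makes the mass positive.
\<close>

section \<open>Cauchy's theorem on the upper half plane\<close>

text \<open>The logarithm is unbounded near a boundary point, but its integral over an interval is
  continuous up to the axis. So the potential is only integrated over intervals, never evaluated at
  a point, and its a.e. vanishing is recovered from these integrals.

  On {-R..R} the integrated logarithm has an imaginary part that is affine in y whenever both ends
  of the interval lie outside, and an imaginary affine function cancels it there. Beyond R the
  factor G is real, so the product of the imaginary parts vanishes on the whole line. As G is of
  order 1 / z^2, only the slope of the affine correction survives on the large arc: it is 0 for an
  interval on one side of {-R..R} and pi for one that contains it. Hence the zero potential and the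
  energy.

  Neutrality also removes the ln lam term under scaling. With a nonpositive density equal to -1 on
  (1, R), it leaves mass at least R - 1 in {-1..1}, so the upper bound for the mass may be squared.

  For L > 0 the remaining integral in Phi is elliptic; types II and III have enough slack for
  elementary bounds.\<close>

definition UH :: "complex set" where "UH = {z. 0 \<le> Im z}"

text \<open>Limits at infinity inside the closed half plane: the real axis is included, so that tail
  estimates can be read off on it.\<close>

abbreviation uhinf :: "complex filter" where "uhinf \<equiv> inf at_infinity (principal UH)"

lemma convex_UH: "convex UH"
proof -
  have "UH = {z. Im z \<ge> 0}" by (auto simp: UH_def)
  then show ?thesis using convex_halfspace_Im_ge[of 0] by simp
qed

lemma interior_UH: "interior UH = {z. 0 < Im z}"
proof -
  have "UH = {z. Im z \<ge> 0}" by (auto simp: UH_def)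
  then show ?thesis using interior_halfspace_ge[of \<i> 0] by (auto simp: inner_complex_def)
qed

lemma of_real_UH [simp]: "of_real x \<in> UH"
  by (simp add: UH_def)

lemma eventually_uhinf:
  "eventually P uhinf \<longleftrightarrow> (\<exists>b>0. \<forall>z\<in>UH. norm z \<ge> b \<longrightarrow> P z)"
  unfolding eventually_inf_principal eventually_at_infinity_pos by auto

lemma has_contour_integral_half_circle_inverse:
  assumes "r > 0"
  shows "((\<lambda>z. 1 / z) has_contour_integral \<i> * pi) (part_circlepath 0 r 0 pi)"
proof -
  have "((\<lambda>t. \<i>) has_integral \<i> * pi) {0..pi}"
    using has_integral_const_real[of \<i> 0 pi] by (simp add: scaleR_conv_of_real mult.commute)
  then have "((\<lambda>t. 1 / (0 + of_real r * cis t) * r * \<i> * cis t) has_integral \<i> * pi) {0..pi}"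
    using assms by (simp add: field_simps)
  then show ?thesis
    by (simp add: has_contour_integral_part_circlepath_iff)
qed

lemma half_circle_subset_UH:
  assumes "r > 0"
  shows "path_image (part_circlepath 0 r 0 pi) \<subseteq> UH \<inter> sphere 0 r"
  using assms
  by (auto simp: path_image_part_circlepath' UH_def Im_exp norm_mult cis.simps closed_segment_eq_real_ivl intro!: mult_nonneg_nonneg sin_ge_zero)

text \<open>Cauchy's theorem on a half disc with its diameter on the boundary:
  \<open>Cauchy_theorem_convex\<close> needs continuity on \<open>UH\<close> but differentiability
  only in its interior. On the arc \<open>Q\<close> is \<open>l / z\<close> up to o(1 / r), so the
  arc contributes i pi l in the limit.\<close>

lemma half_plane_integral_tendsto:
  assumes cont: "continuous_on UH Q"
    and hol: "Q holomorphic_on {z. 0 < Im z}"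
    and lim: "((\<lambda>z. z * Q z) \<longlongrightarrow> l) uhinf"
  shows "((\<lambda>r. integral {-r..r} (\<lambda>y. Q (complex_of_real y))) \<longlongrightarrow> - (\<i> * pi * l)) at_top"
proof (rule tendstoI)
  fix e :: real assume "e > 0"
  \<comment> \<open>The arc has length \<open>pi * r\<close>, so an error \<open>d / r\<close> on it
    contributes e / 2.\<close>
  define d where "d = e / (2 * pi)"
  have d: "d > 0" using \<open>e > 0\<close> by (simp add: d_def)
  from tendstoD[OF lim d] obtain b where b: "b > 0" "\<And>z. z \<in> UH \<Longrightarrow> norm z \<ge> b \<Longrightarrow> dist (z * Q z) l < d"
    unfolding eventually_uhinf by auto
  have "dist (integral {-r..r} (\<lambda>y. Q (complex_of_real y))) (- (\<i> * pi * l)) < e" if "r \<ge> b" for r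
  proof -
    have r: "r > 0" using b that by simp
    let ?l = "linepath (complex_of_real (-r)) (complex_of_real r)"
    let ?c = "part_circlepath 0 r 0 pi"
    have li: "path_image ?l \<subseteq> UH"
      using closed_segment_subset[OF of_real_UH[of "-r"] of_real_UH[of r] convex_UH] by simp
    have ci: "path_image ?c \<subseteq> UH" using half_circle_subset_UH[OF r] by blast
    have fin: "pathfinish ?c = complex_of_real (-r)" 
      by simp
    have st: "pathstart ?c = complex_of_real r" by simp
    have "(Q has_contour_integral 0) (?l +++ ?c)"
    proof (rule Cauchy_theorem_convex[where K="{}" and S=UH])
      show "Q field_differentiable at x" if "x \<in> interior UH - {}" for x
        using hol that by (simp add: interior_UH open_halfspace_Im_gt holomorphic_on_imp_differentiable_at)
      show "path_image (?l +++ ?c) \<subseteq> UH"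
        using li ci by (subst path_image_join) (auto simp: st)
    qed (use cont convex_UH fin st in \<open>auto intro!: valid_path_join\<close>)
    moreover have Il: "Q contour_integrable_on ?l"
      by (intro contour_integrable_continuous_linepath continuous_on_subset[OF cont])
         (use li in auto)
    moreover have Ic: "Q contour_integrable_on ?c"
      by (intro contour_integrable_continuous_part_circlepath continuous_on_subset[OF cont] ci)
    ultimately have "contour_integral ?l Q + contour_integral ?c Q = 0"
      by (metis contour_integral_join contour_integral_unique st pathfinish_linepath
          valid_path_linepath valid_path_part_circlepath)
    moreover have "contour_integral ?l Q = integral {-r..r} (\<lambda>y. Q (complex_of_real y))"
      using r by (subst contour_integral_linepath_Reals_eq) auto
    ultimately have eq: "integral {-r..r} (\<lambda>y. Q (complex_of_real y)) = - contour_integral ?c Q"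
      by (simp add: eq_neg_iff_add_eq_0)
    have "((\<lambda>z. Q z - l * (1 / z)) has_contour_integral (contour_integral ?c Q - l * (\<i> * pi))) ?c"
      by (intro has_contour_integral_diff has_contour_integral_lmul 
          has_contour_integral_half_circle_inverse r has_contour_integral_integral Ic)
    then have "norm (contour_integral ?c Q - l * (\<i> * pi)) \<le> (d / r) * r * (pi - 0)"
    proof (rule has_contour_integral_bound_part_circlepath)
      fix z assume z: "z \<in> path_image ?c"
      then have zU: "z \<in> UH" "norm z = r" using half_circle_subset_UH[OF r] by auto
      then have z0: "z \<noteq> 0" using r by auto
      have "norm (z * Q z - l) < d" using b(2)[of z] zU that by (simp add: dist_norm)
      moreover have "Q z - l * (1/z) = (z * Q z - l) / z" using z0 by (simp add: field_simps)
      ultimately show "norm (Q z - l * (1/z)) \<le> d / r" 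
        using zU r by (simp add: norm_divide divide_right_mono)
    qed (use r d in auto)
    also have "\<dots> < e" using r \<open>e > 0\<close> by (simp add: d_def)
    finally show ?thesis
      unfolding eq by (simp add: dist_norm norm_minus_commute algebra_simps)
  qed
  then show "\<forall>\<^sub>F r in at_top. dist (integral {-r..r} (\<lambda>y. Q (complex_of_real y))) (- (\<i> * pi * l)) < e"
    unfolding eventually_at_top_linorder by blast
qed

section \<open>Boundary poles and the residue identity\<close>

lemma sum_list_pairs_nth:
  "sum_list (map (\<lambda>(m, p). h m p) xs) = (\<Sum>i<length xs. h (fst (xs ! i)) (snd (xs ! i)))"
  by (simp add: sum_list_sum_nth atLeast0LessThan case_prod_beta)

text \<open>Replacing E z by E z - E p removes a boundary pole of E z / (z - p). The value
  \<open>d\<close> will be a derivative within the closed half plane only, since p lies on its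
  boundary.\<close>

definition dquot :: "(complex \<Rightarrow> complex) \<Rightarrow> complex \<Rightarrow> complex \<Rightarrow> complex \<Rightarrow> complex" where
  "dquot E d p z = (if z = p then d else (E z - E p) / (z - p))"

lemma continuous_on_dquot:
  assumes cont: "continuous_on S E" and der: "(E has_field_derivative d) (at p within S)"
  shows "continuous_on S (dquot E d p)"
  unfolding continuous_on_eq_continuous_within
proof
  fix z assume z: "z \<in> S"
  show "continuous (at z within S) (dquot E d p)"
  proof (cases "z = p")
    case True
    have "(dquot E d p \<longlongrightarrow> d) (at p within S)"
      using der unfolding has_field_derivative_iff
      by (rule Lim_transform_eventually) (auto simp: dquot_def eventually_at_filter)
    then show ?thesis using True by (simp add: continuous_within dquot_def)
  next
    case False
    have "((\<lambda>w. (E w - E p) / (w - p)) \<longlongrightarrow> (E z - E p) / (z - p)) (at z within S)"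
      using cont z False by (intro tendsto_intros) (auto simp: continuous_on_def)
    moreover have "\<forall>\<^sub>F w in at z within S. (E w - E p) / (w - p) = dquot E d p w"
      using eventually_neq_at_within[of p z S] by eventually_elim (auto simp: dquot_def)
    ultimately have "(dquot E d p \<longlongrightarrow> (E z - E p) / (z - p)) (at z within S)"
      by (rule Lim_transform_eventually)
    then show ?thesis using False by (simp add: continuous_within dquot_def)
  qed
qed

lemma holomorphic_on_dquot:
  assumes "E holomorphic_on S" "p \<notin> S"
  shows "dquot E d p holomorphic_on S"
proof -
  have "(\<lambda>z. (E z - E p) / (z - p)) holomorphic_on S"
    using assms by (intro holomorphic_intros) auto
  then show ?thesis
    by (rule holomorphic_transform) (use assms in \<open>auto simp: dquot_def\<close>)
qed

lemma uhinf_tendsto_id_at_infinity: "filterlim (\<lambda>z. z) at_infinity uhinf"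
  by (simp add: filterlim_def)

lemma inverse_shift_tendsto_uhinf: "((\<lambda>z. z / (z - p)) \<longlongrightarrow> 1) uhinf"
proof -
  have "((\<lambda>z. inverse (1 - p * inverse z)) \<longlongrightarrow> inverse (1 - p * 0)) uhinf"
    by (intro tendsto_intros tendsto_inverse_0[THEN filterlim_compose]
          uhinf_tendsto_id_at_infinity) auto
  moreover have "\<forall>\<^sub>F z in uhinf. inverse (1 - p * inverse z) = z / (z - p)"
    unfolding eventually_uhinf
  proof (intro exI[of _ "norm p + 1"] conjI ballI impI)
    fix z :: complex assume "norm z \<ge> norm p + 1"
    then have "z \<noteq> 0" "z \<noteq> p" using norm_ge_zero[of p] by (auto simp del: norm_ge_zero)
    then show "inverse (1 - p * inverse z) = z / (z - p)" by (simp add: field_simps)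
  qed (simp add: add_nonneg_pos)
  ultimately show ?thesis by (simp add: filterlim_cong)
qed

lemma tendsto_symmetric_interval_integral:
  fixes h :: "real \<Rightarrow> real"
  assumes h: "integrable lborel h"
  shows "((\<lambda>r. LINT y:{-r..r}|lborel. h y) \<longlongrightarrow> (\<integral>y. h y \<partial>lborel)) at_top"
  unfolding set_lebesgue_integral_def
proof (rule integral_dominated_convergence_at_top[where w="\<lambda>y. norm (h y)"])
  show "integrable lborel (\<lambda>y. norm (h y))" using h by simp
  show "h \<in> borel_measurable lborel" using h by simp
  then show "(\<lambda>y. indicat_real {-r..r} y *\<^sub>R h y) \<in> borel_measurable lborel" for r by measurable
  show "\<forall>\<^sub>F r in at_top. AE y in lborel. norm (indicat_real {- r..r} y *\<^sub>R h y) \<le> norm (h y)"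
    by (auto split: split_indicator)
  show "AE y in lborel. ((\<lambda>r. indicat_real {-r..r} y *\<^sub>R h y) \<longlongrightarrow> h y) at_top"
  proof (rule AE_I2)
    fix y :: real
    show "((\<lambda>r. indicat_real {-r..r} y *\<^sub>R h y) \<longlongrightarrow> h y) at_top"
      by (rule tendsto_eventually, rule eventually_mono[OF eventually_ge_at_top[of "\<bar>y\<bar>"]]) (auto split: split_indicator)
  qed
qed

text \<open>Here \<open>g\<close> is the function \<open>G\<close> with its boundary poles subtracted, an atom of mass \<open>m\<close> at \<open>p\<close> corresponding to
  the pole \<open>\<i> m / (\<pi> (z - p))\<close>. These poles are purely imaginary on the real axis, so they do not affect \<open>Re g\<close>.\<close>
locale half_plane_density =
  fixes g :: "complex \<Rightarrow> complex" and f :: "real \<Rightarrow> real" and ats :: "(real \<times> real) list"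
    and c1 R :: real
  assumes cont_g: "continuous_on UH g"
    and hol_g: "g holomorphic_on {z. 0 < Im z}"
    and tail: "((\<lambda>z. z\<^sup>2 * (g z + sum_list (map (\<lambda>(m, p). \<i> * of_real m / (of_real pi * (z - of_real p))) ats)))
                 \<longlongrightarrow> of_real c1) uhinf"
    and f_eq: "\<And>y. y \<notin> snd ` set ats \<Longrightarrow> f y = Re (g (of_real y))"
    and Im_0: "\<And>y. \<bar>y\<bar> > R \<Longrightarrow>
            Im (g (of_real y)) + sum_list (map (\<lambda>(m, p). m / (pi * (y - p))) ats) = 0"
    and atoms: "\<And>m p. (m, p) \<in> set ats \<Longrightarrow> \<bar>p\<bar> < R"
    and f_meas [measurable]: "f \<in> borel_measurable borel"
begin

lemma AE_not_atom: "AE y in lborel. y \<notin> snd ` set ats"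
  by (intro AE_not_in countable_imp_null_set_lborel countable_finite) auto

text \<open>\<open>Q\<close> is E G minus the poles i m E(p) / (pi (z - p)); these give the atomic
  sum through \<open>c\<close>, while the 1 / z^2 decay of G leaves only the slope \<open>e1\<close>
  of E at infinity. On the axis Im E vanishes inside {-R..R} and Im G outside, so Re Q = Re E * f
  away from the atoms.\<close>

lemma test_function_identity:
  assumes contE: "continuous_on UH E"
    and holE: "E holomorphic_on {z. 0 < Im z}"
    and diffE: "\<And>m p. (m, p) \<in> set ats \<Longrightarrow> E field_differentiable (at (of_real p) within UH)"
    and ImE: "\<And>y. \<bar>y\<bar> \<le> R \<Longrightarrow> Im (E (of_real y)) = 0"
    and limE: "((\<lambda>z. E z / z) \<longlongrightarrow> e1) uhinf"
    and intE: "integrable lborel (\<lambda>y. Re (E (of_real y)) * f y)"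
  shows "(\<integral>y. Re (E (of_real y)) * f y \<partial>lborel)
         + sum_list (map (\<lambda>(m, p). m * Re (E (of_real p))) ats) = pi * c1 * Im e1"
proof -
  define n where "n = length ats"
  define m where "m i = fst (ats ! i)" for i
  define p where "p i = snd (ats ! i)" for i
  have mp: "(m i, p i) \<in> set ats" if "i < n" for i
    using that by (simp add: m_def p_def n_def)
  have pR: "\<bar>p i\<bar> < R" if "i < n" for i using atoms[OF mp[OF that]] .
  have ExD: "\<forall>i. \<exists>d. i < n \<longrightarrow> (E has_field_derivative d) (at (of_real (p i)) within UH)"
    using diffE[OF mp] by (auto simp: field_differentiable_def)
  obtain d where d: "\<And>i. i < n \<Longrightarrow> (E has_field_derivative d i) (at (of_real (p i)) within UH)"
    using ExD by metis
  define Q where "Q z = E z * g z + (\<Sum>i<n. \<i> * of_real (m i) / of_real pi * dquot E (d i) (of_real (p i)) z)" for z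
  define c where "c = (\<Sum>i<n. \<i> * of_real (m i) / of_real pi * E (of_real (p i)))"
  define G where "G z = g z + (\<Sum>i<n. \<i> * of_real (m i) / (of_real pi * (z - of_real (p i))))" for z
  have tailG: "((\<lambda>z. z\<^sup>2 * G z) \<longlongrightarrow> of_real c1) uhinf"
    using tail by (simp add: sum_list_pairs_nth G_def m_def p_def n_def)
  have contQ: "continuous_on UH Q"
    unfolding Q_def by (intro continuous_intros contE cont_g continuous_on_dquot d) auto
  have holQ: "Q holomorphic_on {z. 0 < Im z}"
    unfolding Q_def by (intro holomorphic_intros holE hol_g holomorphic_on_dquot) auto
  have evQ: "\<forall>\<^sub>F z in uhinf. E z / z * (z\<^sup>2 * G z) - (\<Sum>i<n. \<i> * of_real (m i) / of_real pi * E (of_real (p i)) * (z / (z - of_real (p i)))) = z * Q z"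
  proof -
    have "E z / z * (z\<^sup>2 * G z) - (\<Sum>i<n. \<i> * of_real (m i) / of_real pi * E (of_real (p i)) * (z / (z - of_real (p i)))) = z * Q z"
      if "norm z \<ge> \<bar>R\<bar> + 1" for z
    proof -
      have z0: "z \<noteq> 0" using that by auto
      have zp: "z \<noteq> of_real (p i)" if "i < n" for i
        using pR[OF that] \<open>norm z \<ge> \<bar>R\<bar> + 1\<close> by auto
      have "z * Q z - E z * z * G z = (\<Sum>i<n. z * (\<i> * of_real (m i) / of_real pi * dquot E (d i) (of_real (p i)) z) - E z * z * (\<i> * of_real (m i) / (of_real pi * (z - of_real (p i)))))"
        unfolding Q_def G_def by (simp add: algebra_simps sum_subtractf sum_distrib_left)
      also have "\<dots> = (\<Sum>i<n. - (\<i> * of_real (m i) / of_real pi * E (of_real (p i)) * (z / (z - of_real (p i)))))"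
      proof (rule sum.cong)
        fix i assume "i \<in> {..<n}"
        then have ne: "z \<noteq> of_real (p i)" using zp by auto
        define w where "w = z - of_real (p i)"
        have w: "w \<noteq> 0" using ne by (simp add: w_def)
        show "z * (\<i> * of_real (m i) / of_real pi * dquot E (d i) (of_real (p i)) z) - E z * z * (\<i> * of_real (m i) / (of_real pi * (z - of_real (p i)))) = - (\<i> * of_real (m i) / of_real pi * E (of_real (p i)) * (z / (z - of_real (p i))))"
          using w ne unfolding dquot_def w_def[symmetric] by (simp add: field_simps)
      qed simp
      finally show ?thesis using z0 by (simp add: sum_negf power2_eq_square algebra_simps)
    qed
    then show ?thesis unfolding eventually_uhinf by (intro exI[of _ "\<bar>R\<bar> + 1"]) auto
  qed
  have "((\<lambda>z. E z / z * (z\<^sup>2 * G z) - (\<Sum>i<n. \<i> * of_real (m i) / of_real pi * E (of_real (p i)) * (z / (z - of_real (p i)))))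
      \<longlongrightarrow> e1 * of_real c1 - (\<Sum>i<n. \<i> * of_real (m i) / of_real pi * E (of_real (p i)) * 1)) uhinf"
    by (intro tendsto_intros limE tailG inverse_shift_tendsto_uhinf)
  then have limQ: "((\<lambda>z. z * Q z) \<longlongrightarrow> e1 * of_real c1 - c) uhinf"
    using evQ by (simp add: filterlim_cong c_def)
  have main: "((\<lambda>r. integral {-r..r} (\<lambda>y. Q (complex_of_real y))) \<longlongrightarrow> - (\<i> * pi * (e1 * of_real c1 - c))) at_top"
    by (rule half_plane_integral_tendsto[OF contQ holQ limQ])
  have ReQ: "Re (Q (of_real y)) = Re (E (of_real y)) * f y" if y: "y \<notin> snd ` set ats" for y
  proof -
    have ne: "y \<noteq> p i" if "i < n" for i using y mp[OF that] by force
    have "Re (Q (of_real y)) = Re (E (of_real y)) * Re (g (of_real y)) - Im (E (of_real y)) * Im (g (of_real y))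
       + (\<Sum>i<n. Re (\<i> * of_real (m i) / of_real pi * dquot E (d i) (of_real (p i)) (of_real y)))"
      unfolding Q_def by simp
    also have "(\<Sum>i<n. Re (\<i> * of_real (m i) / of_real pi * dquot E (d i) (of_real (p i)) (of_real y)))
        = (\<Sum>i<n. - Im (E (of_real y)) * (m i / (pi * (y - p i))))"
    proof (rule sum.cong)
      fix i assume "i \<in> {..<n}"
      then have i: "i < n" by auto
      define w where "w = y - p i"
      have w: "w \<noteq> 0" using ne[OF i] by (simp add: w_def)
      have "dquot E (d i) (of_real (p i)) (of_real y) = (E (of_real y) - E (of_real (p i))) / of_real w"
        using ne[OF i] by (simp add: dquot_def w_def)
      moreover have "Im (E (of_real (p i))) = 0" using pR[OF i] by (intro ImE) auto
      ultimately have "Im (dquot E (d i) (of_real (p i)) (of_real y)) = Im (E (of_real y)) / w"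
        by (simp add: Im_divide_of_real)
      then show "Re (\<i> * of_real (m i) / of_real pi * dquot E (d i) (of_real (p i)) (of_real y)) = - Im (E (of_real y)) * (m i / (pi * (y - p i)))"
        unfolding w_def[symmetric] using w by (simp add: field_simps)
    qed simp
    also have "\<dots> = - Im (E (of_real y)) * (\<Sum>i<n. m i / (pi * (y - p i)))"
      by (rule sum_distrib_left[symmetric])
    finally have "Re (Q (of_real y)) = Re (E (of_real y)) * Re (g (of_real y)) - Im (E (of_real y)) * (Im (g (of_real y)) + (\<Sum>i<n. m i / (pi * (y - p i))))"
      by (simp add: algebra_simps)
    moreover have "Im (E (of_real y)) * (Im (g (of_real y)) + (\<Sum>i<n. m i / (pi * (y - p i)))) = 0"
      using ImE[of y] Im_0[of y] by (cases "\<bar>y\<bar> \<le> R") (auto simp: sum_list_pairs_nth n_def m_def p_def)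
    ultimately show ?thesis using f_eq[OF y] by simp
  qed
  define h where "h y = Re (E (of_real y)) * f y" for y
  have QR: "continuous_on A (\<lambda>y. Q (complex_of_real y))" for A :: "real set"
    by (rule continuous_on_compose2[OF contQ]) (auto intro!: continuous_intros)
  have Ih: "integral {-r..r} (\<lambda>y. Re (Q (of_real y))) = (LINT y:{-r..r}|lborel. h y)" for r
  proof -
    have "(LINT y:{-r..r}|lborel. h y) = (LINT y:{-r..r}|lborel. Re (Q (of_real y)))"
      unfolding set_lebesgue_integral_def
    proof (rule integral_cong_AE)
      show "AE y in lborel. indicat_real {-r..r} y *\<^sub>R h y = indicat_real {-r..r} y *\<^sub>R Re (Q (of_real y))"
        using AE_not_atom by eventually_elim (simp add: ReQ h_def)
      have "(\<lambda>y. Q (complex_of_real y)) \<in> borel_measurable borel"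
        by (rule borel_measurable_continuous_onI) (rule QR)
      then show "(\<lambda>y. indicat_real {-r..r} y *\<^sub>R Re (Q (of_real y))) \<in> borel_measurable lborel"
        by measurable
      have "h \<in> borel_measurable lborel" using intE by (simp add: h_def[abs_def])
      then show "(\<lambda>y. indicat_real {-r..r} y *\<^sub>R h y) \<in> borel_measurable lborel" by measurable
    qed
    also have "\<dots> = integral {-r..r} (\<lambda>y. Re (Q (of_real y)))"
      by (intro set_borel_integral_eq_integral borel_integrable_atLeastAtMost') (intro continuous_intros QR)
    finally show ?thesis ..
  qed
  have "((\<lambda>r. Re (integral {-r..r} (\<lambda>y. Q (complex_of_real y)))) \<longlongrightarrow> Re (- (\<i> * pi * (e1 * of_real c1 - c)))) at_top"
    by (intro tendsto_intros main)
  moreover have "Re (integral {-r..r} (\<lambda>y. Q (complex_of_real y))) = (LINT y:{-r..r}|lborel. h y)" for r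
    unfolding Ih[symmetric]
    by (subst integral_linear[OF integrable_continuous_real[OF QR] bounded_linear_Re, symmetric]) (simp add: o_def)
  ultimately have l1: "((\<lambda>r. LINT y:{-r..r}|lborel. h y) \<longlongrightarrow> Re (- (\<i> * pi * (e1 * of_real c1 - c)))) at_top"
    by simp
  \<comment> \<open>Cauchy's theorem gives only the limit over symmetric intervals;
    \<open>intE\<close> identifies it with the Lebesgue integral.\<close>
  have l2: "((\<lambda>r. LINT y:{-r..r}|lborel. h y) \<longlongrightarrow> (\<integral>y. h y \<partial>lborel)) at_top"
    using intE by (intro tendsto_symmetric_interval_integral) (simp add: h_def[abs_def])
  have "(\<integral>y. h y \<partial>lborel) = Re (- (\<i> * pi * (e1 * of_real c1 - c)))"
    by (rule tendsto_unique[OF _ l2 l1]) simp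
  also have "\<dots> = pi * c1 * Im e1 - pi * Im c" by (simp add: algebra_simps)
  also have "pi * Im c = (\<Sum>i<n. m i * Re (E (of_real (p i))))"
    unfolding c_def by (simp add: sum_distrib_left)
  finally show ?thesis
    by (simp add: h_def sum_list_pairs_nth n_def m_def p_def)
qed

end

section \<open>The logarithmic test functions\<close>

text \<open>The branch of the logarithm that is cut along the negative imaginary axis.\<close>
definition logu :: "complex \<Rightarrow> complex" where
  "logu z = Ln (- \<i> * z) + \<i> * pi / 2"

lemma UH_rotate_notin: "z \<in> UH \<Longrightarrow> z \<noteq> 0 \<Longrightarrow> - \<i> * z \<notin> \<real>\<^sub>\<le>\<^sub>0"
  by (auto simp: UH_def complex_nonpos_Reals_iff complex_eq_iff)

lemma logu_of_real:
  assumes "y \<noteq> 0"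
  shows "logu (of_real y) = of_real (ln \<bar>y\<bar>) + (if y < 0 then \<i> * pi else 0)"
proof -
  have "Ln (of_real \<bar>y\<bar> * (if y < 0 then \<i> else - \<i>)) = of_real (ln \<bar>y\<bar>) + Ln (if y < 0 then \<i> else - \<i>)"
    using assms by (subst Ln_times_of_real) (auto simp: Ln_of_real)
  moreover have "- \<i> * of_real y = of_real \<bar>y\<bar> * (if y < 0 then \<i> else - \<i>)"
    by auto
  ultimately show ?thesis by (auto simp: logu_def)
qed

lemma norm_logu_le:
  assumes "z \<noteq> 0"
  shows "norm (logu z) \<le> \<bar>ln (norm z)\<bar> + 2 * pi"
proof -
  have "norm (Ln (- \<i> * z)) \<le> \<bar>Re (Ln (- \<i> * z))\<bar> + \<bar>Im (Ln (- \<i> * z))\<bar>"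
    by (rule cmod_le)
  also have "\<bar>Im (Ln (- \<i> * z))\<bar> \<le> pi"
    using Im_Ln_le_pi[of "- \<i> * z"] mpi_less_Im_Ln[of "- \<i> * z"] assms by auto
  also have "Re (Ln (- \<i> * z)) = ln (norm z)" using assms by (simp add: norm_mult)
  finally have 1: "norm (Ln (- \<i> * z)) \<le> \<bar>ln (norm z)\<bar> + pi" by simp
  have "norm (logu z) \<le> norm (Ln (- \<i> * z)) + norm (\<i> * pi / 2)"
    unfolding logu_def by (rule norm_triangle_ineq)
  also have "norm (\<i> * complex_of_real pi / 2) = pi / 2" by (simp add: norm_mult norm_divide)
  finally show ?thesis using 1 pi_gt_zero by linarith
qed

lemma logu_field_differentiable:
  assumes "z \<in> UH" "z \<noteq> 0"
  shows "logu field_differentiable (at z)"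
proof -
  have "((\<lambda>z. Ln (- \<i> * z) + \<i> * pi / 2) has_field_derivative (1 / (- \<i> * z) * (- \<i>))) (at z)"
    using UH_rotate_notin[OF assms] assms by (auto intro!: derivative_eq_intros simp: field_simps)
  then show ?thesis unfolding logu_def[abs_def] field_differentiable_def by blast
qed

lemma tendsto_zlogu_0: "((\<lambda>z. z * logu z) \<longlongrightarrow> 0) (at 0)"
proof (rule Lim_null_comparison)
  show "\<forall>\<^sub>F z in at 0. norm (z * logu z) \<le> norm z * (\<bar>ln (norm z)\<bar> + 2 * pi)"
    unfolding eventually_at_filter
    by (rule always_eventually) (auto simp: norm_mult intro!: mult_left_mono norm_logu_le)
  have "((\<lambda>x. x * (\<bar>ln x\<bar> + 2 * pi)) \<longlongrightarrow> (0::real)) (at_right 0)"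
    by real_asymp
  moreover have "filterlim (norm :: complex \<Rightarrow> real) (at_right 0) (at 0)"
    unfolding filterlim_at by (auto simp: eventually_at_filter intro!: tendsto_eq_intros)
  ultimately show "((\<lambda>z::complex. norm z * (\<bar>ln (norm z)\<bar> + 2 * pi)) \<longlongrightarrow> 0) (at 0)"
    by (rule filterlim_compose)
qed

lemma continuous_on_zlogu: "continuous_on UH (\<lambda>z. z * logu z)"
  unfolding continuous_on_eq_continuous_within
proof
  fix z assume z: "z \<in> UH"
  show "continuous (at z within UH) (\<lambda>z. z * logu z)"
  proof (cases "z = 0")
    case True
    then show ?thesis using tendsto_zlogu_0
      by (auto simp: continuous_within intro: tendsto_within_subset)
  next
    case False
    have "isCont logu z"
      by (rule field_differentiable_imp_continuous_at[OF logu_field_differentiable[OF z False]])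
    then have "isCont (\<lambda>z. z * logu z) z" by (intro continuous_intros)
    then show ?thesis using continuous_at_imp_continuous_at_within by blast
  qed
qed

lemma zlogu_of_real:
  "of_real y * logu (of_real y) = of_real (y * ln \<bar>y\<bar>) + (if y < 0 then \<i> * of_real (pi * y) else 0)"
  by (cases "y = 0") (auto simp: logu_of_real algebra_simps)

text \<open>Read off as the real part of \<open>z * logu z\<close>, so the singularity at 0 is
  treated only once.\<close>

lemma continuous_on_xlnx: "continuous_on S (\<lambda>y::real. y * ln \<bar>y\<bar>)"
proof -
  have "continuous_on S (\<lambda>y. Re (of_real y * logu (of_real y)))"
    by (intro continuous_intros continuous_on_compose2[OF continuous_on_zlogu]) auto
  moreover have "Re (of_real y * logu (of_real y)) = y * ln \<bar>y\<bar>" for y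
    unfolding zlogu_of_real by simp
  ultimately show ?thesis by (simp only:)
qed

text \<open>The closed form of the integral of \<open>logu (z - x)\<close> over \<open>x\<close> in \<open>{a..b}\<close>; unlike \<open>logu\<close> it is continuous up to the real axis.\<close>
definition Psi :: "real \<Rightarrow> real \<Rightarrow> complex \<Rightarrow> complex" where
  "Psi a b z = (z - a) * logu (z - a) - (z - b) * logu (z - b) - (b - a)"

text \<open>The integral of \<open>ln \<bar>x - y\<bar>\<close> over x in {a..b}, which is also the
  real part of \<open>Psi\<close> on the axis.\<close>

definition Lam :: "real \<Rightarrow> real \<Rightarrow> real \<Rightarrow> real" where
  "Lam a b y = (y - a) * ln \<bar>y - a\<bar> - (y - b) * ln \<bar>y - b\<bar> - (b - a)"

lemma Re_Psi: "Re (Psi a b (of_real y)) = Lam a b y"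
  unfolding Psi_def Lam_def of_real_diff[symmetric] zlogu_of_real by simp

text \<open>For a <= b this is pi times the length of the part of {a..b} to the right of y, because
  y - x has argument pi exactly for x > y.\<close>

lemma Im_Psi: "Im (Psi a b (of_real y)) = (if y < a then pi * (y - a) else 0) - (if y < b then pi * (y - b) else 0)"
  unfolding Psi_def of_real_diff[symmetric] zlogu_of_real by simp

lemma UH_shift: "z - of_real a \<in> UH \<longleftrightarrow> z \<in> UH"
  by (simp add: UH_def)

lemma continuous_on_Psi: "continuous_on UH (Psi a b)"
  unfolding Psi_def
  by (intro continuous_intros continuous_on_compose2[OF continuous_on_zlogu, of _ "\<lambda>z. z - of_real a"]
      continuous_on_compose2[OF continuous_on_zlogu, of _ "\<lambda>z. z - of_real b"]) (auto simp: UH_shift)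

lemma logu_shift_differentiable:
  assumes "z \<in> UH" "z \<noteq> of_real a"
  shows "(\<lambda>z. logu (z - of_real a)) field_differentiable (at z)"
proof -
  have "(logu \<circ> (\<lambda>z. z - of_real a)) field_differentiable (at z)"
    by (intro field_differentiable_compose logu_field_differentiable)
       (use assms in \<open>auto simp: UH_shift intro!: derivative_intros\<close>)
  then show ?thesis by (simp add: o_def)
qed

lemma Psi_differentiable:
  assumes "z \<in> UH" "z \<noteq> of_real a" "z \<noteq> of_real b"
  shows "Psi a b field_differentiable (at z)"
  unfolding Psi_def[abs_def]
  by (intro field_differentiable_diff field_differentiable_mult logu_shift_differentiable assms
     field_differentiable_ident field_differentiable_const)

text \<open>The argument of - i z is at most pi / 2 in absolute value and that of 1 - a / z is less,
  so their sum stays inside (-pi, pi) and \<open>Ln\<close> is additive.\<close>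

lemma logu_shift:
  assumes z: "z \<in> UH" "z \<noteq> 0" and n: "norm z > \<bar>a\<bar>"
  shows "logu (z - of_real a) = logu z + Ln (1 - of_real a / z)"
proof -
  define w where "w = 1 - of_real a / z"
  have "norm (of_real a / z) < 1" using n z by (simp add: norm_divide)
  then have "Re (of_real a / z) < 1" using complex_Re_le_cmod[of "of_real a / z"] by linarith
  then have Rew: "Re w > 0" by (simp add: w_def)
  then have w0: "w \<noteq> 0" by auto
  have iw: "\<bar>Im (Ln w)\<bar> < pi / 2" by (rule Re_Ln_pos_lt_imp[OF Rew])
  have iz: "\<bar>Im (Ln (- \<i> * z))\<bar> \<le> pi / 2"
    using Re_Ln_pos_le[of "- \<i> * z"] z by (auto simp: UH_def)
  have "- \<i> * (z - of_real a) = (- \<i> * z) * w" using z by (simp add: w_def algebra_simps)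
  then have "Ln (- \<i> * (z - of_real a)) = Ln (- \<i> * z) + Ln w"
    using iw iz z w0 by (subst \<open>- \<i> * (z - of_real a) = _\<close>, subst Ln_times_simple) auto
  then show ?thesis by (simp add: logu_def w_def)
qed

lemma inverse_tendsto_uhinf: "((\<lambda>z. c / z) \<longlongrightarrow> 0) uhinf"
  using tendsto_mult[OF tendsto_const[of c] tendsto_inverse_0[THEN filterlim_compose, OF uhinf_tendsto_id_at_infinity]]
  by (simp add: field_simps)

lemma logu_over_tendsto: "((\<lambda>z. logu z / z) \<longlongrightarrow> 0) uhinf"
proof (rule Lim_null_comparison)
  show "\<forall>\<^sub>F z in uhinf. norm (logu z / z) \<le> (\<bar>ln (norm z)\<bar> + 2 * pi) / norm z"
    unfolding eventually_uhinf
  proof (intro exI[of _ 1] conjI ballI impI)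
    fix z :: complex assume "1 \<le> norm z"
    then have "z \<noteq> 0" by auto
    then show "norm (logu z / z) \<le> (\<bar>ln (norm z)\<bar> + 2 * pi) / norm z"
      unfolding norm_divide by (intro divide_right_mono norm_logu_le) auto
  qed auto
  have "((\<lambda>x. (\<bar>ln x\<bar> + 2 * pi) / x) \<longlongrightarrow> (0::real)) at_top"
    by real_asymp
  moreover have "filterlim norm at_top uhinf"
    by (rule filterlim_at_infinity_imp_norm_at_top[OF uhinf_tendsto_id_at_infinity])
  ultimately show "((\<lambda>z::complex. (\<bar>ln (norm z)\<bar> + 2 * pi) / norm z) \<longlongrightarrow> 0) uhinf"
    by (rule filterlim_compose)
qed

text \<open>The two z log z terms cancel; what remains grows like (b - a) log z.\<close>

lemma Psi_over_tendsto: "((\<lambda>z. Psi a b z / z) \<longlongrightarrow> 0) uhinf"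
proof -
  have L: "((\<lambda>z. Ln (1 - of_real c / z)) \<longlongrightarrow> 0) uhinf" for c :: real
  proof -
    have "((\<lambda>z. Ln (1 - of_real c / z)) \<longlongrightarrow> Ln (1 - 0)) uhinf"
      by (intro tendsto_Ln tendsto_intros inverse_tendsto_uhinf) auto
    then show ?thesis by simp
  qed
  have "((\<lambda>z. of_real (b - a) * (logu z / z) + (1 - of_real a / z) * Ln (1 - of_real a / z)
           - (1 - of_real b / z) * Ln (1 - of_real b / z) - of_real (b - a) / z)
          \<longlongrightarrow> of_real (b - a) * 0 + (1 - 0) * 0 - (1 - 0) * 0 - 0) uhinf"
    by (intro tendsto_intros L inverse_tendsto_uhinf logu_over_tendsto)
  moreover have "\<forall>\<^sub>F z in uhinf. of_real (b - a) * (logu z / z) + (1 - of_real a / z) * Ln (1 - of_real a / z)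
           - (1 - of_real b / z) * Ln (1 - of_real b / z) - of_real (b - a) / z = Psi a b z / z"
    unfolding eventually_uhinf
  proof (intro exI[of _ "1 + \<bar>a\<bar> + \<bar>b\<bar>"] conjI ballI impI)
    fix z assume z: "z \<in> UH" "1 + \<bar>a\<bar> + \<bar>b\<bar> \<le> norm z"
    then have z0: "z \<noteq> 0" by auto
    show "of_real (b - a) * (logu z / z) + (1 - of_real a / z) * Ln (1 - of_real a / z)
           - (1 - of_real b / z) * Ln (1 - of_real b / z) - of_real (b - a) / z = Psi a b z / z"
      unfolding Psi_def using z z0 by (simp add: logu_shift field_simps)
  qed auto
  ultimately show ?thesis by (simp add: filterlim_cong)
qed

section \<open>The logarithmic kernel integrated over an interval\<close>

lemma has_integral_ln_dist:
  assumes "a \<le> b"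
  shows "((\<lambda>x. ln \<bar>x - y\<bar>) has_integral Lam a b y) {a..b}"
proof -
  \<comment> \<open>This primitive is continuous across x = y, so y can be the single exceptional
    point of the fundamental theorem.\<close>
  define F where "F x = (x - y) * ln \<bar>x - y\<bar> - x" for x :: real
  have "((\<lambda>x. ln \<bar>x - y\<bar>) has_integral F b - F a) {a..b}"
  proof (rule fundamental_theorem_of_calculus_interior_strong[where S="{y}"])
    show "continuous_on {a..b} F"
      unfolding F_def
      by (intro continuous_intros continuous_on_compose2[OF continuous_on_xlnx[of UNIV], where f="\<lambda>x. x - y"]) auto
    fix x assume "x \<in> {a<..<b} - {y}"
    then have ne: "x - y \<noteq> 0" by auto
    have "((\<lambda>x. ln \<bar>x - y\<bar>) has_real_derivative 1 / (x - y)) (at x)"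
    proof (cases "x > y")
      case True
      have "((\<lambda>x. ln (x - y)) has_real_derivative 1 / (x - y)) (at x)"
        using True by (auto intro!: derivative_eq_intros)
      then show ?thesis
        by (rule has_field_derivative_transform_within_open[where S="{y<..}"]) (use True in auto)
    next
      case False
      then have "x < y" using ne by auto
      have "((\<lambda>x. ln (y - x)) has_real_derivative 1 / (x - y)) (at x)"
        using \<open>x < y\<close> by (auto intro!: derivative_eq_intros simp: field_simps)
      then show ?thesis
        by (rule has_field_derivative_transform_within_open[where S="{..<y}"]) (use \<open>x < y\<close> in auto)
    qed
    then have "(F has_real_derivative (1 * ln \<bar>x - y\<bar> + (1 / (x - y)) * (x - y)) - 1) (at x)"
      unfolding F_def by (intro DERIV_diff DERIV_mult DERIV_ident) (auto intro!: derivative_eq_intros)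
    then have "(F has_real_derivative ln \<bar>x - y\<bar>) (at x)" using ne by simp
    then show "(F has_vector_derivative ln \<bar>x - y\<bar>) (at x)"
      by (simp add: has_real_derivative_iff_has_vector_derivative)
  qed (use assms in auto)
  moreover have "F b - F a = Lam a b y"
    by (simp add: F_def Lam_def abs_minus_commute algebra_simps)
  ultimately show ?thesis by simp
qed

text \<open>A nonnegative upper bound for the kernel over x in {a..b}. Subtracting the kernel from
  it leaves a nonnegative function, for which integrability is absolute.\<close>

definition Mb :: "real \<Rightarrow> real \<Rightarrow> real \<Rightarrow> real" where
  "Mb a b y = ln (1 + \<bar>a\<bar> + \<bar>b\<bar> + \<bar>y\<bar>)"

lemma Mb_nonneg: "Mb a b y \<ge> 0"
  by (simp add: Mb_def)

lemma ln_dist_le_Mb: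
  assumes "x \<in> {a..b}"
  shows "ln \<bar>x - y\<bar> \<le> Mb a b y"
proof (cases "x = y")
  case False
  then show ?thesis unfolding Mb_def using assms by (subst ln_le_cancel_iff) auto
qed (simp add: Mb_nonneg)

lemma set_integrable_const_Icc: "set_integrable lborel {a..b::real} (\<lambda>x. c::real)"
  by (rule borel_integrable_atLeastAtMost') (rule continuous_on_const)

lemma set_integrable_ln_dist:
  assumes "a \<le> b"
  shows "set_integrable lborel {a..b} (\<lambda>x. ln \<bar>x - y\<bar>)"
    and "(LINT x:{a..b}|lborel. ln \<bar>x - y\<bar>) = Lam a b y"
proof -
  have "(\<lambda>x. Mb a b y - ln \<bar>x - y\<bar>) integrable_on {a..b}"
    by (intro integrable_diff integrable_on_const has_integral_integrable[OF has_integral_ln_dist] assms)  auto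
  then have "(\<lambda>x. Mb a b y - ln \<bar>x - y\<bar>) absolutely_integrable_on {a..b}"
    by (intro nonnegative_absolutely_integrable_1) (auto simp: ln_dist_le_Mb)
  then have "set_integrable lborel {a..b} (\<lambda>x. Mb a b y - ln \<bar>x - y\<bar>)"
    unfolding set_integrable_def by (subst (asm) integrable_completion) auto
  then have "set_integrable lborel {a..b} (\<lambda>x. Mb a b y - (Mb a b y - ln \<bar>x - y\<bar>))"
    by (rule set_integral_diff(1)[OF set_integrable_const_Icc])
  then show *: "set_integrable lborel {a..b} (\<lambda>x. ln \<bar>x - y\<bar>)" by simp
  show "(LINT x:{a..b}|lborel. ln \<bar>x - y\<bar>) = Lam a b y"
    using set_borel_integral_eq_integral(2)[OF *] integral_unique[OF has_integral_ln_dist[OF assms]] by simp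
qed

lemma continuous_on_Lam: "continuous_on S (Lam a b)"
  unfolding Lam_def
  by (intro continuous_intros continuous_on_compose2[OF continuous_on_xlnx[of UNIV], where f="\<lambda>x. x - a"]
        continuous_on_compose2[OF continuous_on_xlnx[of UNIV], where f="\<lambda>x. x - b"]) auto

text \<open>Far from {a..b} all distances are at least 1 and the logarithms nonnegative; on the
  remaining compact set continuity suffices.\<close>

lemma Lam_bounded_below:
  assumes "a \<le> b"
  obtains K where "K \<ge> 0" "\<And>y. - K \<le> Lam a b y"
proof -
  define r where "r = 1 + \<bar>a\<bar> + \<bar>b\<bar>"
  have "compact (Lam a b ` {-r..r})"
    by (intro compact_continuous_image continuous_on_Lam) auto
  then obtain K where K: "\<And>y. y \<in> {-r..r} \<Longrightarrow> \<bar>Lam a b y\<bar> \<le> K"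
    using compact_imp_bounded[of "Lam a b ` {-r..r}"] unfolding bounded_iff
    by (metis image_eqI real_norm_def)
  have "K \<ge> 0" using K[of 0] by (force simp: r_def)
  moreover have "- K \<le> Lam a b y" for y
  proof (cases "y \<in> {-r..r}")
    case True then show ?thesis using K[of y] by linarith
  next
    case False
    have "0 \<le> Lam a b y"
    proof (rule has_integral_nonneg[OF has_integral_ln_dist[OF assms]])
      fix x assume "x \<in> {a..b}"
      then have "1 \<le> \<bar>x - y\<bar>" using False by (auto simp: r_def)
      then show "0 \<le> ln \<bar>x - y\<bar>" by simp
    qed
    then show ?thesis using \<open>K \<ge> 0\<close> by linarith
  qed
  ultimately show ?thesis using that by blast
qed

text \<open>From \<open>\<bar>t\<bar> \<le> 2 * M - t\<close> for t <= M and M >= 0. The bound grows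
  only logarithmically in y, which the decay of the density can absorb.\<close>

lemma abs_ln_dist_integral_le:
  assumes "a \<le> b"
  obtains K where "K \<ge> 0" "\<And>y. (LINT x:{a..b}|lborel. \<bar>ln \<bar>x - y\<bar>\<bar>) \<le> K + 2 * (b - a) * Mb a b y"
proof -
  obtain K where K: "K \<ge> 0" "\<And>y. - K \<le> Lam a b y" using Lam_bounded_below[OF assms] by blast
  have "(LINT x:{a..b}|lborel. \<bar>ln \<bar>x - y\<bar>\<bar>) \<le> K + 2 * (b - a) * Mb a b y" for y
  proof -
    have "(LINT x:{a..b}|lborel. \<bar>ln \<bar>x - y\<bar>\<bar>) \<le> (LINT x:{a..b}|lborel. 2 * Mb a b y - ln \<bar>x - y\<bar>)"
    proof (rule set_integral_mono)
      show "set_integrable lborel {a..b} (\<lambda>x. \<bar>ln \<bar>x - y\<bar>\<bar>)"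
        using set_integrable_abs[OF set_integrable_ln_dist(1)[OF assms]] by simp
      show "set_integrable lborel {a..b} (\<lambda>x. 2 * Mb a b y - ln \<bar>x - y\<bar>)"
        by (rule set_integral_diff(1)[OF set_integrable_const_Icc set_integrable_ln_dist(1)[OF assms]])
      fix x assume "x \<in> {a..b}"
      then show "\<bar>ln \<bar>x - y\<bar>\<bar> \<le> 2 * Mb a b y - ln \<bar>x - y\<bar>"
        using ln_dist_le_Mb[of x a b y] Mb_nonneg[of a b y] by (simp add: abs_if)
    qed
    also have "\<dots> = (LINT x:{a..b}|lborel. 2 * Mb a b y) - Lam a b y"
      using set_integral_diff(2)[OF set_integrable_const_Icc set_integrable_ln_dist(1)[OF assms]]
        set_integrable_ln_dist(2)[OF assms] by simp
    also have "(LINT x:{a..b}|lborel. 2 * Mb a b y) = 2 * (b - a) * Mb a b y"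
      using assms by (simp add: set_lebesgue_integral_def)
    finally show ?thesis using K(2)[of y] by linarith
  qed
  then show ?thesis using that K(1) by blast
qed

lemma integrable_powr_tail:
  assumes "b > (0::real)" "e < -1"
  shows "integrable lborel (\<lambda>y. indicat_real {b..} y * y powr e)"
proof -
  have "(\<lambda>y. y powr e) integrable_on {b..}"
    using has_integral_powr_to_inf[OF assms(2,1)] by blast
  then have "(\<lambda>y. y powr e) absolutely_integrable_on {b..}"
    by (intro nonnegative_absolutely_integrable_1) auto
  then show ?thesis
    unfolding set_integrable_def by (subst (asm) integrable_completion) auto
qed

lemma integrable_if_tail_le:
  fixes h :: "real \<Rightarrow> real"
  assumes [measurable]: "h \<in> borel_measurable borel" and b: "b > 0" and e: "e < -1"
    and 1: "AE y in lborel. \<bar>y\<bar> \<le> b \<longrightarrow> \<bar>h y\<bar> \<le> K"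
    and 2: "AE y in lborel. \<bar>y\<bar> \<ge> b \<longrightarrow> \<bar>h y\<bar> \<le> C * \<bar>y\<bar> powr e"
  shows "integrable lborel h"
proof -
  define k where "k y = indicat_real {b..} y * y powr e" for y
  have k: "integrable lborel k" unfolding k_def by (rule integrable_powr_tail[OF b e])
  have k': "integrable lborel (\<lambda>y. k (- y))"
    using lborel_integrable_real_affine[OF k, of "-1" 0] by simp
  define w where "w y = K * indicat_real {-b..b} y + C * (k y + k (- y))" for y
  have w: "integrable lborel w"
    unfolding w_def by (intro Bochner_Integration.integrable_add integrable_mult_right k k')
      (use set_integrable_const_Icc[of "-b" b 1] in \<open>simp add: set_integrable_def\<close>)
  show ?thesis
  proof (rule Bochner_Integration.integrable_bound[OF integrable_abs[OF w]])
    show "h \<in> borel_measurable lborel" by simp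
    \<comment> \<open>The points b and -b are discarded: there both parts of \<open>w\<close> can
      contribute, and \<open>C\<close> carries no sign.\<close>
    show "AE y in lborel. norm (h y) \<le> norm \<bar>w y\<bar>"
      using 1 2 AE_lborel_singleton[of b] AE_lborel_singleton[of "-b"]
    proof eventually_elim
      case (elim y)
      have "\<bar>h y\<bar> \<le> w y"
      proof (cases "\<bar>y\<bar> \<le> b")
        case True
        then have "k y = 0" "k (- y) = 0" using elim by (auto simp: k_def indicator_def)
        then show ?thesis using True elim by (auto simp: w_def indicator_def abs_le_iff)
      next
        case False
        then have "k y + k (- y) = \<bar>y\<bar> powr e" using b by (auto simp: k_def indicator_def)
        then show ?thesis using False elim by (auto simp: w_def indicator_def)
      qed
      then show ?case by simp
    qed
  qed
qed

section \<open>The potential of a half-plane density\<close>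

text \<open>The sets over which h integrates to 0 form a Dynkin system containing the intervals. Its
  complement step needs a vanishing total integral, obtained as a limit over {-r..r}.\<close>

lemma AE_zero_if_interval_integrals_zero:
  fixes h :: "real \<Rightarrow> real"
  assumes h: "integrable lborel h"
    and z: "\<And>a b. a \<le> b \<Longrightarrow> (LINT x:{a..b}|lborel. h x) = 0"
  shows "AE x in lborel. h x = 0"
proof -
  have hs: "set_integrable lborel A h" if "A \<in> sets borel" for A
    using h that unfolding set_integrable_def by (intro integrable_mult_indicator) auto
  have tot: "(\<integral>x. h x \<partial>lborel) = 0"
  proof (rule tendsto_unique[OF _ tendsto_symmetric_interval_integral[OF h]])
    show "((\<lambda>r. LINT y:{-r..r}|lborel. h y) \<longlongrightarrow> 0) at_top"
      by (rule tendsto_eventually, rule eventually_mono[OF eventually_ge_at_top[of 0]]) (simp add: z)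
  qed simp
  have "(LINT x:A|lborel. h x) = 0" if "A \<in> sets borel" for A
    using that
  proof (induction rule: borel_set_induct)
    case (compl A)
    have "(LINT x:A \<union> - A|lborel. h x) = (LINT x:A|lborel. h x) + (LINT x:- A|lborel. h x)"
      using compl by (intro set_integral_Un hs) auto
    then show ?case using compl tot by (simp add: set_lebesgue_integral_def)
  next
    case (union F)
    have "(LINT x:(\<Union>i. F i)|lborel. h x) = (\<Sum>i. LINT x:F i|lborel. h x)"
      using union by (intro lebesgue_integral_countable_add hs) (auto simp: disjoint_family_on_def)
    then show ?case using union by simp
  next
    case empty show ?case by (simp add: set_lebesgue_integral_def)
  next
    case (interval a b) then show ?case by (rule z)
  qed
  then have "AE x in lborel. h x = (\<lambda>_. 0) x"
    by (intro density_unique_real h) (auto simp: set_lebesgue_integral_def)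
  then show ?thesis by simp
qed

lemma holomorphic_on_Psi: "Psi a b holomorphic_on {z. 0 < Im z}"
  unfolding holomorphic_on_def
proof
  fix z :: complex assume "z \<in> {z. 0 < Im z}"
  then show "Psi a b field_differentiable at z within {z. 0 < Im z}"
    by (intro field_differentiable_at_within[OF Psi_differentiable]) (auto simp: UH_def)
qed

section \<open>Decay, neutrality, potential and energy\<close>

context half_plane_density
begin

text \<open>On the axis the subtracted poles are purely imaginary, so the real part of the tail
  condition bounds \<open>f\<close> itself, except at the atoms, where \<open>f\<close> is not tied
  to \<open>g\<close>.\<close>

lemma f_bounds:
  obtains b C where "b > 0" "C \<ge> 0" "\<And>y. \<bar>y\<bar> \<ge> b \<Longrightarrow> y \<notin> snd ` set ats \<Longrightarrow> \<bar>f y\<bar> \<le> C / y\<^sup>2"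
proof -
  let ?G = "\<lambda>z. g z + sum_list (map (\<lambda>(m, p). \<i> * of_real m / (of_real pi * (z - of_real p))) ats)"
  obtain b where b: "b > 0" "\<And>z. z \<in> UH \<Longrightarrow> norm z \<ge> b \<Longrightarrow> dist (z\<^sup>2 * ?G z) (of_real c1) < 1"
    using tendstoD[OF tail, of 1] unfolding eventually_uhinf by auto
  have "\<bar>f y\<bar> \<le> (\<bar>c1\<bar> + 1) / y\<^sup>2" if y: "\<bar>y\<bar> \<ge> b" "y \<notin> snd ` set ats" for y
  proof -
    have y0: "y \<noteq> 0" using b y by auto
    have "Re (sum_list (map (\<lambda>(m, p). \<i> * of_real m / (of_real pi * (of_real y - of_real p))) ats)) = 0"
    proof -
      have "Re (\<i> * of_real m / (of_real pi * (of_real y - of_real p))) = 0" for m p :: real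
        unfolding of_real_diff[symmetric] of_real_mult[symmetric] Re_divide_of_real by simp
      then show ?thesis unfolding sum_list_pairs_nth by simp
    qed
    then have "Re (?G (of_real y)) = f y" using f_eq[OF y(2)] by simp
    moreover have "Re ((of_real y)\<^sup>2 * ?G (of_real y)) = y\<^sup>2 * Re (?G (of_real y))"
      unfolding of_real_power[symmetric] by simp
    ultimately have "y\<^sup>2 * f y = Re ((of_real y)\<^sup>2 * ?G (of_real y))" by simp
    also have "\<bar>\<dots>\<bar> \<le> norm ((of_real y)\<^sup>2 * ?G (of_real y))" by (rule abs_Re_le_cmod)
    also have "\<dots> \<le> \<bar>c1\<bar> + 1"
    proof -
      have "dist ((of_real y)\<^sup>2 * ?G (of_real y)) (of_real c1) < 1" using y by (intro b) auto
      then show ?thesis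
        using norm_triangle_sub[of "(of_real y)\<^sup>2 * ?G (of_real y)" "of_real c1"] by (simp add: dist_norm)
    qed
    finally have "y\<^sup>2 * \<bar>f y\<bar> \<le> \<bar>c1\<bar> + 1" by (simp add: abs_mult)
    then show ?thesis using y0 by (simp add: field_simps)
  qed
  then show ?thesis using that[of b "\<bar>c1\<bar> + 1"] b by auto
qed

text \<open>Half a power of |y| absorbs the logarithm: split the decay 1 / y^2 as |y|^(-1/2)
  |y|^(-3/2). On bounded sets \<open>f\<close> agrees a.e. with the continuous Re g.\<close>

lemma integrable_log_density:
  assumes k: "k \<ge> 1" and K: "K \<ge> 0"
  shows "integrable lborel (\<lambda>y. (K + K' * ln (k + \<bar>y\<bar>)) * \<bar>f y\<bar>)"
proof -
  obtain b0 C where bC: "b0 > 0" "C \<ge> 0" "\<And>y. \<bar>y\<bar> \<ge> b0 \<Longrightarrow> y \<notin> snd ` set ats \<Longrightarrow> \<bar>f y\<bar> \<le> C / y\<^sup>2"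
    using f_bounds by blast
  have "\<forall>\<^sub>F t in at_top. \<bar>(K + K' * ln (k + t)) * t powr (- 1 / 2)\<bar> < (1::real)"
  proof -
    have "((\<lambda>t. (K + K' * ln (k + t)) * t powr (- 1 / 2)) \<longlongrightarrow> 0) at_top"
      by real_asymp
    from tendstoD[OF this, of 1] show ?thesis by simp
  qed
  then obtain b1 where b1: "\<And>t. t \<ge> b1 \<Longrightarrow> \<bar>(K + K' * ln (k + t)) * t powr (- 1 / 2)\<bar> < 1"
    unfolding eventually_at_top_linorder by blast
  define b where "b = max b0 b1"
  have b: "b > 0" using bC by (simp add: b_def)
  define h where "h y = (K + K' * ln (k + \<bar>y\<bar>)) * \<bar>f y\<bar>" for y
  have "continuous_on {-b..b} (\<lambda>y. (K + K' * ln (k + \<bar>y\<bar>)) * \<bar>Re (g (of_real y))\<bar>)"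
    using k by (intro continuous_intros continuous_on_compose2[OF cont_g]) auto
  then have "compact ((\<lambda>y. (K + K' * ln (k + \<bar>y\<bar>)) * \<bar>Re (g (of_real y))\<bar>) ` {-b..b})"
    by (intro compact_continuous_image) auto
  then obtain B where "\<forall>y\<in>{-b..b}. \<bar>(K + K' * ln (k + \<bar>y\<bar>)) * \<bar>Re (g (of_real y))\<bar>\<bar> \<le> B"
    by (auto dest!: compact_imp_bounded simp: bounded_iff)
  then have B: "\<And>y. y \<in> {-b..b} \<Longrightarrow> \<bar>(K + K' * ln (k + \<bar>y\<bar>)) * \<bar>Re (g (of_real y))\<bar>\<bar> \<le> B" by blast
  have "integrable lborel h"
  proof (rule integrable_if_tail_le[OF _ b, where e="-3/2" and K=B and C=C])
    show "h \<in> borel_measurable borel" unfolding h_def by measurable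
    show "AE y in lborel. \<bar>y\<bar> \<le> b \<longrightarrow> \<bar>h y\<bar> \<le> B"
      using AE_not_atom
    proof eventually_elim
      case (elim y) then show ?case using B[of y] by (simp add: h_def f_eq abs_le_iff)
    qed
    show "AE y in lborel. \<bar>y\<bar> \<ge> b \<longrightarrow> \<bar>h y\<bar> \<le> C * \<bar>y\<bar> powr (-3/2)"
      using AE_not_atom
    proof eventually_elim
      case (elim y)
      show ?case
      proof
        assume y: "\<bar>y\<bar> \<ge> b"
        then have y0: "\<bar>y\<bar> > 0" using b by linarith
        have 1: "\<bar>f y\<bar> \<le> C / y\<^sup>2" using bC(3)[of y] y elim by (simp add: b_def)
        have 2: "\<bar>K + K' * ln (k + \<bar>y\<bar>)\<bar> * \<bar>y\<bar> powr (- 1 / 2) \<le> 1"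
          using b1[of "\<bar>y\<bar>"] y by (simp add: b_def abs_mult)
        have "\<bar>h y\<bar> \<le> \<bar>K + K' * ln (k + \<bar>y\<bar>)\<bar> * (C / y\<^sup>2)"
          unfolding h_def abs_mult by (intro mult_left_mono) (use 1 in auto)
        also have "C / y\<^sup>2 = C * (\<bar>y\<bar> powr (-1/2) * \<bar>y\<bar> powr (-3/2))"
        proof -
          have "\<bar>y\<bar> powr (-1/2) * \<bar>y\<bar> powr (-3/2) = \<bar>y\<bar> powr (-1/2 + -3/2)"
            by (rule powr_add[symmetric])
          also have "\<dots> = \<bar>y\<bar> powr (- real 2)" by simp
          also have "\<dots> = inverse (y\<^sup>2)" using y0 by (simp only: powr_minus powr_realpow) simp
          finally show ?thesis by (simp add: field_simps)
        qed
        also have "\<bar>K + K' * ln (k + \<bar>y\<bar>)\<bar> * (C * (\<bar>y\<bar> powr (-1/2) * \<bar>y\<bar> powr (-3/2)))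
            = (\<bar>K + K' * ln (k + \<bar>y\<bar>)\<bar> * \<bar>y\<bar> powr (-1/2)) * (C * \<bar>y\<bar> powr (-3/2))" by simp
        also have "\<dots> \<le> 1 * (C * \<bar>y\<bar> powr (-3/2))"
          by (intro mult_right_mono) (use 2 bC in auto)
        finally show "\<bar>h y\<bar> \<le> C * \<bar>y\<bar> powr (-3/2)" by simp
      qed
    qed
  qed auto
  then show ?thesis by (simp add: h_def[abs_def])
qed

lemma integrable_f: "integrable lborel f"
proof (rule Bochner_Integration.integrable_bound[OF integrable_log_density[of 1 1 0]])
  show "AE x in lborel. norm (f x) \<le> norm ((1 + 0 * ln (1 + \<bar>x\<bar>)) * \<bar>f x\<bar>)" by simp
qed auto

text \<open>The constant test function 1 has slope 0 at infinity, so the right-hand side of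
  \<open>test_function_identity\<close> vanishes.\<close>

lemma neutral: "(\<integral>y. f y \<partial>lborel) + sum_list (map fst ats) = 0"
proof -
  have "(\<integral>y. Re ((\<lambda>_. 1) (complex_of_real y)) * f y \<partial>lborel)
         + sum_list (map (\<lambda>(m, p). m * Re ((\<lambda>_. 1) (complex_of_real p))) ats) = pi * c1 * Im 0"
    by (rule test_function_identity[where E="\<lambda>_. 1"])
       (auto intro!: continuous_intros inverse_tendsto_uhinf[of 1, simplified] simp: integrable_f)
  moreover have "(\<lambda>(m::real, p::real). m * Re 1) = fst" by auto
  ultimately show ?thesis by simp
qed

text \<open>Tonelli: integrating the absolute kernel in x first leaves logarithmic growth in y,
  which is integrable against |f|.\<close>

lemma integrable_log_kernel:
  assumes "a \<le> b"
  shows "integrable (lborel \<Otimes>\<^sub>M lborel) (\<lambda>(y, x). indicat_real {a..b} x * ln \<bar>x - y\<bar> * f y)"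
proof -
  obtain K where K: "K \<ge> 0" "\<And>y. (LINT x:{a..b}|lborel. \<bar>ln \<bar>x - y\<bar>\<bar>) \<le> K + 2 * (b - a) * Mb a b y"
    using abs_ln_dist_integral_le[OF assms] by blast
  have eq: "(\<integral>x. norm (indicat_real {a..b} x * ln \<bar>x - y\<bar> * f y) \<partial>lborel)
      = (LINT x:{a..b}|lborel. \<bar>ln \<bar>x - y\<bar>\<bar>) * \<bar>f y\<bar>" for y
    by (simp add: set_lebesgue_integral_def abs_mult)
  show ?thesis
  proof (rule lborel_pair.Fubini_integrable)
    show "(\<lambda>(y, x). indicat_real {a..b} x * ln \<bar>x - y\<bar> * f y) \<in> borel_measurable (lborel \<Otimes>\<^sub>M lborel)"
      by measurable
    have "integrable lborel (\<lambda>y. (K + (2 * (b - a)) * ln ((1 + \<bar>a\<bar> + \<bar>b\<bar>) + \<bar>y\<bar>)) * \<bar>f y\<bar>)"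
      by (rule integrable_log_density) (use K in auto)
    then have "integrable lborel (\<lambda>y. (LINT x:{a..b}|lborel. \<bar>ln \<bar>x - y\<bar>\<bar>) * \<bar>f y\<bar>)"
    proof (rule Bochner_Integration.integrable_bound)
      show "(\<lambda>y. (LINT x:{a..b}|lborel. \<bar>ln \<bar>x - y\<bar>\<bar>) * \<bar>f y\<bar>) \<in> borel_measurable lborel"
        unfolding set_lebesgue_integral_def by measurable
      show "AE y in lborel. norm ((LINT x:{a..b}|lborel. \<bar>ln \<bar>x - y\<bar>\<bar>) * \<bar>f y\<bar>) \<le>
          norm ((K + 2 * (b - a) * ln (1 + \<bar>a\<bar> + \<bar>b\<bar> + \<bar>y\<bar>)) * \<bar>f y\<bar>)"
      proof (rule AE_I2)
        fix y
        have 0: "0 \<le> (LINT x:{a..b}|lborel. \<bar>ln \<bar>x - y\<bar>\<bar>)"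
          unfolding set_lebesgue_integral_def by (intro integral_nonneg_AE AE_I2) (auto simp: indicator_def)
        have "(LINT x:{a..b}|lborel. \<bar>ln \<bar>x - y\<bar>\<bar>) * \<bar>f y\<bar> \<le> (K + 2 * (b - a) * Mb a b y) * \<bar>f y\<bar>"
          by (intro mult_right_mono K) auto
        moreover have "0 \<le> (LINT x:{a..b}|lborel. \<bar>ln \<bar>x - y\<bar>\<bar>) * \<bar>f y\<bar>" using 0 by simp
        ultimately show "norm ((LINT x:{a..b}|lborel. \<bar>ln \<bar>x - y\<bar>\<bar>) * \<bar>f y\<bar>) \<le>
          norm ((K + 2 * (b - a) * ln (1 + \<bar>a\<bar> + \<bar>b\<bar> + \<bar>y\<bar>)) * \<bar>f y\<bar>)"
          unfolding Mb_def real_norm_def by (metis abs_of_nonneg abs_ge_self order_trans)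
      qed
    qed
    then show "integrable lborel (\<lambda>y. \<integral>x. norm (case (y, x) of (y, x) \<Rightarrow> indicat_real {a..b} x * ln \<bar>x - y\<bar> * f y) \<partial>lborel)"
      by (simp only: case_prod_conv eq)
    show "AE y in lborel. integrable lborel (\<lambda>x. case (y, x) of (y, x) \<Rightarrow> indicat_real {a..b} x * ln \<bar>x - y\<bar> * f y)"
      using set_integrable_ln_dist(1)[OF assms] by (auto simp: set_integrable_def)
  qed
qed

text \<open>Fubini moves the interval integral onto the kernel and turns it into \<open>Lam\<close>,
  so the integrated potential becomes minus the pairing of the measure with Re Psi.\<close>

lemma Wconv_interval:
  assumes "a \<le> b"
  shows "set_integrable lborel {a..b} (Wconv (f, ats))"
    and "integrable lborel (\<lambda>y. Lam a b y * f y)"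
    and "(LINT x:{a..b}|lborel. Wconv (f, ats) x) =
       - ((\<integral>y. Lam a b y * f y \<partial>lborel) + sum_list (map (\<lambda>(m, p). m * Lam a b p) ats))"
proof -
  let ?F = "\<lambda>y x. indicat_real {a..b} x * ln \<bar>x - y\<bar> * f y"
  let ?V = "\<lambda>x. \<integral>y. ln \<bar>x - y\<bar> * f y \<partial>lborel"
  have F: "integrable (lborel \<Otimes>\<^sub>M lborel) (case_prod ?F)" by (rule integrable_log_kernel[OF assms])
  have Fx: "(\<integral>x. ?F y x \<partial>lborel) = Lam a b y * f y" for y
    using set_integrable_ln_dist(2)[OF assms, of y] by (simp add: set_lebesgue_integral_def)
  have Fy: "(\<integral>y. ?F y x \<partial>lborel) = indicat_real {a..b} x * ?V x" for x
    by (simp add: mult.assoc)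
  show "integrable lborel (\<lambda>y. Lam a b y * f y)"
    using lborel_pair.integrable_fst[OF F] by (simp only: Fx)
  have V: "set_integrable lborel {a..b} ?V"
    using lborel_pair.integrable_snd[OF F] by (simp only: Fy set_integrable_def real_scaleR_def)
  have LV: "(LINT x:{a..b}|lborel. ?V x) = (\<integral>y. Lam a b y * f y \<partial>lborel)"
    using lborel_pair.Fubini_integral[OF F] by (simp only: Fx Fy set_lebesgue_integral_def real_scaleR_def)
  have W: "Wconv (f, ats) x = - ?V x - (\<Sum>i<length ats. fst (ats ! i) * ln \<bar>x - snd (ats ! i)\<bar>)" for x
    by (simp add: Wconv_def sum_list_pairs_nth sum_negf)
  have A: "set_integrable lborel {a..b} (\<lambda>x. \<Sum>i<length ats. fst (ats ! i) * ln \<bar>x - snd (ats ! i)\<bar>)"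
    using set_integrable_ln_dist(1)[OF assms]
    unfolding set_integrable_def scaleR_sum_right
    by (intro Bochner_Integration.integrable_sum) (simp add: mult.left_commute)
  have LA: "(LINT x:{a..b}|lborel. (\<Sum>i<length ats. fst (ats ! i) * ln \<bar>x - snd (ats ! i)\<bar>)) = (\<Sum>i<length ats. fst (ats ! i) * Lam a b (snd (ats ! i)))"
    using set_integrable_ln_dist[OF assms]
    unfolding set_integrable_def set_lebesgue_integral_def scaleR_sum_right
    by (subst Bochner_Integration.integral_sum) (simp_all add: mult.left_commute)
  have V': "set_integrable lborel {a..b} (\<lambda>x. - ?V x)"
    using set_integrable_mult_right[of "-1" lborel "{a..b}" ?V] V by simp
  show "set_integrable lborel {a..b} (Wconv (f, ats))"
    unfolding W by (intro set_integral_diff(1) V' A)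
  have "(LINT x:{a..b}|lborel. Wconv (f, ats) x) = (LINT x:{a..b}|lborel. - ?V x) - (\<Sum>i<length ats. fst (ats ! i) * Lam a b (snd (ats ! i)))"
    unfolding W using set_integral_diff(2)[OF V' A] by (simp add: LA)
  also have "(LINT x:{a..b}|lborel. - ?V x) = - (LINT x:{a..b}|lborel. ?V x)"
    by (simp add: set_lebesgue_integral_def)
  finally show "(LINT x:{a..b}|lborel. Wconv (f, ats) x) =
       - ((\<integral>y. Lam a b y * f y \<partial>lborel) + sum_list (map (\<lambda>(m, p). m * Lam a b p) ats))"
    by (simp add: LV sum_list_pairs_nth)
qed

text \<open>The test function is Psi + i (al + be z), real on {-R..R} by choice of \<open>al\<close>
  and \<open>be\<close>. Psi is o(z), so the slope at infinity is i be. The ends of the interval lie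
  beyond the atoms, where Psi is therefore differentiable.\<close>

lemma Wconv_interval_value:
  assumes ab: "a \<le> b" and al: "\<And>y. \<bar>y\<bar> \<le> R \<Longrightarrow> Im (Psi a b (of_real y)) + (al + be * y) = 0"
    and out: "\<bar>a\<bar> > R" "\<bar>b\<bar> > R"
  shows "(LINT x:{a..b}|lborel. Wconv (f, ats) x) = - (pi * c1 * be)"
proof -
  define E where "E z = Psi a b z + \<i> * (of_real al + of_real be * z)" for z
  have ReE: "Re (E (of_real y)) = Lam a b y" for y by (simp add: E_def Re_Psi)
  have "(\<integral>y. Re (E (of_real y)) * f y \<partial>lborel)
         + sum_list (map (\<lambda>(m, p). m * Re (E (of_real p))) ats) = pi * c1 * Im (\<i> * of_real be)"
  proof (rule test_function_identity)
    show "continuous_on UH E"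
      unfolding E_def by (intro continuous_intros continuous_on_Psi)
    show "E holomorphic_on {z. 0 < Im z}"
      unfolding E_def
      by (intro holomorphic_intros holomorphic_on_Psi)
    show "E field_differentiable at (complex_of_real p) within UH" if "(m, p) \<in> set ats" for m p
    proof -
      have "\<bar>p\<bar> < R" using atoms[OF that] .
      then have "p \<noteq> a" "p \<noteq> b" using out by auto
      then show ?thesis
        unfolding E_def[abs_def]
        by (intro field_differentiable_add field_differentiable_mult field_differentiable_const
            field_differentiable_ident field_differentiable_at_within[OF Psi_differentiable]) auto
    qed
    show "Im (E (of_real y)) = 0" if "\<bar>y\<bar> \<le> R" for y
      using al[OF that] by (simp add: E_def)
    have "((\<lambda>z. Psi a b z / z + (\<i> * of_real al) / z + \<i> * of_real be) \<longlongrightarrow> 0 + 0 + \<i> * of_real be) uhinf"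
      by (intro tendsto_intros Psi_over_tendsto inverse_tendsto_uhinf)
    moreover have "\<forall>\<^sub>F z in uhinf. Psi a b z / z + (\<i> * of_real al) / z + \<i> * of_real be = E z / z"
      unfolding eventually_uhinf
    proof (intro exI[of _ 1] conjI ballI impI)
      fix z :: complex assume "1 \<le> norm z"
      then have "z \<noteq> 0" by auto
      then show "Psi a b z / z + (\<i> * of_real al) / z + \<i> * of_real be = E z / z"
        by (simp add: E_def field_simps)
    qed simp
    ultimately show "((\<lambda>z. E z / z) \<longlongrightarrow> \<i> * of_real be) uhinf" by (simp add: filterlim_cong)
    show "integrable lborel (\<lambda>y. Re (E (of_real y)) * f y)"
      using Wconv_interval(2)[OF ab] by (simp add: ReE)
  qed
  then show ?thesis using Wconv_interval(3)[OF ab] by (simp add: ReE)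
qed

lemma Wconv_AE_zero_Icc:
  assumes out: "a > R \<or> b < - R" and R: "R \<ge> 0"
  shows "AE x in lborel. x \<in> {a..b} \<longrightarrow> Wconv (f, ats) x = 0"
proof (cases "a \<le> b")
  case True
  define h where "h x = indicat_real {a..b} x * Wconv (f, ats) x" for x
  have "AE x in lborel. h x = 0"
  proof (rule AE_zero_if_interval_integrals_zero)
    show "integrable lborel h" using Wconv_interval(1)[OF True] by (simp add: set_integrable_def h_def[abs_def])
    fix c d :: real
    define c' d' where "c' = max a c" and "d' = min b d"
    have "(LINT x:{c..d}|lborel. h x) = (LINT x:{c'..d'}|lborel. Wconv (f, ats) x)"
      unfolding set_lebesgue_integral_def h_def
      by (intro Bochner_Integration.integral_cong) (auto simp: c'_def d'_def indicator_def)
    also have "\<dots> = 0"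
    proof (cases "c' \<le> d'")
      case le: True
      \<comment> \<open>Seen from {-R..R}, the imaginary part of \<open>Psi\<close> is pi times the
        length of an interval to the right and 0 for one to the left. Either way it is constant,
        hence be = 0.\<close>
      have "(LINT x:{c'..d'}|lborel. Wconv (f, ats) x) = - (pi * c1 * 0)"
      proof (rule Wconv_interval_value[OF le, where al="if a > R then - pi * (d' - c') else 0"])
        fix y assume "\<bar>y\<bar> \<le> R"
        then show "Im (Psi c' d' (of_real y)) + ((if a > R then - pi * (d' - c') else 0) + 0 * y) = 0"
          using out le R unfolding Im_Psi by (auto simp: c'_def d'_def algebra_simps)
      qed (use out le R in \<open>auto simp: c'_def d'_def\<close>)
      then show ?thesis by simp
    qed (simp add: set_lebesgue_integral_def)
    finally show "(LINT x:{c..d}|lborel. h x) = 0" .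
  qed
  then show ?thesis by eventually_elim (auto simp: h_def)
qed auto

lemma Wconv_AE_zero:
  assumes R: "R \<ge> 0"
  shows "AE x in lborel. \<bar>x\<bar> > R \<longrightarrow> Wconv (f, ats) x = 0"
proof -
  have "AE x in lborel. \<forall>n::nat. x \<in> {R + 1 / Suc n..R + Suc n} \<longrightarrow> Wconv (f, ats) x = 0"
    unfolding AE_all_countable by (intro allI Wconv_AE_zero_Icc R) auto
  moreover have "AE x in lborel. \<forall>n::nat. x \<in> {- R - Suc n..- R - 1 / Suc n} \<longrightarrow> Wconv (f, ats) x = 0"
    unfolding AE_all_countable by (intro allI Wconv_AE_zero_Icc R) auto
  ultimately show ?thesis
  proof eventually_elim
    case (elim x)
    show ?case
    proof
      assume x: "\<bar>x\<bar> > R"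
      obtain n1 where n1: "1 / real (Suc n1) < \<bar>x\<bar> - R" using x nat_approx_posE[of "\<bar>x\<bar> - R"] by auto
      obtain n2 where n2: "\<bar>x\<bar> - R < real n2" using reals_Archimedean2 by blast
      define n where "n = max n1 n2"
      have "1 / real (Suc n) \<le> 1 / real (Suc n1)" by (simp add: n_def frac_le)
      moreover have "real n2 \<le> real (Suc n)" by (simp add: n_def)
      ultimately have *: "1 / real (Suc n) \<le> \<bar>x\<bar> - R" "\<bar>x\<bar> - R \<le> real (Suc n)" using n1 n2 by linarith+
      show "Wconv (f, ats) x = 0"
      proof (cases "x > 0")
        case True
        then show ?thesis using elim(1)[rule_format, of n] * by auto
      next
        case False
        then show ?thesis using elim(2)[rule_format, of n] * by auto
      qed
    qed
  qed
qed

lemma Hfun_value: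
  assumes R: "R \<ge> 0"
  shows "Hfun (f, ats) = - pi\<^sup>2 * c1"
proof -
  define T where "T = R + 1"
  have T: "- T \<le> T" "T > R" using R by (auto simp: T_def)
  have [measurable]: "Wconv (f, ats) \<in> borel_measurable borel"
    unfolding Wconv_def[abs_def] sum_list_pairs_nth by simp
  have "Hfun (f, ats) = (LINT x:{-T..T}|lborel. Wconv (f, ats) x)"
    unfolding Hfun_def set_lebesgue_integral_def
  proof (rule integral_cong_AE)
    show "AE x in lborel. Wconv (f, ats) x = indicat_real {-T..T} x *\<^sub>R Wconv (f, ats) x"
      using Wconv_AE_zero[OF R] by eventually_elim (auto simp: T_def indicator_def)
  qed auto
  \<comment> \<open>On {-R..R} the imaginary part of \<open>Psi (- T) T\<close> is pi (T - y), which
    gives al = - pi T and be = pi.\<close>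
  also have "\<dots> = - (pi * c1 * pi)"
    by (rule Wconv_interval_value[where al="- pi * T"]) (use T R in \<open>auto simp: Im_Psi algebra_simps\<close>)
  finally show ?thesis by (simp add: power2_eq_square)
qed

text \<open>The scaled potential is lam W(x / lam) minus lam ln lam times the total mass, and that
  mass is 0 by \<open>neutral\<close>.\<close>

lemma Hfun_scale:
  assumes R: "R \<ge> 0" and lam: "lam > 0"
  shows "Hfun (sm_scale lam (f, ats)) = lam\<^sup>2 * (- pi\<^sup>2 * c1)"
proof -
  have [measurable]: "Wconv (f, ats) \<in> borel_measurable borel"
    unfolding Wconv_def[abs_def] sum_list_pairs_nth by simp
  have W: "AE x in lborel. Wconv (sm_scale lam (f, ats)) x = lam * Wconv (f, ats) (x / lam)"
  proof -
    define S where "S = (\<lambda>p. lam * p) ` snd ` set ats"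
    have "AE x in lborel. x \<notin> S"
      by (intro AE_not_in countable_imp_null_set_lborel countable_finite) (auto simp: S_def)
    \<comment> \<open>Splitting ln lam off the integral requires the remaining logarithmic integral
      to exist; Fubini provides this for a.e. x.\<close>
    moreover have "AE x in lborel. integrable lborel (\<lambda>y. ln \<bar>x / lam - y\<bar> * f y)"
    proof -
      have "AE x in lborel. \<forall>n::nat. x \<in> {- real n..real n} \<longrightarrow> integrable lborel (\<lambda>y. ln \<bar>x - y\<bar> * f y)"
        unfolding AE_all_countable
      proof
        fix n :: nat
        have "AE x in lborel. integrable lborel (\<lambda>y. indicat_real {- real n..real n} x * ln \<bar>x - y\<bar> * f y)"
          using lborel_pair.AE_integrable_snd[OF integrable_log_kernel[of "- real n" "real n"]] by simp
        then show "AE x in lborel. x \<in> {- real n..real n} \<longrightarrow> integrable lborel (\<lambda>y. ln \<bar>x - y\<bar> * f y)"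
          by eventually_elim auto
      qed
      then have *: "AE x in lborel. integrable lborel (\<lambda>y. ln \<bar>x - y\<bar> * f y)"
      proof eventually_elim
        case (elim x)
        obtain n where "\<bar>x\<bar> \<le> real n" using real_arch_simple by blast
        then have "x \<in> {- real n..real n}" by auto
        then show ?case using elim by blast
      qed
      show ?thesis
        using AE_borel_affine[of "1 / lam" "\<lambda>x. integrable lborel (\<lambda>y. ln \<bar>x - y\<bar> * f y)" 0] lam * by simp
    qed
    ultimately show ?thesis
    proof eventually_elim
      case (elim x)
      define I where "I = (\<integral>y. ln \<bar>x / lam - y\<bar> * f y \<partial>lborel)"
      have ne: "x / lam \<noteq> p" if "(m, p) \<in> set ats" for m p
        using elim that lam by (force simp: S_def)
      have "(\<integral>y. - ln \<bar>x - y\<bar> * f (y / lam) \<partial>lborel) = lam * (\<integral>y. - ln \<bar>x - lam * y\<bar> * f y \<partial>lborel)"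
        using lborel_integral_real_affine[of lam "\<lambda>y. - ln \<bar>x - y\<bar> * f (y / lam)" 0] lam by simp
      also have "(\<integral>y. - ln \<bar>x - lam * y\<bar> * f y \<partial>lborel) = (\<integral>y. - (ln \<bar>x / lam - y\<bar> * f y) - ln lam * f y \<partial>lborel)"
      proof (rule integral_cong_AE)
        show "AE y in lborel. - ln \<bar>x - lam * y\<bar> * f y = - (ln \<bar>x / lam - y\<bar> * f y) - ln lam * f y"
          using AE_lborel_singleton[of "x / lam"]
        proof eventually_elim
          case (elim y)
          have "\<bar>x - lam * y\<bar> = lam * \<bar>x / lam - y\<bar>"
            using lam by (simp add: abs_if field_simps)
          then have "ln \<bar>x - lam * y\<bar> = ln lam + ln \<bar>x / lam - y\<bar>" using lam elim by (simp add: ln_mult)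
          then show ?case by (simp add: algebra_simps)
        qed
      qed auto
      also have "\<dots> = - I - ln lam * (\<integral>y. f y \<partial>lborel)"
        using elim integrable_f by (simp add: I_def)
      finally have A: "(\<integral>y. - ln \<bar>x - y\<bar> * f (y / lam) \<partial>lborel) = lam * (- I - ln lam * (\<integral>y. f y \<partial>lborel))" .
      have "sum_list (map (\<lambda>(m, p). (lam * m) * (- ln \<bar>x - lam * p\<bar>)) ats)
          = (\<Sum>i<length ats. lam * (fst (ats ! i) * - ln \<bar>x / lam - snd (ats ! i)\<bar>) - lam * ln lam * fst (ats ! i))"
        unfolding sum_list_pairs_nth
      proof (rule sum.cong)
        fix i assume "i \<in> {..<length ats}"
        then have "x / lam \<noteq> snd (ats ! i)" using ne[of "fst (ats ! i)" "snd (ats ! i)"] by simp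
        moreover have "\<bar>x - lam * snd (ats ! i)\<bar> = lam * \<bar>x / lam - snd (ats ! i)\<bar>"
          using lam by (simp add: abs_if field_simps)
        ultimately have "ln \<bar>x - lam * snd (ats ! i)\<bar> = ln lam + ln \<bar>x / lam - snd (ats ! i)\<bar>" using lam by (simp add: ln_mult)
        then show "lam * fst (ats ! i) * - ln \<bar>x - lam * snd (ats ! i)\<bar> = lam * (fst (ats ! i) * - ln \<bar>x / lam - snd (ats ! i)\<bar>) - lam * ln lam * fst (ats ! i)"
          by (simp add: algebra_simps)
      qed simp
      also have "\<dots> = lam * (\<Sum>i<length ats. fst (ats ! i) * - ln \<bar>x / lam - snd (ats ! i)\<bar>) - lam * ln lam * sum_list (map fst ats)"
        by (simp add: sum_subtractf sum_distrib_left sum_list_sum_nth atLeast0LessThan)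
      finally have B: "sum_list (map (\<lambda>(m, p). (lam * m) * (- ln \<bar>x - lam * p\<bar>)) ats) = lam * (\<Sum>i<length ats. fst (ats ! i) * - ln \<bar>x / lam - snd (ats ! i)\<bar>) - lam * ln lam * sum_list (map fst ats)" .
      have "Wconv (sm_scale lam (f, ats)) x = (\<integral>y. - ln \<bar>x - y\<bar> * f (y / lam) \<partial>lborel) + sum_list (map (\<lambda>(m, p). (lam * m) * (- ln \<bar>x - lam * p\<bar>)) ats)"
        by (simp add: Wconv_def sm_scale_def o_def case_prod_unfold)
      also have "\<dots> = lam * (- I + (\<Sum>i<length ats. fst (ats ! i) * - ln \<bar>x / lam - snd (ats ! i)\<bar>)) - lam * ln lam * ((\<integral>y. f y \<partial>lborel) + sum_list (map fst ats))"
        unfolding A B by (simp add: algebra_simps)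
      also have "\<dots> = lam * Wconv (f, ats) (x / lam)"
        unfolding neutral by (simp add: Wconv_def I_def sum_list_pairs_nth)
      finally show ?case .
    qed
  qed
  have [measurable]: "Wconv (sm_scale lam (f, ats)) \<in> borel_measurable borel"
    unfolding Wconv_def[abs_def] sm_scale_def sum_list_pairs_nth by simp
  have "Hfun (sm_scale lam (f, ats)) = (\<integral>x. lam * Wconv (f, ats) (x / lam) \<partial>lborel)"
    unfolding Hfun_def by (rule integral_cong_AE) (use W in auto)
  also have "\<dots> = lam * (lam * (\<integral>x. Wconv (f, ats) x \<partial>lborel))"
    using lborel_integral_real_affine[of lam "\<lambda>x. Wconv (f, ats) (x / lam)" 0] lam by simp
  also have "(\<integral>x. Wconv (f, ats) x \<partial>lborel) = - pi\<^sup>2 * c1"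
    using Hfun_value[OF R] by (simp add: Hfun_def)
  finally show ?thesis by (simp add: power2_eq_square)
qed

end

section \<open>The three families as half-plane densities\<close>

text \<open>The branch of \<open>sqrt (z\<^sup>2 - a\<^sup>2)\<close> on the closed upper half plane that behaves like \<open>z\<close> at infinity.\<close>
definition sq2 :: "real \<Rightarrow> complex \<Rightarrow> complex" where
  "sq2 a z = \<i> * csqrt (- \<i> * (z - of_real a)) * csqrt (- \<i> * (z + of_real a))"

lemma sq2_square: "(sq2 a z)\<^sup>2 = z\<^sup>2 - (of_real a)\<^sup>2"
proof -
  have "(sq2 a z)\<^sup>2 = \<i>\<^sup>2 * (csqrt (- \<i> * (z - of_real a)))\<^sup>2 * (csqrt (- \<i> * (z + of_real a)))\<^sup>2"
    by (simp add: sq2_def power_mult_distrib)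
  also have "\<dots> = - 1 * (- \<i> * (z - of_real a)) * (- \<i> * (z + of_real a))"
    by (simp only: power2_csqrt power2_i)
  also have "\<dots> = - (\<i> * \<i>) * ((z - of_real a) * (z + of_real a))" by (simp add: algebra_simps)
  also have "\<dots> = z\<^sup>2 - (of_real a)\<^sup>2" by (simp add: power2_eq_square algebra_simps)
  finally show ?thesis .
qed

lemma csqrt_neg_ii_times_nonneg:
  assumes "y \<ge> 0"
  shows "csqrt (- \<i> * of_real y) = of_real (sqrt (y / 2)) * (1 - \<i>)"
proof (cases "y = 0")
  case False
  show ?thesis
  proof (rule csqrt_unique)
    have "(of_real (sqrt (y / 2)) * (1 - \<i>))\<^sup>2 = of_real ((sqrt (y / 2))\<^sup>2) * (1 - \<i>)\<^sup>2"
      by (simp add: power_mult_distrib)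
    also have "\<dots> = of_real (y / 2) * (- 2 * \<i>)"
      using assms by (simp add: power2_eq_square algebra_simps)
    finally show "(of_real (sqrt (y / 2)) * (1 - \<i>))\<^sup>2 = - \<i> * of_real y" by simp
  qed (use assms False in auto)
qed simp

lemma csqrt_neg_ii_times_nonpos:
  assumes "y \<le> 0"
  shows "csqrt (- \<i> * of_real y) = of_real (sqrt (- y / 2)) * (1 + \<i>)"
proof (cases "y = 0")
  case False
  show ?thesis
  proof (rule csqrt_unique)
    have "(of_real (sqrt (- y / 2)) * (1 + \<i>))\<^sup>2 = of_real ((sqrt (- y / 2))\<^sup>2) * (1 + \<i>)\<^sup>2"
      by (simp add: power_mult_distrib)
    also have "\<dots> = of_real (- y / 2) * (2 * \<i>)"
      using assms by (simp add: power2_eq_square algebra_simps)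
    finally show "(of_real (sqrt (- y / 2)) * (1 + \<i>))\<^sup>2 = - \<i> * of_real y" by simp
  qed (use assms False in auto)
qed simp

lemma sq2_real_ge:
  assumes "a \<ge> 0" "y \<ge> a"
  shows "sq2 a (of_real y) = of_real (sqrt (y\<^sup>2 - a\<^sup>2))"
proof -
  have "sq2 a (of_real y) = \<i> * csqrt (- \<i> * of_real (y - a)) * csqrt (- \<i> * of_real (y + a))"
    by (simp add: sq2_def)
  also have "\<dots> = of_real (sqrt ((y - a) / 2) * sqrt ((y + a) / 2)) * (\<i> * ((1 - \<i>) * (1 - \<i>)))"
    using assms by (subst (1 2) csqrt_neg_ii_times_nonneg) auto
  also have "\<i> * ((1 - \<i>) * (1 - \<i>)) = 2" by (simp add: algebra_simps)
  also have "sqrt ((y - a) / 2) * sqrt ((y + a) / 2) = sqrt (y\<^sup>2 - a\<^sup>2) / 2"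
    by (simp add: real_sqrt_mult[symmetric] real_sqrt_divide power2_eq_square algebra_simps)
  finally show ?thesis by simp
qed

text \<open>The minus sign reflects the growth like z. Divided by y < 0 it produces the |x| in the
  type I density.\<close>

lemma sq2_real_le:
  assumes "a \<ge> 0" "y \<le> - a"
  shows "sq2 a (of_real y) = - of_real (sqrt (y\<^sup>2 - a\<^sup>2))"
proof -
  have "sq2 a (of_real y) = \<i> * csqrt (- \<i> * of_real (y - a)) * csqrt (- \<i> * of_real (y + a))"
    by (simp add: sq2_def)
  also have "\<dots> = of_real (sqrt (- (y - a) / 2) * sqrt (- (y + a) / 2)) * (\<i> * ((1 + \<i>) * (1 + \<i>)))"
    using assms by (subst (1 2) csqrt_neg_ii_times_nonpos) auto
  also have "\<i> * ((1 + \<i>) * (1 + \<i>)) = - 2" by (simp add: algebra_simps)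
  also have "sqrt (- (y - a) / 2) * sqrt (- (y + a) / 2) = sqrt (y\<^sup>2 - a\<^sup>2) / 2"
    by (simp add: real_sqrt_mult[symmetric] real_sqrt_divide power2_eq_square algebra_simps)
  finally show ?thesis by simp
qed

lemma sq2_real_mid:
  assumes "\<bar>y\<bar> \<le> a"
  shows "sq2 a (of_real y) = \<i> * of_real (sqrt (a\<^sup>2 - y\<^sup>2))"
proof -
  have "sq2 a (of_real y) = \<i> * csqrt (- \<i> * of_real (y - a)) * csqrt (- \<i> * of_real (y + a))"
    by (simp add: sq2_def)
  also have "\<dots> = of_real (sqrt (- (y - a) / 2) * sqrt ((y + a) / 2)) * (\<i> * ((1 + \<i>) * (1 - \<i>)))"
    using assms by (subst csqrt_neg_ii_times_nonpos, simp, subst csqrt_neg_ii_times_nonneg) auto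
  also have "\<i> * ((1 + \<i>) * (1 - \<i>)) = 2 * \<i>" by (simp add: algebra_simps)
  also have "sqrt (- (y - a) / 2) * sqrt ((y + a) / 2) = sqrt (a\<^sup>2 - y\<^sup>2) / 2"
    by (simp add: real_sqrt_mult[symmetric] real_sqrt_divide power2_eq_square algebra_simps)
  finally show ?thesis by simp
qed

text \<open>Multiplication by -i maps the half plane to the closed right half plane, which meets the
  branch cut only at 0; there |csqrt w| = sqrt |w|.\<close>

lemma continuous_on_csqrt_UH: "continuous_on UH (\<lambda>z. csqrt (- \<i> * z))"
  unfolding continuous_on_eq_continuous_within
proof
  fix z assume z: "z \<in> UH"
  show "continuous (at z within UH) (\<lambda>z. csqrt (- \<i> * z))"
  proof (cases "z = 0")
    case True
    have "((\<lambda>z. csqrt (- \<i> * z)) \<longlongrightarrow> 0) (at 0 within UH)"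
    proof (rule Lim_null_comparison)
      show "\<forall>\<^sub>F z in at 0 within UH. norm (csqrt (- \<i> * z)) \<le> sqrt (norm z)"
        by (simp add: norm_mult)
      have "((\<lambda>z::complex. sqrt (norm z)) \<longlongrightarrow> sqrt (norm (0::complex))) (at 0 within UH)"
        by (intro tendsto_intros)
      then show "((\<lambda>z::complex. sqrt (norm z)) \<longlongrightarrow> 0) (at 0 within UH)" by simp
    qed
    then show ?thesis using True by (simp add: continuous_within)
  next
    case False
    have "isCont (\<lambda>z. csqrt (- \<i> * z)) z"
      using UH_rotate_notin[OF z False]
      by (intro isCont_csqrt' continuous_mult continuous_const continuous_ident)
    then show ?thesis using continuous_at_imp_continuous_at_within by blast
  qed
qed

lemma continuous_on_sq2: "continuous_on UH (sq2 a)"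
proof -
  have 1: "continuous_on UH (\<lambda>z. csqrt (- \<i> * (z - of_real a)))"
    by (rule continuous_on_compose2[OF continuous_on_csqrt_UH]) (auto simp: UH_def intro!: continuous_intros)
  have 2: "continuous_on UH (\<lambda>z. csqrt (- \<i> * (z + of_real a)))"
    by (rule continuous_on_compose2[OF continuous_on_csqrt_UH]) (auto simp: UH_def intro!: continuous_intros)
  show ?thesis unfolding sq2_def by (intro continuous_on_mult continuous_on_const 1 2)
qed

lemma sq2_differentiable:
  assumes z: "z \<in> UH" "z \<noteq> of_real a" "z \<noteq> - of_real a"
  shows "sq2 a field_differentiable (at z)"
proof -
  have 1: "- \<i> * (z - of_real a) \<notin> \<real>\<^sub>\<le>\<^sub>0" using z by (intro UH_rotate_notin) (auto simp: UH_def)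
  have "z + of_real a \<noteq> 0" using z(3) by (metis add_eq_0_iff2)
  then have 2: "- \<i> * (z + of_real a) \<notin> \<real>\<^sub>\<le>\<^sub>0" using z by (intro UH_rotate_notin) (auto simp: UH_def)
  have d1: "(\<lambda>z. csqrt (- \<i> * (z - of_real a))) field_differentiable (at z)"
    unfolding field_differentiable_def using 1
    by (intro exI) (rule has_field_derivative_csqrt', auto intro!: derivative_eq_intros)
  have d2: "(\<lambda>z. csqrt (- \<i> * (z + of_real a))) field_differentiable (at z)"
    unfolding field_differentiable_def using 2
    by (intro exI) (rule has_field_derivative_csqrt', auto intro!: derivative_eq_intros)
  show ?thesis unfolding sq2_def[abs_def]
    by (intro field_differentiable_mult field_differentiable_const d1 d2)
qed

lemma sq2_holomorphic: "sq2 a holomorphic_on {z. 0 < Im z}"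
  unfolding holomorphic_on_def
proof
  fix z :: complex assume "z \<in> {z. 0 < Im z}"
  then show "sq2 a field_differentiable at z within {z. 0 < Im z}"
    by (intro field_differentiable_at_within[OF sq2_differentiable]) (auto simp: UH_def)
qed

text \<open>As in \<open>logu_shift\<close>, the two arguments add up to less than pi in absolute
  value, so the principal root is multiplicative.\<close>

lemma csqrt_shift:
  assumes z: "z \<in> UH" "z \<noteq> 0" and n: "norm z > \<bar>a\<bar>"
  shows "csqrt (- \<i> * (z + of_real a)) = csqrt (- \<i> * z) * csqrt (1 + of_real a / z)"
proof -
  define w where "w = 1 + of_real a / z"
  have "norm (of_real a / z) < 1" using n z by (simp add: norm_divide)
  then have "- Re (of_real a / z) < 1" using abs_Re_le_cmod[of "of_real a / z"] by linarith
  then have Rew: "Re w > 0" by (simp add: w_def)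
  then have w0: "w \<noteq> 0" by auto
  have iw: "\<bar>Im (Ln w)\<bar> < pi / 2" by (rule Re_Ln_pos_lt_imp[OF Rew])
  have iz: "\<bar>Im (Ln (- \<i> * z))\<bar> \<le> pi / 2"
    using Re_Ln_pos_le[of "- \<i> * z"] z by (auto simp: UH_def)
  have "- \<i> * (z + of_real a) = (- \<i> * z) * w" using z by (simp add: w_def algebra_simps)
  moreover have "csqrt ((- \<i> * z) * w) = csqrt (- \<i> * z) * csqrt w"
    using iw iz z w0 by (intro csqrt_mult) (auto simp: Arg_eq_Im_Ln)
  ultimately show ?thesis unfolding w_def by (simp only:)
qed

lemma sq2_over_tendsto: "((\<lambda>z. sq2 a z / z) \<longlongrightarrow> 1) uhinf"
proof -
  have "((\<lambda>z. csqrt (1 + of_real (- a) / z) * csqrt (1 + of_real a / z)) \<longlongrightarrow> csqrt (1 + 0) * csqrt (1 + 0)) uhinf"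
    by (intro tendsto_mult isCont_tendsto_compose[OF isCont_csqrt'[OF continuous_ident]]
        tendsto_add tendsto_const inverse_tendsto_uhinf) auto
  moreover have "\<forall>\<^sub>F z in uhinf. csqrt (1 + of_real (- a) / z) * csqrt (1 + of_real a / z) = sq2 a z / z"
    unfolding eventually_uhinf
  proof (intro exI[of _ "\<bar>a\<bar> + 1"] conjI ballI impI)
    fix z assume z: "z \<in> UH" "\<bar>a\<bar> + 1 \<le> norm z"
    then have z0: "z \<noteq> 0" by auto
    have "sq2 a z = \<i> * csqrt (- \<i> * (z + of_real (- a))) * csqrt (- \<i> * (z + of_real a))"
      by (simp add: sq2_def)
    also have "\<dots> = \<i> * (csqrt (- \<i> * z))\<^sup>2 * (csqrt (1 + of_real (- a) / z) * csqrt (1 + of_real a / z))"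
      using z z0 by (subst (1 2) csqrt_shift) (auto simp: power2_eq_square)
    also have "\<i> * (csqrt (- \<i> * z))\<^sup>2 = z" by (simp only: power2_csqrt) simp
    finally show "csqrt (1 + of_real (- a) / z) * csqrt (1 + of_real a / z) = sq2 a z / z"
      using z0 by simp
  qed auto
  ultimately show ?thesis by (simp add: filterlim_cong)
qed

text \<open>G = sq2 a z / z - 1 with a = 1 / pi. Its residue i a at 0 encodes the mass pi a = 1, and
  z (sq2 a z - z) = - a^2 z / (sq2 a z + z) tends to - a^2 / 2.\<close>

lemma muI_half_plane_density:
  "\<exists>g. half_plane_density g (fst muI) (snd muI) (- (1 / pi)\<^sup>2 / 2) (1 / pi)"
proof -
  define a where "a = 1 / pi"
  have a: "a > 0" by (simp add: a_def)
  define N where "N z = sq2 a z - \<i> * of_real a" for z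
  have "sq2 a field_differentiable (at (0::complex))"
    using a by (intro sq2_differentiable) (auto simp: UH_def)
  then have "N field_differentiable (at 0 within UH)"
    unfolding N_def[abs_def]
    by (intro field_differentiable_diff field_differentiable_const) (rule field_differentiable_at_within)
  then obtain d where d: "(N has_field_derivative d) (at 0 within UH)"
    by (auto simp: field_differentiable_def)
  have N0: "N 0 = 0" using sq2_real_mid[of 0 a] a by (simp add: N_def)
  define g where "g z = dquot N d 0 z - 1" for z
  have g: "g z = (sq2 a z - \<i> * of_real a) / z - 1" if "z \<noteq> 0" for z
    using that by (simp add: g_def dquot_def N0) (simp add: N_def)
  have contN: "continuous_on UH N" unfolding N_def by (intro continuous_intros continuous_on_sq2)
  have "half_plane_density g (fst muI) (snd muI) (- a\<^sup>2 / 2) a"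
  proof
    show "continuous_on UH g"
      unfolding g_def by (intro continuous_intros continuous_on_dquot contN d)
    show "g holomorphic_on {z. 0 < Im z}"
      unfolding g_def N_def[abs_def] by (intro holomorphic_intros holomorphic_on_dquot sq2_holomorphic) auto
    have "((\<lambda>z. - (of_real a)\<^sup>2 / (sq2 a z / z + 1)) \<longlongrightarrow> - (of_real a)\<^sup>2 / (1 + 1)) uhinf"
      by (intro tendsto_intros sq2_over_tendsto) auto
    moreover have "\<forall>\<^sub>F z in uhinf. - (of_real a)\<^sup>2 / (sq2 a z / z + 1) =
       z\<^sup>2 * (g z + sum_list (map (\<lambda>(m, p). \<i> * of_real m / (of_real pi * (z - of_real p))) (snd muI)))"
    proof -
      have "\<forall>\<^sub>F z in uhinf. z \<noteq> 0"
        unfolding eventually_uhinf by (intro exI[of _ 1]) auto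
      moreover have "\<forall>\<^sub>F z in uhinf. sq2 a z / z + 1 \<noteq> 0"
        by (rule tendsto_imp_eventually_ne[of _ 2]) (use tendsto_add[OF sq2_over_tendsto[of a] tendsto_const[of 1]] in auto)
      ultimately show ?thesis
      proof eventually_elim
        case (elim z)
        have nz: "sq2 a z + z \<noteq> 0" using elim by (auto simp: field_simps)
        have "g z + sum_list (map (\<lambda>(m, p). \<i> * of_real m / (of_real pi * (z - of_real p))) (snd muI)) = (sq2 a z - z) / z"
          using elim by (simp add: g muI_def a_def field_simps)
        also have "z\<^sup>2 * \<dots> = z * (sq2 a z - z)" using elim by (simp add: power2_eq_square)
        also have "(sq2 a z - z) * (sq2 a z + z) = - (of_real a)\<^sup>2"
          using sq2_square[of a z] by (simp add: power2_eq_square algebra_simps)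
        then have "z * (sq2 a z - z) * (sq2 a z + z) = - (of_real a)\<^sup>2 * z" by (simp add: mult.assoc)
        then have "z * (sq2 a z - z) = - (of_real a)\<^sup>2 * z / (sq2 a z + z)" using nz
          unfolding eq_divide_eq by simp
        also have "\<dots> = - (of_real a)\<^sup>2 / (sq2 a z / z + 1)" using elim nz by (simp add: field_simps)
        finally show ?case ..
      qed
    qed
    ultimately show "((\<lambda>z. z\<^sup>2 * (g z + sum_list (map (\<lambda>(m, p). \<i> * of_real m / (of_real pi * (z - of_real p))) (snd muI)))) \<longlongrightarrow> of_real (- a\<^sup>2 / 2)) uhinf"
      by (simp add: filterlim_cong)
    show "fst muI y = Re (g (of_real y))" if "y \<notin> snd ` set (snd muI)" for y
    proof -
      have y0: "y \<noteq> 0" using that by (auto simp: muI_def)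
      have "Re (g (of_real y)) = Re (sq2 a (of_real y)) / y - 1"
        using y0 by (simp add: g Re_divide_of_real)
      moreover have "Re (sq2 a (of_real y)) / y = (if \<bar>y\<bar> \<ge> a then sqrt (y\<^sup>2 - a\<^sup>2) / \<bar>y\<bar> else 0)"
        using sq2_real_ge[of a y] sq2_real_le[of a y] sq2_real_mid[of y a] a by (auto simp: abs_if)
      ultimately show ?thesis by (simp add: muI_def a_def)
    qed
    show "Im (g (of_real y)) + sum_list (map (\<lambda>(m, p). m / (pi * (y - p))) (snd muI)) = 0" if "a < \<bar>y\<bar>" for y
    proof -
      have y0: "y \<noteq> 0" using that a by auto
      have "Im (sq2 a (of_real y)) = 0"
        using sq2_real_ge[of a y] sq2_real_le[of a y] that a by (auto simp: abs_if split: if_splits)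
      then show ?thesis using y0 by (simp add: g Im_divide_of_real muI_def a_def field_simps)
    qed
    show "fst muI \<in> borel_measurable borel" unfolding muI_def by simp
    show "\<bar>p\<bar> < a" if "(m, p) \<in> set (snd muI)" for m p using that a by (auto simp: muI_def)
  qed
  then show ?thesis by (auto simp: a_def)
qed

text \<open>G = S z / (z^2 - 1) - 1. The values i m at 1 and - i m at -1 give both poles residue i m
  / 2, hence mass pi m / 2. The tail constant comes from S^2 - (z^2 - 1)^2 = (2 - R^2 - L^2) z^2 +
  R^2 L^2 - 1.\<close>

lemma muIII_half_plane_density:
  assumes L: "0 \<le> L" "L < 1" and R: "1 < R"
  shows "\<exists>g. half_plane_density g (fst (muIII L R)) (snd (muIII L R)) (- (R\<^sup>2 + L\<^sup>2 - 2) / 2) R"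
proof -
  define m where "m = sqrt ((R\<^sup>2 - 1) * (1 - L\<^sup>2))"
  have ms: "snd (muIII L R) = [(pi * m / 2, 1), (pi * m / 2, - 1)]" by (simp add: muIII_def m_def)
  define S where "S z = sq2 R z * sq2 L z" for z
  \<comment> \<open>The linear term interpolates S at 1 and at -1, so one subtraction cancels both
    poles.\<close>
  define N where "N z = S z - \<i> * of_real m * z" for z
  have Ssq: "(S z)\<^sup>2 = (z\<^sup>2 - (of_real R)\<^sup>2) * (z\<^sup>2 - (of_real L)\<^sup>2)" for z
    by (simp add: S_def power_mult_distrib sq2_square)
  have S1: "S 1 = \<i> * of_real m"
    using sq2_real_mid[of 1 R] sq2_real_ge[of L 1] L R by (simp add: S_def m_def real_sqrt_mult)
  have Sm1: "S (- 1) = - \<i> * of_real m"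
    using sq2_real_mid[of "-1" R] sq2_real_le[of L "-1"] L R by (simp add: S_def m_def real_sqrt_mult)
  have dS: "S field_differentiable (at z within UH)" if "z = 1 \<or> z = - 1" for z
  proof -
    have "z \<in> UH" using that by (auto simp: UH_def)
    moreover have "z \<noteq> of_real R" "z \<noteq> - of_real R" "z \<noteq> of_real L" "z \<noteq> - of_real L"
      using that L R by (auto simp: complex_eq_iff)
    ultimately show ?thesis
      unfolding S_def[abs_def] by (intro field_differentiable_mult field_differentiable_at_within[OF sq2_differentiable])
  qed
  have dN: "\<exists>d. (N has_field_derivative d) (at z within UH)" if "z = 1 \<or> z = - 1" for z
    unfolding N_def[abs_def] field_differentiable_def[symmetric]
    by (intro field_differentiable_diff dS that field_differentiable_mult field_differentiable_const field_differentiable_ident)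
  obtain d1 where d1: "(N has_field_derivative d1) (at 1 within UH)" using dN by blast
  obtain d2 where d2: "(N has_field_derivative d2) (at (- 1) within UH)" using dN by blast
  have N0: "N 1 = 0" "N (- 1) = 0" by (simp_all add: N_def S1 Sm1)
  \<comment> \<open>Partial fractions of 1 / (z^2 - 1): each boundary pole gets its own difference
    quotient.\<close>
  define g where "g z = (dquot N d1 1 z - dquot N d2 (- 1) z) / 2 - 1" for z
  have z1: "z\<^sup>2 - 1 \<noteq> 0" if "z \<noteq> 1" "z \<noteq> - 1" for z :: complex
    using that by (metis eq_iff_diff_eq_0 power2_eq_1_iff)
  have g: "g z = (S z - \<i> * of_real m * z) / (z\<^sup>2 - 1) - 1" if "z \<noteq> 1" "z \<noteq> - 1" for z
  proof -
    have z: "z - 1 \<noteq> 0" "z + 1 \<noteq> 0" using that by (auto simp: add_eq_0_iff2)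
    have "g z = (N z / (z - 1) - N z / (z + 1)) / 2 - 1"
      using that by (simp add: g_def dquot_def N0)
    also have "N z / (z - 1) - N z / (z + 1) = 2 * N z / ((z - 1) * (z + 1))"
      using z by (simp add: divide_simps) (simp add: algebra_simps)
    also have "(z - 1) * (z + 1) = z\<^sup>2 - 1" by (simp add: power2_eq_square algebra_simps)
    also have "(2 * N z / (z\<^sup>2 - 1)) / 2 = N z / (z\<^sup>2 - 1)"
      by (metis divide_divide_eq_left' mult_divide_mult_cancel_left zero_neq_numeral)
    finally show ?thesis by (simp only: N_def)
  qed
  have contN: "continuous_on UH N"
    unfolding N_def S_def by (intro continuous_intros continuous_on_sq2)
  have holN: "N holomorphic_on {z. 0 < Im z}"
    unfolding N_def[abs_def] S_def[abs_def] by (intro holomorphic_intros sq2_holomorphic)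
  have atoms: "sum_list (map (\<lambda>(m, p). \<i> * of_real m / (of_real pi * (z - of_real p))) (snd (muIII L R))) = \<i> * of_real m * z / (z\<^sup>2 - 1)"
    if "z \<noteq> 1" "z \<noteq> - 1" for z :: complex
  proof -
    have z: "z - 1 \<noteq> 0" "z + 1 \<noteq> 0" using that by (auto simp: add_eq_0_iff2)
    have e: "z\<^sup>2 - 1 = (z - 1) * (z + 1)" by (simp add: power2_eq_square algebra_simps)
    have "sum_list (map (\<lambda>(m, p). \<i> * of_real m / (of_real pi * (z - of_real p))) (snd (muIII L R))) = (\<i> * of_real m / 2) * (1 / (z - 1) + 1 / (z + 1))"
    proof -
      have "\<i> * of_real (pi * m / 2) / (of_real pi * w) = (\<i> * of_real m / 2) * (1 / w)" for w :: complex
        by simp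
      then show ?thesis by (simp only: ms list.map sum_list.Cons sum_list.Nil case_prod_conv) (simp add: algebra_simps)
    qed
    also have "1 / (z - 1) + 1 / (z + 1) = 2 * z / (z\<^sup>2 - 1)"
      unfolding e using z by (simp add: divide_simps)
    finally show ?thesis by simp
  qed
  have "half_plane_density g (fst (muIII L R)) (snd (muIII L R)) (- (R\<^sup>2 + L\<^sup>2 - 2) / 2) R"
  proof
    show "continuous_on UH g"
      unfolding g_def by (intro continuous_intros continuous_on_dquot contN d1 d2) auto
    show "g holomorphic_on {z. 0 < Im z}"
      unfolding g_def by (intro holomorphic_intros holomorphic_on_dquot holN) auto
    let ?c = "of_real (2 - R\<^sup>2 - L\<^sup>2) :: complex"
    let ?k = "of_real (R\<^sup>2 * L\<^sup>2 - 1) :: complex"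
    let ?D = "\<lambda>z. (sq2 R z / z) * (sq2 L z / z) + 1 - (1 / z) * (1 / z)"
    have D: "(?D \<longlongrightarrow> 1 * 1 + 1 - 0 * 0) uhinf"
      by (intro tendsto_intros sq2_over_tendsto inverse_tendsto_uhinf)
    have "((\<lambda>z. (z / (z - 1)) * (z / (z - (- 1))) * ((?c + (?k / z) * (1 / z)) / ?D z)) \<longlongrightarrow> 1 * 1 * ((?c + 0 * 0) / (1 * 1 + 1 - 0 * 0))) uhinf"
      by (intro tendsto_mult tendsto_divide tendsto_add tendsto_const D inverse_shift_tendsto_uhinf inverse_tendsto_uhinf) auto
    moreover have "\<forall>\<^sub>F z in uhinf. (z / (z - 1)) * (z / (z - (- 1))) * ((?c + (?k / z) * (1 / z)) / ?D z) =
       z\<^sup>2 * (g z + sum_list (map (\<lambda>(m, p). \<i> * of_real m / (of_real pi * (z - of_real p))) (snd (muIII L R))))"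
    proof -
      have "\<forall>\<^sub>F z in uhinf. z \<noteq> 0 \<and> z \<noteq> 1 \<and> z \<noteq> - 1"
        unfolding eventually_uhinf by (intro exI[of _ 2]) auto
      moreover have "\<forall>\<^sub>F z in uhinf. ?D z \<noteq> 0"
        by (rule tendsto_imp_eventually_ne[of _ 2]) (use D in auto)
      ultimately show ?thesis
      proof eventually_elim
        case (elim z)
        have z: "z - 1 \<noteq> 0" "z + 1 \<noteq> 0" "z \<noteq> 0" using elim by (auto simp: add_eq_0_iff2)
        have e: "z\<^sup>2 - 1 = (z - 1) * (z + 1)" by (simp add: power2_eq_square algebra_simps)
        have zz: "z\<^sup>2 \<noteq> 0" using z by simp
        have DS: "?D z = (S z + (z\<^sup>2 - 1)) / z\<^sup>2"
          using z by (simp add: S_def power2_eq_square divide_simps)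
        then have nz: "S z + (z\<^sup>2 - 1) \<noteq> 0" using elim by auto
        have pr: "(S z - (z\<^sup>2 - 1)) * (S z + (z\<^sup>2 - 1)) = ?c * z\<^sup>2 + ?k"
        proof -
          have "(S z - (z\<^sup>2 - 1)) * (S z + (z\<^sup>2 - 1)) = (S z)\<^sup>2 - (z\<^sup>2 - 1)\<^sup>2"
            by (simp add: power2_eq_square algebra_simps)
          also have "\<dots> = ?c * z\<^sup>2 + ?k" unfolding Ssq by (simp add: power2_eq_square algebra_simps)
          finally show ?thesis .
        qed
        have "g z + sum_list (map (\<lambda>(m, p). \<i> * of_real m / (of_real pi * (z - of_real p))) (snd (muIII L R))) = S z / (z\<^sup>2 - 1) - 1"
          using elim by (simp add: g atoms diff_divide_distrib)
        also have "\<dots> = (S z - (z\<^sup>2 - 1)) / (z\<^sup>2 - 1)" using z1[of z] elim by (simp add: diff_divide_distrib)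
        also have "S z - (z\<^sup>2 - 1) = (?c * z\<^sup>2 + ?k) / (S z + (z\<^sup>2 - 1))"
          using pr nz by (simp add: eq_divide_eq)
        also have "?c * z\<^sup>2 + ?k = (?c + (?k / z) * (1 / z)) * z\<^sup>2" using z by (simp add: power2_eq_square field_simps)
        also have "S z + (z\<^sup>2 - 1) = ?D z * z\<^sup>2" using DS zz by simp
        also have "((?c + (?k / z) * (1 / z)) * z\<^sup>2) / (?D z * z\<^sup>2) = (?c + (?k / z) * (1 / z)) / ?D z"
          using zz by simp
        finally have "z\<^sup>2 * (g z + sum_list (map (\<lambda>(m, p). \<i> * of_real m / (of_real pi * (z - of_real p))) (snd (muIII L R))))
            = z\<^sup>2 / ((z - 1) * (z + 1)) * ((?c + (?k / z) * (1 / z)) / ?D z)"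
          unfolding e by simp
        also have "z\<^sup>2 / ((z - 1) * (z + 1)) = (z / (z - 1)) * (z / (z - (- 1)))" by (simp add: power2_eq_square)
        finally show ?case ..
      qed
    qed
    ultimately show "((\<lambda>z. z\<^sup>2 * (g z + sum_list (map (\<lambda>(m, p). \<i> * of_real m / (of_real pi * (z - of_real p))) (snd (muIII L R))))) \<longlongrightarrow> of_real (- (R\<^sup>2 + L\<^sup>2 - 2) / 2)) uhinf"
      by (simp add: filterlim_cong algebra_simps)
    show "fst (muIII L R) y = Re (g (of_real y))" if "y \<notin> snd ` set (snd (muIII L R))" for y
    proof -
      have y1: "y \<noteq> 1" "y \<noteq> - 1" using that by (auto simp: muIII_def)
      then have c1: "complex_of_real y \<noteq> 1" "complex_of_real y \<noteq> - 1"
        by (auto simp: complex_eq_iff)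
      have "g (of_real y) = (S (of_real y) - \<i> * of_real (m * y)) / of_real (y\<^sup>2 - 1) - 1"
        using g[OF c1] by simp
      then have "Re (g (of_real y)) = Re (S (of_real y)) / (y\<^sup>2 - 1) - 1"
        by (simp only: Re_divide_of_real minus_complex.simps one_complex.simps) simp
      moreover have "Re (S (of_real y)) / (y\<^sup>2 - 1) = (if \<bar>y\<bar> \<le> L \<or> \<bar>y\<bar> \<ge> R then sqrt ((y\<^sup>2 - R\<^sup>2) * (y\<^sup>2 - L\<^sup>2)) / \<bar>y\<^sup>2 - 1\<bar> else 0)"
      proof -
        consider "\<bar>y\<bar> \<le> L" | "L < \<bar>y\<bar>" "\<bar>y\<bar> < R" | "\<bar>y\<bar> \<ge> R" by linarith
        then show ?thesis
        proof cases
          case 1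
          \<comment> \<open>Both factors are imaginary here; the resulting minus sign matches y^2 -
            1 < 0.\<close>
          have "Re (S (of_real y)) = - (sqrt (R\<^sup>2 - y\<^sup>2) * sqrt (L\<^sup>2 - y\<^sup>2))"
            using sq2_real_mid[of y R] sq2_real_mid[of y L] 1 L R by (simp add: S_def)
          also have "sqrt (R\<^sup>2 - y\<^sup>2) * sqrt (L\<^sup>2 - y\<^sup>2) = sqrt ((y\<^sup>2 - R\<^sup>2) * (y\<^sup>2 - L\<^sup>2))"
            unfolding real_sqrt_mult[symmetric] by (simp add: algebra_simps)
          finally have "Re (S (of_real y)) = - sqrt ((y\<^sup>2 - R\<^sup>2) * (y\<^sup>2 - L\<^sup>2))" .
          moreover have "\<bar>y\<^sup>2 - 1\<bar> = - (y\<^sup>2 - 1)" using 1 L abs_square_less_1[of y] by auto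
          moreover have "- a / b = a / - b" for a b :: real by simp
          ultimately show ?thesis using 1 by (simp only: simp_thms if_True)
        next
          case 2
          then have "Re (S (of_real y)) = 0"
            using sq2_real_mid[of y R] sq2_real_ge[of L y] sq2_real_le[of L y] L R
            by (cases "y \<ge> 0") (auto simp: S_def)
          then show ?thesis using 2 by simp
        next
          case 3
          then have "Re (S (of_real y)) = sqrt ((y\<^sup>2 - R\<^sup>2) * (y\<^sup>2 - L\<^sup>2))"
            using sq2_real_ge[of R y] sq2_real_le[of R y] sq2_real_ge[of L y] sq2_real_le[of L y] L R
            by (cases "y \<ge> 0") (auto simp: S_def real_sqrt_mult)
          moreover have "\<bar>y\<^sup>2 - 1\<bar> = y\<^sup>2 - 1" using 3 R one_le_power[of "\<bar>y\<bar>" 2] by simp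
          ultimately show ?thesis using 3 by simp
        qed
      qed
      ultimately show ?thesis by (simp add: muIII_def)
    qed
    show "Im (g (of_real y)) + sum_list (map (\<lambda>(m, p). m / (pi * (y - p))) (snd (muIII L R))) = 0" if "R < \<bar>y\<bar>" for y
    proof -
      have y1: "y - 1 \<noteq> 0" "y + 1 \<noteq> 0" using that R by auto
      then have c1: "complex_of_real y \<noteq> 1" "complex_of_real y \<noteq> - 1"
        by (auto simp: complex_eq_iff)
      have e: "y\<^sup>2 - 1 = (y - 1) * (y + 1)" by (simp add: power2_eq_square algebra_simps)
      have "g (of_real y) = (S (of_real y) - \<i> * of_real (m * y)) / of_real (y\<^sup>2 - 1) - 1"
        using g[OF c1] by simp
      moreover have "Im (S (of_real y)) = 0"
        using sq2_real_ge[of R y] sq2_real_le[of R y] sq2_real_ge[of L y] sq2_real_le[of L y] L R that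
        by (cases "y \<ge> 0") (auto simp: S_def)
      ultimately have "Im (g (of_real y)) = - (m * y) / (y\<^sup>2 - 1)"
        by (simp only: Im_divide_of_real minus_complex.simps one_complex.simps) simp
      moreover have "sum_list (map (\<lambda>(m, p). m / (pi * (y - p))) (snd (muIII L R))) = (m / 2) * (1 / (y - 1) + 1 / (y + 1))"
      proof -
        have "(pi * m / 2) / (pi * w) = (m / 2) * (1 / w)" for w :: real by simp
        then show ?thesis by (simp only: ms list.map sum_list.Cons sum_list.Nil case_prod_conv) (simp add: algebra_simps)
      qed
      moreover have "1 / (y - 1) + 1 / (y + 1) = 2 * y / (y\<^sup>2 - 1)"
        unfolding e using y1 by (simp add: divide_simps)
      ultimately show ?thesis by simp
    qed
    show "fst (muIII L R) \<in> borel_measurable borel" unfolding muIII_def by simp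
    show "\<bar>p\<bar> < R" if "(m, p) \<in> set (snd (muIII L R))" for m p using that R by (auto simp: muIII_def)
  qed
  then show ?thesis by blast
qed

section \<open>The principal value integral\<close>

text \<open>A primitive of \<open>sqrt (m\<^sup>2 + s * u - u\<^sup>2) / u\<close>. Its last term
  carries the whole singularity at u = 0. It serves with u = x^2 - 1 for Phi and with u = x + 1, s =
  2 for KI 0 R.\<close>

definition Tprim :: "real \<Rightarrow> real \<Rightarrow> real \<Rightarrow> real" where
  "Tprim m s u = sqrt (m\<^sup>2 + s * u - u\<^sup>2) + s / 2 * arcsin ((2 * u - s) / sqrt (s\<^sup>2 + 4 * m\<^sup>2))
     - m * ln (2 * m\<^sup>2 + s * u + 2 * m * sqrt (m\<^sup>2 + s * u - u\<^sup>2)) + m * ln \<bar>u\<bar>"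

lemma DERIV_ln_abs: "u \<noteq> 0 \<Longrightarrow> ((\<lambda>u. ln \<bar>u\<bar>) has_real_derivative 1 / u) (at u)"
proof (cases "u > 0")
  case True
  have "(ln has_real_derivative 1 / u) (at u)" using True by (auto intro!: derivative_eq_intros)
  then show ?thesis
    by (rule has_field_derivative_transform_within_open[where S="{0<..}"]) (use True in auto)
next
  case False
  assume "u \<noteq> 0"
  then have u: "u < 0" using False by auto
  then have "((\<lambda>u. ln (- u)) has_real_derivative 1 / u) (at u)"
    by (auto intro!: derivative_eq_intros)
  then show ?thesis
    by (rule has_field_derivative_transform_within_open[where S="{..<0}"]) (use u in auto)
qed

text \<open>2 m^2 + s u is m^2 + u^2 plus the radicand.\<close>

lemma Tprim_log_arg_pos:
  assumes "m > 0" "m\<^sup>2 + s * u - u\<^sup>2 \<ge> 0"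
  shows "2 * m\<^sup>2 + s * u + 2 * m * sqrt (m\<^sup>2 + s * u - u\<^sup>2) > 0"
proof -
  have "2 * m\<^sup>2 + s * u > 0"
    using assms zero_less_power[of m 2] zero_le_power2[of u] by linarith
  moreover have "2 * m * sqrt (m\<^sup>2 + s * u - u\<^sup>2) \<ge> 0" using assms by simp
  ultimately show ?thesis by linarith
qed

lemma DERIV_Tprim:
  assumes m: "m > 0" and X: "m\<^sup>2 + s * u - u\<^sup>2 > 0" and u: "u \<noteq> 0"
  shows "(Tprim m s has_real_derivative sqrt (m\<^sup>2 + s * u - u\<^sup>2) / u) (at u)"
proof -
  define r where "r = sqrt (m\<^sup>2 + s * u - u\<^sup>2)"
  have r: "r > 0" "r\<^sup>2 = m\<^sup>2 + s * u - u\<^sup>2" using X by (auto simp: r_def)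
  define D where "D = sqrt (s\<^sup>2 + 4 * m\<^sup>2)"
  have D: "D > 0" "D\<^sup>2 = s\<^sup>2 + 4 * m\<^sup>2" using m by (auto simp: D_def intro!: add_nonneg_pos)
  define n where "n = 2 * m\<^sup>2 + s * u + 2 * m * r"
  have n: "n > 0" using Tprim_log_arg_pos[OF m, of s u] X by (simp add: n_def r_def)
  have d1: "((\<lambda>u. sqrt (m\<^sup>2 + s * u - u\<^sup>2)) has_real_derivative (s - 2 * u) / (2 * r)) (at u)"
    unfolding r_def using X by (auto intro!: derivative_eq_intros simp: field_simps)
  have sq: "D\<^sup>2 - (2 * u - s)\<^sup>2 = (2 * r)\<^sup>2"
    unfolding power_mult_distrib r(2) D(2) by (simp add: power2_eq_square algebra_simps)
  have "(2 * u - s)\<^sup>2 < D\<^sup>2" using sq r zero_less_power[of "2 * r" 2] by linarith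
  then have ab: "\<bar>2 * u - s\<bar> < D" using D by (metis abs_le_square_iff abs_of_pos linorder_not_less)
  have "(2 * r / D)\<^sup>2 = (D\<^sup>2 - (2 * u - s)\<^sup>2) / D\<^sup>2" by (simp only: power_divide sq)
  also have "\<dots> = 1 - ((2 * u - s) / D)\<^sup>2" 
    using D(1) by (simp add: diff_divide_distrib[of "D\<^sup>2"] power_divide[of "2 * u - s"])
  finally have "1 - ((2 * u - s) / D)\<^sup>2 = (2 * r / D)\<^sup>2" ..
  then have sq2: "sqrt (1 - ((2 * u - s) / D)\<^sup>2) = 2 * r / D" using r D by simp
  have d2: "((\<lambda>u. arcsin ((2 * u - s) / D)) has_real_derivative 1 / r) (at u)"
  proof -
    have "((\<lambda>u. arcsin ((2 * u - s) / D)) has_real_derivative inverse (sqrt (1 - ((2 * u - s) / D)\<^sup>2)) * (2 / D)) (at u)"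
      by (rule DERIV_chain2[of arcsin, OF DERIV_arcsin])
         (use ab D in \<open>auto intro!: derivative_eq_intros simp: field_simps abs_less_iff\<close>)
    also have "inverse (sqrt (1 - ((2 * u - s) / D)\<^sup>2)) * (2 / D) = 1 / r"
      unfolding sq2 using r D by (simp add: field_simps)
    finally show ?thesis .
  qed
  have d3: "((\<lambda>u. ln (2 * m\<^sup>2 + s * u + 2 * m * sqrt (m\<^sup>2 + s * u - u\<^sup>2))) has_real_derivative (s + 2 * m * ((s - 2 * u) / (2 * r))) / n) (at u)"
  proof -
    have "((\<lambda>u. 2 * m\<^sup>2 + s * u + 2 * m * sqrt (m\<^sup>2 + s * u - u\<^sup>2)) has_real_derivative s + 2 * m * ((s - 2 * u) / (2 * r))) (at u)"
      by (rule derivative_eq_intros d1 refl | simp)+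
    from DERIV_chain2[OF DERIV_ln_divide this] n show ?thesis
      unfolding r_def[symmetric] n_def[symmetric] by (simp only: times_divide_eq_left mult_1)
  qed
  have "(Tprim m s has_real_derivative (s - 2 * u) / (2 * r) + s / 2 * (1 / r) - m * ((s + 2 * m * ((s - 2 * u) / (2 * r))) / n) + m * (1 / u)) (at u)"
    unfolding Tprim_def[abs_def] D_def[symmetric]
    by (intro DERIV_add DERIV_diff DERIV_cmult d1 d2 d3 DERIV_ln_abs u)
  moreover have "(s - 2 * u) / (2 * r) + s / 2 * (1 / r) - m * ((s + 2 * m * ((s - 2 * u) / (2 * r))) / n) + m * (1 / u) = r / u"
  proof -
    \<comment> \<open>The denominator n cancels because n (r - m) = u (r s + m (s - 2 u)).\<close>
    have e: "(s + 2 * m * ((s - 2 * u) / (2 * r))) / n = 1 / u - m / (r * u)"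
    proof -
      have "n * (r - m) = u * (r * s + m * (s - 2 * u)) + 2 * m * (r\<^sup>2 - (m\<^sup>2 + s * u - u\<^sup>2))"
        by (simp add: n_def algebra_simps power2_eq_square)
      then have "n * (r - m) = u * (r * s + m * (s - 2 * u))" using r by simp
      then show ?thesis using n r u by (simp add: divide_simps) (simp add: algebra_simps)
    qed
    have "(s - 2 * u) / (2 * r) + s / 2 * (1 / r) - m * (1 / u - m / (r * u)) + m * (1 / u) = (m * m + s * u - u * u) / (r * u)"
      using r u by (simp add: divide_simps) (simp add: algebra_simps)
    also have "m * m + s * u - u * u = r * r" using r(2) by (simp add: power2_eq_square)
    finally show ?thesis unfolding e using r by simp
  qed
  ultimately show ?thesis by (simp add: r_def)
qed

text \<open>Continuity across u = 0 after removing m ln |u| is what makes the regular part drop out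
  of the principal value.\<close>

lemma continuous_on_Tprim_regular:
  assumes m: "m > 0" and X: "\<And>u. u \<in> S \<Longrightarrow> m\<^sup>2 + s * u - u\<^sup>2 \<ge> 0"
  shows "continuous_on S (\<lambda>u. Tprim m s u - m * ln \<bar>u\<bar>)"
proof -
  have D: "s\<^sup>2 + 4 * m\<^sup>2 > 0" using m by (auto intro!: add_nonneg_pos)
  have ar: "\<bar>(2 * u - s) / sqrt (s\<^sup>2 + 4 * m\<^sup>2)\<bar> \<le> 1" if "u \<in> S" for u
  proof -
    have "(2 * u - s)\<^sup>2 \<le> s\<^sup>2 + 4 * m\<^sup>2" using X[OF that] by (simp add: power2_eq_square algebra_simps)
    then have "\<bar>2 * u - s\<bar> \<le> sqrt (s\<^sup>2 + 4 * m\<^sup>2)" using real_le_rsqrt real_sqrt_abs real_sqrt_le_iff by metis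
    then show ?thesis using D by (simp add: abs_divide divide_le_eq)
  qed
  have "continuous_on S (\<lambda>u. sqrt (m\<^sup>2 + s * u - u\<^sup>2) + s / 2 * arcsin ((2 * u - s) / sqrt (s\<^sup>2 + 4 * m\<^sup>2))
     - m * ln (2 * m\<^sup>2 + s * u + 2 * m * sqrt (m\<^sup>2 + s * u - u\<^sup>2)))"
  proof (intro continuous_intros ballI)
    fix u assume u: "u \<in> S"
    show "sqrt (s\<^sup>2 + 4 * m\<^sup>2) \<noteq> 0" using D by simp
    show "- 1 \<le> (2 * u - s) / sqrt (s\<^sup>2 + 4 * m\<^sup>2) \<and> (2 * u - s) / sqrt (s\<^sup>2 + 4 * m\<^sup>2) \<le> 1"
      using ar[OF u] by linarith
    show "2 * m\<^sup>2 + s * u + 2 * m * sqrt (m\<^sup>2 + s * u - u\<^sup>2) \<noteq> 0"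
      using Tprim_log_arg_pos[OF m X[OF u]] by linarith
  qed
  then show ?thesis by (simp add: Tprim_def)
qed

lemma continuous_on_Tprim:
  assumes m: "m > 0" and X: "\<And>u. u \<in> S \<Longrightarrow> m\<^sup>2 + s * u - u\<^sup>2 \<ge> 0 \<and> u \<noteq> 0"
  shows "continuous_on S (Tprim m s)"
proof -
  have "continuous_on S (\<lambda>u. (Tprim m s u - m * ln \<bar>u\<bar>) + m * ln \<bar>u\<bar>)"
    using X by (intro continuous_on_add continuous_on_Tprim_regular m continuous_intros) auto
  then show ?thesis by simp
qed

section \<open>Reduction of Phi to a regular integral\<close>

definition kr :: "real \<Rightarrow> real \<Rightarrow> real \<Rightarrow> real" where
  "kr L R x = sqrt ((R\<^sup>2 - x\<^sup>2) * (x\<^sup>2 - L\<^sup>2))"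

definition KI :: "real \<Rightarrow> real \<Rightarrow> real" where
  "KI L R = integral {L..R} (\<lambda>x. kr L R x / (x + 1))"

lemma kr_arg_nonneg:
  fixes x :: real
  assumes "0 \<le> L" "x \<in> {L..R}"
  shows "(R\<^sup>2 - x\<^sup>2) * (x\<^sup>2 - L\<^sup>2) \<ge> 0"
  using assms by (intro mult_nonneg_nonneg) (auto intro!: power_mono)

lemma kr_arg_pos:
  fixes x :: real
  assumes "0 \<le> L" "x \<in> {L<..<R}"
  shows "(R\<^sup>2 - x\<^sup>2) * (x\<^sup>2 - L\<^sup>2) > 0"
  using assms by (intro mult_pos_pos) (auto intro!: power_strict_mono)

lemma continuous_on_kr: "continuous_on S (kr L R)"
  unfolding kr_def by (intro continuous_intros)

lemma kr_integrable:
  assumes "0 \<le> L" "L \<le> a"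
  shows "(\<lambda>x. kr L R x / (x + 1)) integrable_on {a..b}"
proof (intro integrable_continuous_real continuous_on_divide continuous_on_kr continuous_on_add
    continuous_on_id continuous_on_const ballI)
  fix x assume "x \<in> {a..b}"
  then show "x + 1 \<noteq> 0" using assms by simp
qed

context
  fixes L R m s :: real
  assumes L: "0 \<le> L" "L < 1" and R: "1 < R"
  defines "m \<equiv> sqrt ((R\<^sup>2 - 1) * (1 - L\<^sup>2))" and "s \<equiv> R\<^sup>2 + L\<^sup>2 - 2"
begin

private lemma AB: "R\<^sup>2 - 1 > 0" "1 - L\<^sup>2 > 0"
  using L R by (auto simp: power2_eq_square mult_less_cancel_right intro: less_1_mult)
     (metis L(1) L(2) abs_of_nonneg abs_square_less_1 power2_eq_square)

private lemma m_pos: "m > 0" and m_sq: "m\<^sup>2 = (R\<^sup>2 - 1) * (1 - L\<^sup>2)"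
  using AB by (auto simp: m_def)

text \<open>The substitution u = x^2 - 1 makes the quartic under the root quadratic in u, with value
  m^2 at the singular point.\<close>

private lemma X_eq: "m\<^sup>2 + s * (x\<^sup>2 - 1) - (x\<^sup>2 - 1)\<^sup>2 = (R\<^sup>2 - x\<^sup>2) * (x\<^sup>2 - L\<^sup>2)"
  unfolding m_sq s_def by (simp add: power2_eq_square algebra_simps)

lemma kr_has_integral:
  assumes ab: "L \<le> a" "a \<le> b" "b \<le> R" and 1: "1 \<notin> {a..b}"
  shows "((\<lambda>x. kr L R x * x / (x\<^sup>2 - 1)) has_integral (Tprim m s (b\<^sup>2 - 1) / 2 - Tprim m s (a\<^sup>2 - 1) / 2)) {a..b}"
proof (rule fundamental_theorem_of_calculus_interior[OF ab(2)])
  have ne: "x\<^sup>2 - 1 \<noteq> 0" if "x \<in> {a..b}" for x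
    using that 1 ab L by (auto simp: power2_eq_1_iff)
  have "continuous_on ((\<lambda>x. x\<^sup>2 - 1) ` {a..b}) (Tprim m s)"
  proof (rule continuous_on_Tprim[OF m_pos])
    fix u assume "u \<in> (\<lambda>x. x\<^sup>2 - 1) ` {a..b}"
    then obtain x where x: "x \<in> {a..b}" "u = x\<^sup>2 - 1" by auto
    show "m\<^sup>2 + s * u - u\<^sup>2 \<ge> 0 \<and> u \<noteq> 0"
      unfolding x(2) X_eq using ne[OF x(1)] kr_arg_nonneg[of L x R] x ab L by auto
  qed
  then have "continuous_on {a..b} (\<lambda>x. Tprim m s (x\<^sup>2 - 1))"
    by (rule continuous_on_compose2) (auto intro!: continuous_intros)
  then show "continuous_on {a..b} (\<lambda>x. Tprim m s (x\<^sup>2 - 1) / 2)" by (intro continuous_intros) auto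
  fix x assume x: "x \<in> {a<..<b}"
  have "((\<lambda>x. Tprim m s (x\<^sup>2 - 1) / 2) has_real_derivative (sqrt (m\<^sup>2 + s * (x\<^sup>2 - 1) - (x\<^sup>2 - 1)\<^sup>2) / (x\<^sup>2 - 1) * (2 * x)) / 2) (at x)"
  proof (intro DERIV_cdivide DERIV_chain2[of "Tprim m s", OF DERIV_Tprim] m_pos)
    show "0 < m\<^sup>2 + s * (x\<^sup>2 - 1) - (x\<^sup>2 - 1)\<^sup>2"
      unfolding X_eq using x ab L by (intro kr_arg_pos) auto
    show "x\<^sup>2 - 1 \<noteq> 0" using ne x by auto
    show "((\<lambda>x. x\<^sup>2 - 1) has_real_derivative 2 * x) (at x)" by (auto intro!: derivative_eq_intros)
  qed
  then show "((\<lambda>x. Tprim m s (x\<^sup>2 - 1) / 2) has_vector_derivative kr L R x * x / (x\<^sup>2 - 1)) (at x)"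
  proof -
    have "(K / d * (2 * x)) / 2 = K * x / d" for K d :: real by simp
    moreover assume "((\<lambda>x. Tprim m s (x\<^sup>2 - 1) / 2) has_real_derivative (sqrt (m\<^sup>2 + s * (x\<^sup>2 - 1) - (x\<^sup>2 - 1)\<^sup>2) / (x\<^sup>2 - 1) * (2 * x)) / 2) (at x)"
    ultimately show ?thesis
      unfolding X_eq by (simp only: kr_def has_real_derivative_iff_has_vector_derivative)
  qed
qed

lemma Phi_integrand_integral:
  assumes ab: "L \<le> a" "a \<le> b" "b \<le> R" and 1: "1 \<notin> {a..b}"
  shows "integral {a..b} (\<lambda>x. pi * sqrt ((R\<^sup>2 - x\<^sup>2) * (x\<^sup>2 - L\<^sup>2)) / (x\<^sup>2 - 1)) =
    pi * (Tprim m s (b\<^sup>2 - 1) / 2 - Tprim m s (a\<^sup>2 - 1) / 2 - integral {a..b} (\<lambda>x. kr L R x / (x + 1)))"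
proof (rule integral_unique)
  have "((\<lambda>x. pi * (kr L R x * x / (x\<^sup>2 - 1) - kr L R x / (x + 1))) has_integral
     pi * (Tprim m s (b\<^sup>2 - 1) / 2 - Tprim m s (a\<^sup>2 - 1) / 2 - integral {a..b} (\<lambda>x. kr L R x / (x + 1)))) {a..b}"
    by (intro has_integral_mult_right has_integral_diff kr_has_integral assms integrable_integral kr_integrable L)
  moreover have "pi * (kr L R x * x / (x\<^sup>2 - 1) - kr L R x / (x + 1)) = pi * sqrt ((R\<^sup>2 - x\<^sup>2) * (x\<^sup>2 - L\<^sup>2)) / (x\<^sup>2 - 1)"
    if "x \<in> {a..b}" for x
  proof -
    have z: "x - 1 \<noteq> 0" "x + 1 \<noteq> 0" using that 1 ab L by auto
    have e: "x\<^sup>2 - 1 = (x - 1) * (x + 1)" by (simp add: power2_eq_square algebra_simps)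
    show ?thesis unfolding kr_def[symmetric] e using z by (simp add: divide_simps) (simp add: algebra_simps)
  qed
  ultimately show "((\<lambda>x. pi * sqrt ((R\<^sup>2 - x\<^sup>2) * (x\<^sup>2 - L\<^sup>2)) / (x\<^sup>2 - 1)) has_integral
     pi * (Tprim m s (b\<^sup>2 - 1) / 2 - Tprim m s (a\<^sup>2 - 1) / 2 - integral {a..b} (\<lambda>x. kr L R x / (x + 1)))) {a..b}"
    by (rule has_integral_eq[rotated])
qed

text \<open>At both ends the radicand vanishes and the arcsine is pi / 2 or - pi / 2. The logarithms
  reduce to - m ln (A + B) at either end and cancel.\<close>

private lemma Tprim_ends: "Tprim m s (R\<^sup>2 - 1) - Tprim m s (L\<^sup>2 - 1) = pi * s / 2"
proof -
  define A B where "A = R\<^sup>2 - 1" and "B = 1 - L\<^sup>2"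
  have AB': "A > 0" "B > 0" using AB by (auto simp: A_def B_def)
  have ms: "m\<^sup>2 = A * B" "s = A - B" by (simp_all add: m_sq A_def B_def s_def)
  have D: "sqrt (s\<^sup>2 + 4 * m\<^sup>2) = A + B"
  proof -
    have "s\<^sup>2 + 4 * m\<^sup>2 = (A + B)\<^sup>2" unfolding ms by (simp add: power2_eq_square algebra_simps)
    then show ?thesis using AB' by simp
  qed
  have XA: "m\<^sup>2 + s * A - A\<^sup>2 = 0" unfolding ms by (simp add: power2_eq_square algebra_simps)
  have XB: "m\<^sup>2 + s * (- B) - (- B)\<^sup>2 = 0" unfolding ms by (simp add: power2_eq_square algebra_simps)
  have nA: "2 * m\<^sup>2 + s * A = A * (A + B)" unfolding ms by (simp add: power2_eq_square algebra_simps)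
  have nB: "2 * m\<^sup>2 + s * (- B) = B * (A + B)" unfolding ms by (simp add: power2_eq_square algebra_simps)
  have aA: "(2 * A - s) / (A + B) = 1" and aB: "(2 * (- B) - s) / (A + B) = - 1"
    using AB' by (auto simp: ms field_simps)
  have "Tprim m s A = s / 2 * (pi / 2) - m * ln (A * (A + B)) + m * ln A"
    unfolding Tprim_def XA D aA using nA AB' by simp
  moreover have "Tprim m s (- B) = s / 2 * (- (pi / 2)) - m * ln (B * (A + B)) + m * ln B"
    unfolding Tprim_def XB D aB using nB AB' by simp
  moreover have "ln (A * (A + B)) = ln A + ln (A + B)" "ln (B * (A + B)) = ln B + ln (A + B)"
    using AB' by (simp_all add: ln_mult)
  ultimately have "Tprim m s A - Tprim m s (- B) = pi * s / 2" by (simp add: algebra_simps)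
  moreover have "L\<^sup>2 - 1 = - B" by (simp add: B_def)
  ultimately show ?thesis unfolding A_def by (simp only:)
qed

text \<open>The cut-off is symmetric in x, not in u: |u| is e (2 - e) on one side and e (2 + e) on
  the other. The terms ln e cancel and the other factors both tend to 2.\<close>

private lemma Tprim_jump:
  "((\<lambda>e. Tprim m s ((1 - e)\<^sup>2 - 1) - Tprim m s ((1 + e)\<^sup>2 - 1)) \<longlongrightarrow> 0) (at_right 0)"
proof -
  define U where "U = {L\<^sup>2 - 1<..<R\<^sup>2 - 1}"
  define T0 where "T0 u = Tprim m s u - m * ln \<bar>u\<bar>" for u
  have "continuous_on U T0"
    unfolding T0_def
  proof (rule continuous_on_Tprim_regular[OF m_pos])
    fix u assume u: "u \<in> U"
    have "m\<^sup>2 + s * u - u\<^sup>2 = (R\<^sup>2 - 1 - u) * (u + 1 - L\<^sup>2)"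
      unfolding m_sq s_def by (simp add: power2_eq_square algebra_simps)
    then show "m\<^sup>2 + s * u - u\<^sup>2 \<ge> 0" using u by (auto simp: U_def intro!: mult_nonneg_nonneg)
  qed
  moreover have "0 \<in> U" "open U" using AB by (auto simp: U_def)
  ultimately have c: "isCont T0 0" using continuous_on_eq_continuous_at by blast
  have "((\<lambda>e::real. (1 - e)\<^sup>2 - 1) \<longlongrightarrow> 0) (at_right 0)" "((\<lambda>e::real. (1 + e)\<^sup>2 - 1) \<longlongrightarrow> 0) (at_right 0)"
    by (auto intro!: tendsto_eq_intros)
  then have "((\<lambda>e. T0 ((1 - e)\<^sup>2 - 1) - T0 ((1 + e)\<^sup>2 - 1)) \<longlongrightarrow> T0 0 - T0 0) (at_right 0)"
    by (intro tendsto_diff isCont_tendsto_compose[OF c])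
  moreover have "((\<lambda>e::real. m * (ln (2 - e) - ln (2 + e))) \<longlongrightarrow> m * (ln (2 - 0) - ln (2 + 0))) (at_right 0)"
    by (intro tendsto_intros) auto
  ultimately have "((\<lambda>e. (T0 ((1 - e)\<^sup>2 - 1) - T0 ((1 + e)\<^sup>2 - 1)) + m * (ln (2 - e) - ln (2 + e))) \<longlongrightarrow> (T0 0 - T0 0) + m * (ln (2 - 0) - ln (2 + 0))) (at_right 0)"
    by (rule tendsto_add)
  moreover have "\<forall>\<^sub>F e in at_right 0. (T0 ((1 - e)\<^sup>2 - 1) - T0 ((1 + e)\<^sup>2 - 1)) + m * (ln (2 - e) - ln (2 + e)) = Tprim m s ((1 - e)\<^sup>2 - 1) - Tprim m s ((1 + e)\<^sup>2 - 1)"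
  proof (rule eventually_at_rightI[of 0 1])
    fix e :: real assume e: "e \<in> {0<..<1}"
    have "\<bar>(1 - e)\<^sup>2 - 1\<bar> = e * (2 - e)" using e by (auto simp: power2_eq_square algebra_simps abs_if mult_less_cancel_left)
    then have 1: "ln \<bar>(1 - e)\<^sup>2 - 1\<bar> = ln e + ln (2 - e)" using e by (simp add: ln_mult)
    have "\<bar>(1 + e)\<^sup>2 - 1\<bar> = e * (2 + e)" using e by (auto simp: power2_eq_square algebra_simps)
    then have 2: "ln \<bar>(1 + e)\<^sup>2 - 1\<bar> = ln e + ln (2 + e)" using e by (simp add: ln_mult)
    show "(T0 ((1 - e)\<^sup>2 - 1) - T0 ((1 + e)\<^sup>2 - 1)) + m * (ln (2 - e) - ln (2 + e)) = Tprim m s ((1 - e)\<^sup>2 - 1) - Tprim m s ((1 + e)\<^sup>2 - 1)"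
      unfolding T0_def 1 2 by (simp add: algebra_simps)
  qed auto
  ultimately show ?thesis by (simp add: filterlim_cong)
qed

lemma Phi_eq: "Phi L R = pi * (pi * s / 4 - KI L R)"
proof -
  define f where "f x = kr L R x / (x + 1)" for x
  have fint: "f integrable_on {L..R}" unfolding f_def by (rule kr_integrable) (use L in auto)
  have l1: "((\<lambda>e. integral {L..1 - e} f) \<longlongrightarrow> integral {L..1} f) (at_right 0)"
  proof -
    have "continuous_on {L..R} (\<lambda>x. integral {L..x} f)" by (rule indefinite_integral_continuous_1[OF fint])
    then have "isCont (\<lambda>x. integral {L..x} f) 1"
      using L R by (intro continuous_on_interior[of "{L..R}"]) auto
    moreover have "((\<lambda>e::real. 1 - e) \<longlongrightarrow> 1) (at_right 0)" by (auto intro!: tendsto_eq_intros)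
    ultimately show ?thesis by (rule isCont_tendsto_compose)
  qed
  have l2: "((\<lambda>e. integral {1 + e..R} f) \<longlongrightarrow> integral {1..R} f) (at_right 0)"
  proof -
    have "continuous_on {L..R} (\<lambda>x. integral {x..R} f)" by (rule indefinite_integral_continuous_1'[OF fint])
    then have "isCont (\<lambda>x. integral {x..R} f) 1"
      using L R by (intro continuous_on_interior[of "{L..R}"]) auto
    moreover have "((\<lambda>e::real. 1 + e) \<longlongrightarrow> 1) (at_right 0)" by (auto intro!: tendsto_eq_intros)
    ultimately show ?thesis by (rule isCont_tendsto_compose)
  qed
  have comb: "integral {L..1} f + integral {1..R} f = KI L R"
    unfolding KI_def f_def[symmetric] using L R fint by (intro Henstock_Kurzweil_Integration.integral_combine) auto
  have "((\<lambda>e. pi * ((Tprim m s ((1 - e)\<^sup>2 - 1) - Tprim m s ((1 + e)\<^sup>2 - 1)) / 2 + (Tprim m s (R\<^sup>2 - 1) - Tprim m s (L\<^sup>2 - 1)) / 2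
           - (integral {L..1 - e} f + integral {1 + e..R} f))) \<longlongrightarrow> pi * (0 / 2 + (pi * s / 2) / 2 - (integral {L..1} f + integral {1..R} f))) (at_right 0)"
    unfolding Tprim_ends by (intro tendsto_intros Tprim_jump l1 l2) auto
  moreover have "\<forall>\<^sub>F e in at_right 0. pi * ((Tprim m s ((1 - e)\<^sup>2 - 1) - Tprim m s ((1 + e)\<^sup>2 - 1)) / 2 + (Tprim m s (R\<^sup>2 - 1) - Tprim m s (L\<^sup>2 - 1)) / 2
           - (integral {L..1 - e} f + integral {1 + e..R} f)) = integral {L..1 - e} (\<lambda>x. pi * sqrt ((R\<^sup>2 - x\<^sup>2) * (x\<^sup>2 - L\<^sup>2)) / (x\<^sup>2 - 1))
    + integral {1 + e..R} (\<lambda>x. pi * sqrt ((R\<^sup>2 - x\<^sup>2) * (x\<^sup>2 - L\<^sup>2)) / (x\<^sup>2 - 1))"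
  proof (rule eventually_at_rightI[of 0 "min (1 - L) (R - 1)"])
    fix e assume e: "e \<in> {0<..<min (1 - L) (R - 1)}"
    have i1: "integral {L..1 - e} (\<lambda>x. pi * sqrt ((R\<^sup>2 - x\<^sup>2) * (x\<^sup>2 - L\<^sup>2)) / (x\<^sup>2 - 1)) = pi * (Tprim m s ((1 - e)\<^sup>2 - 1) / 2 - Tprim m s (L\<^sup>2 - 1) / 2 - integral {L..1 - e} f)"
      unfolding f_def by (rule Phi_integrand_integral) (use e L R in auto)
    have i2: "integral {1 + e..R} (\<lambda>x. pi * sqrt ((R\<^sup>2 - x\<^sup>2) * (x\<^sup>2 - L\<^sup>2)) / (x\<^sup>2 - 1)) = pi * (Tprim m s (R\<^sup>2 - 1) / 2 - Tprim m s ((1 + e)\<^sup>2 - 1) / 2 - integral {1 + e..R} f)"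
      unfolding f_def by (rule Phi_integrand_integral) (use e L R in auto)
    show "pi * ((Tprim m s ((1 - e)\<^sup>2 - 1) - Tprim m s ((1 + e)\<^sup>2 - 1)) / 2 + (Tprim m s (R\<^sup>2 - 1) - Tprim m s (L\<^sup>2 - 1)) / 2
           - (integral {L..1 - e} f + integral {1 + e..R} f)) = integral {L..1 - e} (\<lambda>x. pi * sqrt ((R\<^sup>2 - x\<^sup>2) * (x\<^sup>2 - L\<^sup>2)) / (x\<^sup>2 - 1))
    + integral {1 + e..R} (\<lambda>x. pi * sqrt ((R\<^sup>2 - x\<^sup>2) * (x\<^sup>2 - L\<^sup>2)) / (x\<^sup>2 - 1))"
      unfolding i1 i2 by (simp add: field_simps)
  qed (use L R in auto)
  ultimately have "((\<lambda>e. integral {L..1 - e} (\<lambda>x. pi * sqrt ((R\<^sup>2 - x\<^sup>2) * (x\<^sup>2 - L\<^sup>2)) / (x\<^sup>2 - 1))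
    + integral {1 + e..R} (\<lambda>x. pi * sqrt ((R\<^sup>2 - x\<^sup>2) * (x\<^sup>2 - L\<^sup>2)) / (x\<^sup>2 - 1))) \<longlongrightarrow> pi * (0 / 2 + (pi * s / 2) / 2 - (integral {L..1} f + integral {1..R} f))) (at_right 0)"
    by (simp only: filterlim_cong[OF refl refl])
  then have "Phi L R = pi * (0 / 2 + (pi * s / 2) / 2 - (integral {L..1} f + integral {1..R} f))"
    unfolding Phi_def by (intro tendsto_Lim) auto
  then show ?thesis unfolding comb by simp
qed

end

text \<open>In the Bernstein basis of degree 9 all coefficients of the difference are positive.\<close>
lemma bernstein_polynomial_pos:
  fixes L :: real
  assumes "0 \<le> L" "L \<le> 1"
  shows "48400 * (1 + L)\<^sup>2 < 121 * (17 - 3 * L\<^sup>2)\<^sup>2 * (L\<^sup>2 * (1 + L)\<^sup>2) + 3080 * (17 - 3 * L\<^sup>2) * (1 + L) + 19600"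
proof -
  define M where "M = 1 - L"
  have M: "M \<ge> 0" using assms by (simp add: M_def)
  have "121 * (17 - 3 * L\<^sup>2)\<^sup>2 * (L\<^sup>2 * (1 + L)\<^sup>2) + 3080 * (17 - 3 * L\<^sup>2) * (1 + L) + 19600 - 48400 * (1 + L)\<^sup>2
    = 23560 * M ^ 9 + 167600 * L * M ^ 8 + 469969 * L ^ 2 * M ^ 7 + 636721 * L ^ 3 * M ^ 6 + 390644 * L ^ 4 * M ^ 5
      + 63196 * L ^ 5 * M ^ 4 + 27156 * L ^ 6 * M ^ 3 + 84804 * L ^ 7 * M ^ 2 + 48096 * L ^ 8 * M + 7104 * L ^ 9"
    unfolding M_def by algebra
  moreover have "\<dots> > 0"
  proof (cases "M = 0")
    case True
    then have "L = 1" by (simp add: M_def)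
    then show ?thesis using True by simp
  next
    case False
    then have "M > 0" using M by simp
    then have "23560 * M ^ 9 > 0" by simp
    moreover have "0 \<le> 167600 * L * M ^ 8" "0 \<le> 469969 * L ^ 2 * M ^ 7" "0 \<le> 636721 * L ^ 3 * M ^ 6" "0 \<le> 390644 * L ^ 4 * M ^ 5"
      "0 \<le> 63196 * L ^ 5 * M ^ 4" "0 \<le> 27156 * L ^ 6 * M ^ 3" "0 \<le> 84804 * L ^ 7 * M ^ 2" "0 \<le> 48096 * L ^ 8 * M" "0 \<le> 7104 * L ^ 9"
      using assms M by simp_all
    ultimately show ?thesis by linarith
  qed
  ultimately show ?thesis by linarith
qed

text \<open>With \<open>s = B\<^sup>2 y\<^sup>2\<close> the hypothesis forces \<open>y\<^sup>2 \<ge> 1 / (2 - B + 3 B\<^sup>2 / 8)\<close>; the polynomial \<open>u\<close> is a lower bound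
  for the square root of the right-hand side.\<close>
lemma pi_mass_gap_lt:
  fixes L s :: real
  assumes L: "0 \<le> L" "L < 1" and s: "s > 0"
    and c: "(s + 2 * (1 - L\<^sup>2))\<^sup>2 \<le> s * (8 + 3 * s)"
  shows "pi * (sqrt ((1 - L\<^sup>2 + s) * (1 - L\<^sup>2)) - sqrt s) < 2 * (1 - L)"
proof -
  define B where "B = 1 - L\<^sup>2"
  define y where "y = sqrt s / B"
  define u where "u = (17 - 3 * L\<^sup>2) / 20"
  \<comment> \<open>As 2 (1 - L) = pi B k, the claim divided by pi B reads sqrt (1 + B y^2) < y + k,
    or 1 < L^2 y^2 + 2 y k + k^2. The right side increases in y and k, so u and k0 may replace them;
    k0 is k with 22 / 7 for pi.\<close>
  define k where "k = 2 / (pi * (1 + L))"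
  define k0 where "k0 = 7 / (11 * (1 + L))"
  have v: "0 \<le> L\<^sup>2" "L\<^sup>2 < 1" using L by (auto simp: abs_square_less_1)
  have B: "0 < B" "B \<le> 1" using v by (auto simp: B_def)
  have y0: "y > 0" using s B by (simp add: y_def)
  have sy: "sqrt s = B * y" using B by (simp add: y_def)
  have s_eq: "s = B\<^sup>2 * y\<^sup>2" using sy s by (metis power_mult_distrib real_sqrt_pow2 less_imp_le)
  have u0: "0 < u" "u \<le> 17 / 20" using v by (auto simp: u_def)
  have "u\<^sup>2 \<le> (17 / 20)\<^sup>2" using u0 by (intro power_mono) auto
  then have u34: "u\<^sup>2 \<le> 3 / 4" by (simp add: power2_eq_square)
  have Q: "u\<^sup>2 * (2 - B + 3 * B\<^sup>2 / 8) \<le> 1"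
  proof -
    define w where "w = L\<^sup>2"
    have w: "0 \<le> w" "w \<le> 1" using v by (auto simp: w_def)
    have "w ^ 3 \<le> w\<^sup>2" using w by (intro power_decreasing) auto
    then have "544 - 762 * w + 288 * w\<^sup>2 - 27 * w ^ 3 \<ge> 43 + (1 - w) * (501 - 261 * w)"
      by (simp add: algebra_simps power2_eq_square)
    moreover have "(1 - w) * (501 - 261 * w) \<ge> 0" using w by (intro mult_nonneg_nonneg) auto
    ultimately have "544 - 762 * w + 288 * w\<^sup>2 - 27 * w ^ 3 \<ge> 0" by linarith
    then have "w * (544 - 762 * w + 288 * w\<^sup>2 - 27 * w ^ 3) \<ge> 0" using w by (intro mult_nonneg_nonneg)
    moreover have "3200 - (17 - 3 * w)\<^sup>2 * (11 + 2 * w + 3 * w\<^sup>2) = 21 + w * (544 - 762 * w + 288 * w\<^sup>2 - 27 * w ^ 3)"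
      by algebra
    ultimately have "(17 - 3 * w)\<^sup>2 * (11 + 2 * w + 3 * w\<^sup>2) \<le> 3200" by linarith
    moreover have "u\<^sup>2 * (2 - B + 3 * B\<^sup>2 / 8) = (17 - 3 * w)\<^sup>2 * (11 + 2 * w + 3 * w\<^sup>2) / 3200"
      unfolding u_def B_def w_def[symmetric] by (simp add: power2_eq_square field_simps)
    ultimately show ?thesis by simp
  qed
  have uy: "u \<le> y"
  proof (rule ccontr)
    assume "\<not> u \<le> y"
    then have "y < u" by simp
    then have yu: "y\<^sup>2 < u\<^sup>2" using y0 by (intro power_strict_mono) auto
    define t where "t = y\<^sup>2"
    have t: "0 < t" "t < u\<^sup>2" using y0 yu by (auto simp: t_def)
    have "(B\<^sup>2 * t + 2 * B)\<^sup>2 \<le> B\<^sup>2 * t * (8 + 3 * (B\<^sup>2 * t))"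
      using c unfolding s_eq t_def B_def by simp
    then have "4 * B\<^sup>2 * 1 \<le> 4 * B\<^sup>2 * (B\<^sup>2 * t * t / 2 + (2 - B) * t)"
      by (simp add: power2_eq_square algebra_simps)
    then have 1: "1 \<le> B\<^sup>2 * t * t / 2 + (2 - B) * t"
      using B by (subst (asm) mult_le_cancel_left_pos) auto
    \<comment> \<open>The rough bound t < u^2 <= 3 / 4 makes the quadratic inequality linear in
      t.\<close>
    have "B\<^sup>2 * t * t \<le> B\<^sup>2 * t * (3 / 4)" using t u34 by (intro mult_left_mono) auto
    then have "1 \<le> t * (2 - B + 3 * B\<^sup>2 / 8)" using 1 by (simp add: algebra_simps)
    also have "\<dots> < u\<^sup>2 * (2 - B + 3 * B\<^sup>2 / 8)"
      using t B by (intro mult_strict_right_mono add_pos_nonneg) auto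
    also have "\<dots> \<le> 1" by (rule Q)
    finally show False by simp
  qed
  have kk: "k0 \<le> k"
  proof -
    have "7 / 11 \<le> 2 / pi" using pi_approx(2) by (simp add: field_simps)
    then have "7 / 11 / (1 + L) \<le> 2 / pi / (1 + L)" using L by (intro divide_right_mono) auto
    then show ?thesis by (simp add: k0_def k_def)
  qed
  have k0p: "k0 > 0" using L by (simp add: k0_def)
  have "1 < u\<^sup>2 * L\<^sup>2 + 2 * u * k0 + k0\<^sup>2"
  proof -
    define a where "a = 1 + L"
    have a: "a > 0" using L by (simp add: a_def)
    \<comment> \<open>The factor 48400 a^2 = (20 * 11 * a)^2 clears the denominators of u and
      k0.\<close>
    have "48400 * a\<^sup>2 < 121 * (17 - 3 * L\<^sup>2)\<^sup>2 * (L\<^sup>2 * a\<^sup>2) + 3080 * (17 - 3 * L\<^sup>2) * a + 19600"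
      using bernstein_polynomial_pos[of L] L by (simp add: a_def)
    also have "\<dots> = 48400 * a\<^sup>2 * (u\<^sup>2 * L\<^sup>2 + 2 * u * k0 + k0\<^sup>2)"
      unfolding u_def k0_def a_def[symmetric] using a by (simp add: field_simps power2_eq_square)
    finally have "48400 * a\<^sup>2 * 1 < 48400 * a\<^sup>2 * (u\<^sup>2 * L\<^sup>2 + 2 * u * k0 + k0\<^sup>2)" by simp
    then show ?thesis using a by (subst (asm) mult_less_cancel_left_pos) auto
  qed
  also have "\<dots> \<le> y\<^sup>2 * L\<^sup>2 + 2 * y * k + k\<^sup>2"
    using uy kk u0 k0p L by (intro add_mono mult_mono power_mono) auto
  finally have "1 + B * y\<^sup>2 < (y + k)\<^sup>2"
    by (simp add: B_def power2_eq_square algebra_simps)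
  then have "B\<^sup>2 * (1 + B * y\<^sup>2) < B\<^sup>2 * (y + k)\<^sup>2" using B by (intro mult_strict_left_mono) auto
  then have "(B + s) * B < (B * (y + k))\<^sup>2"
    unfolding s_eq by (simp add: power2_eq_square algebra_simps)
  then have "sqrt ((B + s) * B) < sqrt ((B * (y + k))\<^sup>2)" by (rule real_sqrt_less_mono)
  also have "\<dots> = B * (y + k)" using B y0 kk k0p by simp
  finally have "sqrt ((B + s) * B) - sqrt s < B * k" by (simp add: sy algebra_simps)
  then have "pi * (sqrt ((B + s) * B) - sqrt s) < pi * (B * k)" by simp
  also have "pi * (B * k) = 2 * (1 - L)"
  proof -
    have "B = (1 - L) * (1 + L)" by (simp add: B_def power2_eq_square algebra_simps)
    then show ?thesis using L by (simp add: k_def)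
  qed
  finally show ?thesis by (simp add: B_def)
qed

section \<open>Semicircle primitives and elementary bounds for KI\<close>

lemma DERIV_sqrt_circle:
  assumes "\<bar>v\<bar> < r"
  shows "((\<lambda>v. sqrt (r\<^sup>2 - v\<^sup>2)) has_real_derivative - v / sqrt (r\<^sup>2 - v\<^sup>2)) (at v)"
proof -
  have "v\<^sup>2 < r\<^sup>2" using assms by (simp add: abs_le_square_iff[symmetric] not_le[symmetric])
  then show ?thesis by (auto intro!: derivative_eq_intros simp: field_simps)
qed

lemma DERIV_arcsin_divide:
  assumes "\<bar>v\<bar> < r"
  shows "((\<lambda>v. arcsin (v / r)) has_real_derivative 1 / sqrt (r\<^sup>2 - v\<^sup>2)) (at v)"
proof -
  have r: "r > 0" using assms by linarith
  have "sqrt (1 - (v / r)\<^sup>2) = sqrt ((r\<^sup>2 - v\<^sup>2) / r\<^sup>2)"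
    using r by (simp add: diff_divide_distrib power_divide)
  also have "\<dots> = sqrt (r\<^sup>2 - v\<^sup>2) / r" using r by (simp add: real_sqrt_divide)
  finally have e: "sqrt (1 - (v / r)\<^sup>2) = sqrt (r\<^sup>2 - v\<^sup>2) / r" .
  have "((\<lambda>v. arcsin (v / r)) has_real_derivative inverse (sqrt (1 - (v / r)\<^sup>2)) * (1 / r)) (at v)"
    by (rule DERIV_chain2[of arcsin, OF DERIV_arcsin])
       (use assms r in \<open>auto intro!: derivative_eq_intros simp: field_simps\<close>)
  then show ?thesis unfolding e using r by (simp add: field_simps)
qed

definition Sprim :: "real \<Rightarrow> real \<Rightarrow> real" where
  "Sprim r v = (v * sqrt (r\<^sup>2 - v\<^sup>2) + r\<^sup>2 * arcsin (v / r)) / 2"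

lemma DERIV_Sprim:
  assumes "\<bar>v\<bar> < r"
  shows "(Sprim r has_real_derivative sqrt (r\<^sup>2 - v\<^sup>2)) (at v)"
proof -
  define q where "q = sqrt (r\<^sup>2 - v\<^sup>2)"
  have "v\<^sup>2 < r\<^sup>2" using assms by (simp add: abs_le_square_iff[symmetric] not_le[symmetric])
  then have q: "q > 0" "q * q = r\<^sup>2 - v\<^sup>2" by (auto simp: q_def)
  have "(Sprim r has_real_derivative ((1 * q + (- v / q) * v) + r\<^sup>2 * (1 / q)) / 2) (at v)"
    unfolding Sprim_def[abs_def] q_def
    by (intro DERIV_cdivide DERIV_add DERIV_mult DERIV_cmult DERIV_ident DERIV_sqrt_circle DERIV_arcsin_divide assms)
  moreover have "((1 * q + (- v / q) * v) + r\<^sup>2 * (1 / q)) / 2 = q"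
    using q by (simp add: field_simps power2_eq_square)
  ultimately show ?thesis unfolding q_def by (simp only:)
qed

lemma continuous_on_Sprim:
  assumes "r > 0" "\<And>v. v \<in> S \<Longrightarrow> \<bar>v\<bar> \<le> r"
  shows "continuous_on S (Sprim r)"
  unfolding Sprim_def
proof (intro continuous_intros ballI)
  fix v assume "v \<in> S"
  then show "- 1 \<le> v / r \<and> v / r \<le> 1" using assms(1) assms(2)[of v] by (auto simp: field_simps abs_le_iff)
qed (use assms in auto)

lemma Sprim_end: "r > 0 \<Longrightarrow> Sprim r r = pi * r\<^sup>2 / 4" "r > 0 \<Longrightarrow> Sprim r (- r) = - (pi * r\<^sup>2 / 4)" "Sprim r 0 = 0"
  by (auto simp: Sprim_def)

text \<open>As a function of x^2, the root is a semicircle over the segment from L^2 to R^2.\<close>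

lemma kr_circle: "kr L R x = sqrt (((R\<^sup>2 - L\<^sup>2) / 2)\<^sup>2 - (x\<^sup>2 - (R\<^sup>2 + L\<^sup>2) / 2)\<^sup>2)"
  unfolding kr_def by (rule arg_cong[where f=sqrt]) (simp add: power2_eq_square field_simps)

lemma circle_coordinate:
  fixes x :: real
  assumes L: "0 \<le> L"
  shows "x \<in> {L..R} \<Longrightarrow> \<bar>x\<^sup>2 - (R\<^sup>2 + L\<^sup>2) / 2\<bar> \<le> (R\<^sup>2 - L\<^sup>2) / 2"
    and "x \<in> {L<..<R} \<Longrightarrow> \<bar>x\<^sup>2 - (R\<^sup>2 + L\<^sup>2) / 2\<bar> < (R\<^sup>2 - L\<^sup>2) / 2"
proof -
  assume "x \<in> {L..R}"
  then have "L\<^sup>2 \<le> x\<^sup>2" "x\<^sup>2 \<le> R\<^sup>2" using L by (auto intro!: power_mono)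
  then show "\<bar>x\<^sup>2 - (R\<^sup>2 + L\<^sup>2) / 2\<bar> \<le> (R\<^sup>2 - L\<^sup>2) / 2" by (simp add: abs_le_iff field_simps)
next
  assume "x \<in> {L<..<R}"
  then have "L\<^sup>2 < x\<^sup>2" "x\<^sup>2 < R\<^sup>2" using L by (auto intro!: power_strict_mono)
  then show "\<bar>x\<^sup>2 - (R\<^sup>2 + L\<^sup>2) / 2\<bar> < (R\<^sup>2 - L\<^sup>2) / 2" by (simp add: abs_less_iff field_simps)
qed

text \<open>The lower bound replaces \<open>1 / (x + 1)\<close> by \<open>2 x / (3 x\<^sup>2 + 1)\<close> (AM-GM) and then \<open>1 / (3 x\<^sup>2 + 1)\<close> by its
  tangent in \<open>x\<^sup>2\<close> at the centre of \<open>{L\<^sup>2..R\<^sup>2}\<close>.\<close>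
lemma KI_lower:
  assumes L: "0 \<le> L" "L < R"
  shows "pi * (R\<^sup>2 - L\<^sup>2)\<^sup>2 / (8 * (3 * ((R\<^sup>2 + L\<^sup>2) / 2) + 1)) \<le> KI L R"
proof -
  define c where "c = (R\<^sup>2 + L\<^sup>2) / 2"
  define r where "r = (R\<^sup>2 - L\<^sup>2) / 2"
  define k where "k = 3 * c + 1"
  have "L\<^sup>2 < R\<^sup>2" using L by (intro power_strict_mono) auto
  then have r: "r > 0" by (simp add: r_def)
  have k: "k > 0" by (simp add: k_def c_def add_nonneg_pos)
  have kr: "kr L R x = sqrt (r\<^sup>2 - (x\<^sup>2 - c)\<^sup>2)" for x unfolding kr_circle r_def c_def ..
  \<comment> \<open>With v = x^2 - c the integrand is sqrt (r^2 - v^2) (k - 3 v) / k^2 dv; the part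
    -3 v integrates to (r^2 - v^2)^(3/2), which vanishes at both ends.\<close>
  define F where "F x = (k * Sprim r (x\<^sup>2 - c) + (kr L R x) ^ 3) / k\<^sup>2" for x
  have "((\<lambda>x. kr L R x * (2 * x) * (k - 3 * (x\<^sup>2 - c)) / k\<^sup>2) has_integral F R - F L) {L..R}"
  proof (rule fundamental_theorem_of_calculus_interior)
    have "continuous_on {L..R} (\<lambda>x. Sprim r (x\<^sup>2 - c))"
    proof (rule continuous_on_compose2[OF continuous_on_Sprim[OF r, of "{v. \<bar>v\<bar> \<le> r}"]])
      show "(\<lambda>x. x\<^sup>2 - c) ` {L..R} \<subseteq> {v. \<bar>v\<bar> \<le> r}"
        using circle_coordinate(1)[OF L(1)] unfolding c_def r_def by blast
    qed (auto intro!: continuous_intros)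
    then show "continuous_on {L..R} F"
      unfolding F_def using k by (intro continuous_intros continuous_on_kr) auto
    fix x assume x: "x \<in> {L<..<R}"
    have ab: "\<bar>x\<^sup>2 - c\<bar> < r" using circle_coordinate(2)[OF L(1) x] by (simp add: c_def r_def)
    define q where "q = kr L R x"
    have "(x\<^sup>2 - c)\<^sup>2 < r\<^sup>2" using ab by (simp add: abs_le_square_iff[symmetric] not_le[symmetric])
    then have q: "q > 0" by (simp add: q_def kr)
    have dv: "((\<lambda>x. x\<^sup>2 - c) has_real_derivative 2 * x) (at x)" by (auto intro!: derivative_eq_intros)
    have d1: "((\<lambda>x. Sprim r (x\<^sup>2 - c)) has_real_derivative q * (2 * x)) (at x)"
      unfolding q_def kr by (rule DERIV_chain2[OF DERIV_Sprim[OF ab] dv])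
    have d2: "(kr L R has_real_derivative - (x\<^sup>2 - c) / q * (2 * x)) (at x)"
      unfolding q_def kr[abs_def] by (rule DERIV_chain2[OF DERIV_sqrt_circle[OF ab] dv])
    have d3: "((\<lambda>x. kr L R x ^ 3) has_real_derivative real 3 * (- (x\<^sup>2 - c) / q * (2 * x) * kr L R x ^ (3 - Suc 0))) (at x)"
      by (rule DERIV_power[OF d2])
    have "(F has_real_derivative (k * (q * (2 * x)) + real 3 * (- (x\<^sup>2 - c) / q * (2 * x) * kr L R x ^ (3 - Suc 0))) / k\<^sup>2) (at x)"
      unfolding F_def[abs_def] by (intro DERIV_cdivide DERIV_add DERIV_cmult d1 d3)
    moreover have "k * (q * (2 * x)) + real 3 * (- (x\<^sup>2 - c) / q * (2 * x) * kr L R x ^ (3 - Suc 0)) = kr L R x * (2 * x) * (k - 3 * (x\<^sup>2 - c))"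
      unfolding q_def[symmetric] using q by (simp add: power2_eq_square field_simps)
    ultimately show "(F has_vector_derivative kr L R x * (2 * x) * (k - 3 * (x\<^sup>2 - c)) / k\<^sup>2) (at x)"
      by (simp add: has_real_derivative_iff_has_vector_derivative)
  qed (use L in auto)
  moreover have "F R - F L = pi * r\<^sup>2 / (2 * k)"
  proof -
    have "R\<^sup>2 - c = r" "L\<^sup>2 - c = - r" by (auto simp: c_def r_def field_simps)
    then have "F R = (k * (pi * r\<^sup>2 / 4)) / k\<^sup>2" "F L = (k * (- (pi * r\<^sup>2 / 4))) / k\<^sup>2"
      using r by (auto simp: F_def kr Sprim_end)
    then show ?thesis using k by (simp add: power2_eq_square field_simps)
  qed
  ultimately have I: "((\<lambda>x. kr L R x * (2 * x) * (k - 3 * (x\<^sup>2 - c)) / k\<^sup>2) has_integral pi * r\<^sup>2 / (2 * k)) {L..R}" by simp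
  have "((\<lambda>x. kr L R x / (x + 1)) has_integral KI L R) {L..R}"
    unfolding KI_def by (intro integrable_integral kr_integrable L) simp
  with I have "pi * r\<^sup>2 / (2 * k) \<le> KI L R"
  proof (rule has_integral_le)
    fix x assume x: "x \<in> {L..R}"
    then have x0: "x \<ge> 0" using L by auto
    have k0: "kr L R x \<ge> 0" unfolding kr_def using kr_arg_nonneg[OF L(1) x] by simp
    define t where "t = 3 * x\<^sup>2 + 1"
    have t: "t > 0" by (simp add: t_def add_nonneg_pos)
    have "k - 3 * (x\<^sup>2 - c) = 2 * k - t" by (simp add: k_def t_def)
    moreover have "(2 * k - t) / k\<^sup>2 \<le> 1 / t"
    proof -
      have "0 \<le> (k - t)\<^sup>2" by simp
      then have "(2 * k - t) * t \<le> k\<^sup>2" by (simp add: power2_eq_square algebra_simps)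
      then show ?thesis using t k by (simp add: divide_simps)
    qed
    ultimately have "(k - 3 * (x\<^sup>2 - c)) / k\<^sup>2 \<le> 1 / t" by (simp only:)
    then have "(2 * x) * ((k - 3 * (x\<^sup>2 - c)) / k\<^sup>2) \<le> (2 * x) * (1 / t)"
      by (rule mult_left_mono) (use x0 in simp)
    also have "\<dots> \<le> 1 / (x + 1)"
    proof -
      have "0 \<le> (x - 1)\<^sup>2" by simp
      then have "2 * x * (x + 1) \<le> t" by (simp add: t_def power2_eq_square algebra_simps)
      then show ?thesis using t x0 by (simp add: divide_simps)
    qed
    finally have "kr L R x * ((2 * x) * ((k - 3 * (x\<^sup>2 - c)) / k\<^sup>2)) \<le> kr L R x * (1 / (x + 1))"
      using k0 by (intro mult_left_mono) auto
    then show "kr L R x * (2 * x) * (k - 3 * (x\<^sup>2 - c)) / k\<^sup>2 \<le> kr L R x / (x + 1)" by simp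
  qed
  moreover have "pi * r\<^sup>2 / (2 * k) = pi * (R\<^sup>2 - L\<^sup>2)\<^sup>2 / (8 * k)" by (simp add: r_def power2_eq_square)
  ultimately show ?thesis by (simp add: k_def c_def)
qed

text \<open>Since 1 / (x + 1) <= 1 / x, an integral that is elementary in x^2 dominates. The bound
  is pi / 2 times the arithmetic minus the geometric mean of L^2 and R^2.\<close>

lemma KI_upper:
  assumes L: "0 < L" "L < R"
  shows "KI L R \<le> pi / 2 * ((R\<^sup>2 + L\<^sup>2) / 2 - L * R)"
proof -
  define c where "c = (R\<^sup>2 + L\<^sup>2) / 2"
  define r where "r = (R\<^sup>2 - L\<^sup>2) / 2"
  define g where "g = L * R"
  have "L\<^sup>2 < R\<^sup>2" using L by (intro power_strict_mono) auto
  then have r: "r > 0" by (simp add: r_def)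
  have g: "g > 0" using L by (simp add: g_def)
  have cr: "c\<^sup>2 - r\<^sup>2 = g\<^sup>2" by (simp add: c_def r_def g_def power2_eq_square field_simps)
  have kr: "kr L R x = sqrt (r\<^sup>2 - (x\<^sup>2 - c)\<^sup>2)" for x unfolding kr_circle r_def c_def ..
  \<comment> \<open>Chosen to run from -1 at L to 1 at R, with arcsin (a x) having derivative 2 g /
    (x kr).\<close>
  define a where "a x = (c * x\<^sup>2 - g\<^sup>2) / (r * x\<^sup>2)" for x
  have a1: "1 - (a x)\<^sup>2 = (g * kr L R x / (r * x\<^sup>2))\<^sup>2" if x: "x \<in> {L..R}" for x
  proof -
    have x0: "x \<noteq> 0" using x L by auto
    have "(kr L R x)\<^sup>2 = r\<^sup>2 - (x\<^sup>2 - c)\<^sup>2"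
      using kr_arg_nonneg[of L x R] x L kr_def[of L R x] kr[of x] by simp
    then have "(g * kr L R x)\<^sup>2 = g\<^sup>2 * (r\<^sup>2 - (x\<^sup>2 - c)\<^sup>2)" by (simp add: power_mult_distrib)
    also have "\<dots> = (r * x\<^sup>2)\<^sup>2 - (c * x\<^sup>2 - g\<^sup>2)\<^sup>2"
      unfolding cr[symmetric] by algebra
    finally have "(g * kr L R x)\<^sup>2 = (r * x\<^sup>2)\<^sup>2 - (c * x\<^sup>2 - g\<^sup>2)\<^sup>2" .
    then show ?thesis unfolding a_def power_divide using r x0 by (simp add: diff_divide_distrib)
  qed
  define F where "F x = (kr L R x + c * arcsin ((x\<^sup>2 - c) / r) - g * arcsin (a x)) / 2" for x
  have "((\<lambda>x. kr L R x / x) has_integral F R - F L) {L..R}"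
  proof (rule fundamental_theorem_of_calculus_interior)
    have ax: "- 1 \<le> a x \<and> a x \<le> 1" if "x \<in> {L..R}" for x
    proof -
      have "(a x)\<^sup>2 \<le> 1" using a1[OF that] zero_le_power2[of "g * kr L R x / (r * x\<^sup>2)"] by linarith
      then show ?thesis by (simp add: abs_square_le_1 abs_le_iff)
    qed
    have vx: "- 1 \<le> (x\<^sup>2 - c) / r \<and> (x\<^sup>2 - c) / r \<le> 1" if "x \<in> {L..R}" for x
    proof -
      have "\<bar>x\<^sup>2 - c\<bar> \<le> r" using circle_coordinate(1)[of L x R] L that unfolding c_def r_def by simp
      then show ?thesis using r by (simp add: abs_le_iff field_simps)
    qed
    have "continuous_on {L..R} a" unfolding a_def using r L by (intro continuous_intros) auto
    then show "continuous_on {L..R} F"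
      unfolding F_def using ax vx r by (intro continuous_intros continuous_on_kr) auto
    fix x assume x: "x \<in> {L<..<R}"
    then have x0: "x > 0" using L by auto
    have ab: "\<bar>x\<^sup>2 - c\<bar> < r" using circle_coordinate(2)[OF _ x] L by (simp add: c_def r_def)
    define q where "q = kr L R x"
    have "(x\<^sup>2 - c)\<^sup>2 < r\<^sup>2" using ab by (simp add: abs_le_square_iff[symmetric] not_le[symmetric])
    then have q: "q > 0" "q\<^sup>2 = r\<^sup>2 - (x\<^sup>2 - c)\<^sup>2" by (auto simp: q_def kr)
    have dv: "((\<lambda>x. x\<^sup>2 - c) has_real_derivative 2 * x) (at x)" by (auto intro!: derivative_eq_intros)
    have d1: "(kr L R has_real_derivative - (x\<^sup>2 - c) / q * (2 * x)) (at x)"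
      unfolding q_def kr[abs_def] by (rule DERIV_chain2[OF DERIV_sqrt_circle[OF ab] dv])
    have d2: "((\<lambda>x. arcsin ((x\<^sup>2 - c) / r)) has_real_derivative 1 / q * (2 * x)) (at x)"
      unfolding q_def kr by (rule DERIV_chain2[OF DERIV_arcsin_divide[OF ab] dv])
    have da: "(a has_real_derivative 2 * g\<^sup>2 / (r * x ^ 3)) (at x)"
      unfolding a_def[abs_def] using r x0
      by (auto intro!: derivative_eq_intros simp: field_simps power2_eq_square power3_eq_cube)
    have ea: "1 - (a x)\<^sup>2 = (g * q / (r * x\<^sup>2))\<^sup>2" using a1[of x] x by (simp add: q_def)
    have pos: "g * q / (r * x\<^sup>2) > 0" using g q r x0 by simp
    have "(a x)\<^sup>2 < 1" using ea zero_less_power[OF pos, of 2] by linarith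
    then have abx: "- 1 < a x" "a x < 1" by (auto simp: abs_square_less_1 abs_less_iff)
    have d3: "((\<lambda>x. arcsin (a x)) has_real_derivative inverse (sqrt (1 - (a x)\<^sup>2)) * (2 * g\<^sup>2 / (r * x ^ 3))) (at x)"
      by (rule DERIV_chain2[OF DERIV_arcsin[OF abx] da])
    have "sqrt (1 - (a x)\<^sup>2) = g * q / (r * x\<^sup>2)" unfolding ea by (rule real_sqrt_unique[OF refl]) (use pos in linarith)
    then have e3: "inverse (sqrt (1 - (a x)\<^sup>2)) * (2 * g\<^sup>2 / (r * x ^ 3)) = 2 * g / (x * q)"
      using g q r x0 by (simp add: field_simps power2_eq_square power3_eq_cube)
    have "(F has_real_derivative ((- (x\<^sup>2 - c) / q * (2 * x)) + c * (1 / q * (2 * x)) - g * (2 * g / (x * q))) / 2) (at x)"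
      unfolding F_def[abs_def] by (intro DERIV_cdivide DERIV_add DERIV_diff DERIV_cmult d1 d2 d3[unfolded e3])
    moreover have "((- (x\<^sup>2 - c) / q * (2 * x)) + c * (1 / q * (2 * x)) - g * (2 * g / (x * q))) / 2 = q / x"
    proof -
      have "q\<^sup>2 = (2 * c - x\<^sup>2) * x\<^sup>2 - g\<^sup>2" unfolding q(2) cr[symmetric] by algebra
      then have qq: "q * q = (2 * c - x\<^sup>2) * x\<^sup>2 - g * g" by (simp add: power2_eq_square)
      have "((- (x\<^sup>2 - c) / q * (2 * x)) + c * (1 / q * (2 * x)) - g * (2 * g / (x * q))) / 2 = ((2 * c - x\<^sup>2) * x\<^sup>2 - g * g) / (x * q)"
        using q(1) x0 by (simp add: field_simps power2_eq_square)
      then show ?thesis unfolding qq[symmetric] using q(1) by simp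
    qed
    ultimately show "(F has_vector_derivative kr L R x / x) (at x)"
      by (simp add: q_def has_real_derivative_iff_has_vector_derivative)
  qed (use L in auto)
  moreover have "F R - F L = pi / 2 * (c - g)"
  proof -
    have e: "R\<^sup>2 - c = r" "L\<^sup>2 - c = - r" by (auto simp: c_def r_def field_simps)
    have k0: "kr L R R = 0" "kr L R L = 0" by (auto simp: kr_def)
    have R0: "R > 0" using L by simp
    have "c * R\<^sup>2 - g\<^sup>2 = r * R\<^sup>2" "c * L\<^sup>2 - g\<^sup>2 = - (r * L\<^sup>2)"
      by (simp_all add: c_def r_def g_def power2_eq_square field_simps)
    then have "a R = 1" "a L = - 1" using r R0 L by (auto simp: a_def)
    then show ?thesis using r by (simp add: F_def e k0 field_simps)
  qed
  ultimately have I: "((\<lambda>x. kr L R x / x) has_integral pi / 2 * (c - g)) {L..R}" by simp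
  have "((\<lambda>x. kr L R x / (x + 1)) has_integral KI L R) {L..R}"
    unfolding KI_def by (intro integrable_integral kr_integrable) (use L in auto)
  then have "KI L R \<le> pi / 2 * (c - g)"
  proof (rule has_integral_le[OF _ I])
    fix x assume x: "x \<in> {L..R}"
    then have x0: "x > 0" using L by auto
    have "kr L R x \<ge> 0" unfolding kr_def using kr_arg_nonneg[of L x R] x L by simp
    then show "kr L R x / (x + 1) \<le> kr L R x / x" using x0 by (intro divide_left_mono) auto
  qed
  then show ?thesis by (simp add: c_def g_def)
qed

section \<open>The critical radius and the inner radius\<close>

definition hR :: "real \<Rightarrow> real" where
  "hR R = sqrt (R\<^sup>2 - 1) * ln (R + sqrt (R\<^sup>2 - 1)) - R"

text \<open>At L = 0 the integral is elementary: kr 0 R x = x sqrt (R^2 - x^2) and x / (x + 1) = 1 -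
  1 / (x + 1). With \<open>Phi_eq\<close> it says Phi 0 R = pi * hR R, so Rc is the radius at which
  the inner radius reaches 0.\<close>

lemma KI_zero:
  assumes R: "1 < R"
  shows "KI 0 R = pi * (R\<^sup>2 - 2) / 4 - hR R"
proof -
  define s where "s = sqrt (R\<^sup>2 - 1)"
  have R2: "R\<^sup>2 > 1" using R by (simp add: one_less_power)
  have s: "s > 0" "s\<^sup>2 = R\<^sup>2 - 1" using R2 by (auto simp: s_def)
  have X: "s\<^sup>2 + 2 * (x + 1) - (x + 1)\<^sup>2 = R\<^sup>2 - x\<^sup>2" for x
    unfolding s(2) by (simp add: power2_eq_square algebra_simps)
  define F where "F x = Sprim R x - Tprim s 2 (x + 1)" for x
  have "((\<lambda>x. sqrt (R\<^sup>2 - x\<^sup>2) - sqrt (R\<^sup>2 - x\<^sup>2) / (x + 1)) has_integral F R - F 0) {0..R}"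
  proof (rule fundamental_theorem_of_calculus_interior)
    have "continuous_on {0..R} (Sprim R)" using R by (intro continuous_on_Sprim) auto
    moreover have "continuous_on {0..R} (\<lambda>x. Tprim s 2 (x + 1))"
    proof (rule continuous_on_compose2[OF continuous_on_Tprim[OF s(1), of "(\<lambda>x. x + 1) ` {0..R}"]])
      fix u assume "u \<in> (\<lambda>x. x + 1) ` {0..R}"
      then obtain x where x: "x \<in> {0..R}" "u = x + 1" by blast
      then have "x\<^sup>2 \<le> R\<^sup>2" by (intro power_mono) auto
      then show "0 \<le> s\<^sup>2 + 2 * u - u\<^sup>2 \<and> u \<noteq> 0" unfolding x(2) X using x by auto
    qed (auto intro!: continuous_intros)
    ultimately show "continuous_on {0..R} F" unfolding F_def by (intro continuous_intros)
    fix x assume x: "x \<in> {0<..<R}"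
    have "x\<^sup>2 < R\<^sup>2" using x by (intro power_strict_mono) auto
    then have "(Tprim s 2 has_real_derivative sqrt (R\<^sup>2 - x\<^sup>2) / (x + 1)) (at (x + 1))"
      using DERIV_Tprim[OF s(1), of 2 "x + 1"] x unfolding X by simp
    then have "((\<lambda>x. Tprim s 2 (x + 1)) has_real_derivative sqrt (R\<^sup>2 - x\<^sup>2) / (x + 1)) (at x)"
      by (simp only: DERIV_shift)
    moreover have "(Sprim R has_real_derivative sqrt (R\<^sup>2 - x\<^sup>2)) (at x)"
      using x by (intro DERIV_Sprim) auto
    ultimately have "(F has_real_derivative sqrt (R\<^sup>2 - x\<^sup>2) - sqrt (R\<^sup>2 - x\<^sup>2) / (x + 1)) (at x)"
      unfolding F_def[abs_def] by (intro DERIV_diff)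
    then show "(F has_vector_derivative sqrt (R\<^sup>2 - x\<^sup>2) - sqrt (R\<^sup>2 - x\<^sup>2) / (x + 1)) (at x)"
      by (simp add: has_real_derivative_iff_has_vector_derivative)
  qed (use R in auto)
  then have "((\<lambda>x. kr 0 R x / (x + 1)) has_integral F R - F 0) {0..R}"
  proof (rule has_integral_eq[rotated])
    fix x assume x: "x \<in> {0..R}"
    have "kr 0 R x = sqrt (R\<^sup>2 - x\<^sup>2) * x" using x by (simp add: kr_def real_sqrt_mult)
    then show "sqrt (R\<^sup>2 - x\<^sup>2) - sqrt (R\<^sup>2 - x\<^sup>2) / (x + 1) = kr 0 R x / (x + 1)"
      using x by (simp add: field_simps)
  qed
  then have "KI 0 R = F R - F 0" unfolding KI_def by (rule integral_unique)
  moreover have "F R = pi * R\<^sup>2 / 4 - (pi / 2 - s * ln (2 * R))"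
  proof -
    have "Tprim s 2 (R + 1) = arcsin ((2 * (R + 1) - 2) / sqrt (2\<^sup>2 + 4 * s\<^sup>2)) - s * ln (2 * s\<^sup>2 + 2 * (R + 1)) + s * ln (R + 1)"
      unfolding Tprim_def X using R by simp
    moreover have "sqrt (2\<^sup>2 + 4 * s\<^sup>2) = 2 * R"
    proof -
      have "2\<^sup>2 + 4 * s\<^sup>2 = (2 * R)\<^sup>2" unfolding s(2) by (simp add: power2_eq_square)
      then have "sqrt (2\<^sup>2 + 4 * s\<^sup>2) = \<bar>2 * R\<bar>" by (simp only: real_sqrt_abs)
      then show ?thesis using R by simp
    qed
    moreover have "2 * s\<^sup>2 + 2 * (R + 1) = 2 * R * (R + 1)" unfolding s(2) by (simp add: power2_eq_square algebra_simps)
    moreover have "ln (2 * R * (R + 1)) = ln (2 * R) + ln (R + 1)" using R by (intro ln_mult_pos) auto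
    ultimately have "Tprim s 2 (R + 1) = arcsin ((2 * (R + 1) - 2) / (2 * R)) - s * (ln (2 * R) + ln (R + 1)) + s * ln (R + 1)"
      by (simp only:)
    then have "Tprim s 2 (R + 1) = pi / 2 - s * ln (2 * R)" using R by (simp add: algebra_simps)
    then show ?thesis using R by (simp add: F_def Sprim_end)
  qed
  moreover have "F 0 = - (R - s * (ln (2 * R) + ln (R + s)))"
  proof -
    have "sqrt (s\<^sup>2 + 2 * 1 - 1\<^sup>2) = R" using X[of 0] R by simp
    then have "Tprim s 2 1 = R - s * ln (2 * s\<^sup>2 + 2 * 1 + 2 * s * R)"
      unfolding Tprim_def by simp
    also have "2 * s\<^sup>2 + 2 * 1 + 2 * s * R = 2 * R * (R + s)" unfolding s(2) by (simp add: power2_eq_square algebra_simps)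
    also have "ln (2 * R * (R + s)) = ln (2 * R) + ln (R + s)" using R s by (intro ln_mult_pos) auto
    finally show ?thesis by (simp add: F_def Sprim_end)
  qed
  ultimately show ?thesis by (simp add: hR_def s_def[symmetric] field_simps)
qed

lemma hR_strict_mono:
  assumes "1 < a" "a < b"
  shows "hR a < hR b"
proof (rule DERIV_pos_imp_increasing[OF assms(2)])
  fix x assume "a \<le> x" "x \<le> b"
  then have x: "x > 1" using assms by simp
  define s where "s = sqrt (x\<^sup>2 - 1)"
  have "x\<^sup>2 > 1" using x by (simp add: one_less_power)
  then have s: "s > 0" by (simp add: s_def)
  have d1: "((\<lambda>x. sqrt (x\<^sup>2 - 1)) has_real_derivative x / s) (at x)"
    unfolding s_def using \<open>x\<^sup>2 > 1\<close> by (auto intro!: derivative_eq_intros simp: field_simps)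
  have "((\<lambda>x. x + sqrt (x\<^sup>2 - 1)) has_real_derivative 1 + x / s) (at x)"
    by (intro DERIV_add DERIV_ident d1)
  from DERIV_chain2[OF DERIV_ln_divide this] x s
  have d2: "((\<lambda>x. ln (x + sqrt (x\<^sup>2 - 1))) has_real_derivative 1 / (x + s) * (1 + x / s)) (at x)"
    by (simp add: s_def[symmetric])
  have "1 / (x + s) * (1 + x / s) = 1 / s"
    using x s by (simp add: divide_simps)
  with d2 have d2: "((\<lambda>x. ln (x + sqrt (x\<^sup>2 - 1))) has_real_derivative 1 / s) (at x)" by simp
  have "(hR has_real_derivative (x / s * ln (x + sqrt (x\<^sup>2 - 1)) + 1 / s * sqrt (x\<^sup>2 - 1)) - 1) (at x)"
    unfolding hR_def[abs_def] by (intro DERIV_diff DERIV_mult d1 d2 DERIV_ident)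
  then have "(hR has_real_derivative x / s * ln (x + s)) (at x)" using s by (simp add: s_def[symmetric])
  moreover have "x / s * ln (x + s) > 0" using x s by (intro mult_pos_pos ln_gt_zero) auto
  ultimately show "\<exists>y. (hR has_real_derivative y) (at x) \<and> 0 < y" by blast
qed

text \<open>The bracket 3 is also used later: \<open>KI_one_less\<close> needs R - 1 < 2.\<close>

lemma hR_root: "\<exists>R. 1 < R \<and> R < 3 \<and> hR R = 0"
proof -
  have c: "continuous_on {1..3} hR"
    unfolding hR_def
  proof (intro continuous_intros ballI)
    fix x :: real assume "x \<in> {1..3}"
    then have "x + sqrt (x\<^sup>2 - 1) \<ge> 1" by (simp add: add_increasing2 one_le_power)
    then show "x + sqrt (x\<^sup>2 - 1) \<noteq> 0" by linarith
  qed
  have 1: "hR 1 = - 1" by (simp add: hR_def)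
  have 3: "hR 3 > 0"
  proof -
    have s: "sqrt ((3::real)\<^sup>2 - 1) \<ge> 14 / 5" by (rule real_le_rsqrt) (simp add: power2_eq_square)
    have "exp (3 / 2 :: real) * exp (3 / 2) = exp 1 * exp 1 * exp 1"
      by (simp add: exp_add[symmetric])
    also have "\<dots> \<le> (272 / 100) * (272 / 100) * (272 / 100)"
      using e_less_272 by (intro mult_mono) auto
    also have "\<dots> \<le> 5 * (5::real)" by simp
    finally have "(exp (3 / 2 :: real))\<^sup>2 \<le> 5\<^sup>2" by (simp add: power2_eq_square)
    then have "exp (3 / 2 :: real) \<le> 5" by (rule power2_le_imp_le) simp
    then have "exp (3 / 2) \<le> 3 + sqrt ((3::real)\<^sup>2 - 1)" using s by linarith
    then have "3 / 2 \<le> ln (3 + sqrt ((3::real)\<^sup>2 - 1))" using ln_ge_iff[of "3 + sqrt ((3::real)\<^sup>2 - 1)"] s by simp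
    then have "14 / 5 * (3 / 2) \<le> sqrt ((3::real)\<^sup>2 - 1) * ln (3 + sqrt ((3::real)\<^sup>2 - 1))"
      using s by (intro mult_mono) auto
    then show ?thesis unfolding hR_def by linarith
  qed
  obtain R where R: "1 \<le> R" "R \<le> 3" "hR R = 0"
    using IVT'[of hR 1 0 3] c 1 3 by auto
  moreover have "R \<noteq> 1" "R \<noteq> 3" using R 1 3 by auto
  ultimately show ?thesis by (metis less_eq_real_def)
qed

lemma Rc_props: "1 < Rc" "Rc < 3" "hR Rc = 0"
proof -
  obtain R where R: "1 < R" "R < 3" "hR R = 0" using hR_root by blast
  have "Rc = R"
    unfolding Rc_def
  proof (rule the_equality)
    show "R > 1 \<and> sqrt (R\<^sup>2 - 1) * ln (R + sqrt (R\<^sup>2 - 1)) - R = 0" using R by (simp add: hR_def)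
    fix R' assume "R' > 1 \<and> sqrt (R'\<^sup>2 - 1) * ln (R' + sqrt (R'\<^sup>2 - 1)) - R' = 0"
    then have "R' > 1" "hR R' = 0" by (auto simp: hR_def)
    then show "R' = R" using R hR_strict_mono[of R R'] hR_strict_mono[of R' R] by (metis less_irrefl linorder_neqE)
  qed
  then show "1 < Rc" "Rc < 3" "hR Rc = 0" using R by auto
qed

text \<open>The integrand of KI extended by 0 to {0..R}: with a domain independent of L,
  monotonicity and continuity in L follow from the integrand.\<close>

definition kmax :: "real \<Rightarrow> real \<Rightarrow> real \<Rightarrow> real" where
  "kmax R L x = sqrt ((R\<^sup>2 - x\<^sup>2) * max 0 (x\<^sup>2 - L\<^sup>2)) / (x + 1)"

lemma KI_kmax:
  assumes L: "0 \<le> L" "L \<le> R"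
  shows "KI L R = integral {0..R} (kmax R L)"
proof -
  have c: "continuous_on {0..R} (kmax R L)"
    unfolding kmax_def by (intro continuous_intros) auto
  have "integral {0..L} (kmax R L) + integral {L..R} (kmax R L) = integral {0..R} (kmax R L)"
    using L by (intro Henstock_Kurzweil_Integration.integral_combine integrable_continuous_real c) auto
  moreover have "integral {0..L} (kmax R L) = integral {0..L} (\<lambda>_. 0)"
  proof (rule integral_cong)
    fix x assume "x \<in> {0..L}"
    then have "x\<^sup>2 \<le> L\<^sup>2" by (intro power_mono) auto
    then show "kmax R L x = 0" by (simp add: kmax_def)
  qed
  moreover have "integral {L..R} (kmax R L) = KI L R"
    unfolding KI_def
  proof (rule integral_cong)
    fix x assume "x \<in> {L..R}"
    then have "L\<^sup>2 \<le> x\<^sup>2" using L by (intro power_mono) auto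
    then show "kmax R L x = kr L R x / (x + 1)" by (simp add: kmax_def kr_def max_def)
  qed
  ultimately show ?thesis by simp
qed

lemma KI_antimono:
  assumes "0 \<le> L1" "L1 \<le> L2" "L2 \<le> R"
  shows "KI L2 R \<le> KI L1 R"
proof -
  have c: "kmax R L integrable_on {0..R}" for L
    unfolding kmax_def by (intro integrable_continuous_real continuous_intros) auto
  have "integral {0..R} (kmax R L2) \<le> integral {0..R} (kmax R L1)"
  proof (rule integral_le[OF c c])
    fix x assume x: "x \<in> {0..R}"
    then have "x\<^sup>2 \<le> R\<^sup>2" by (intro power_mono) auto
    moreover have "L1\<^sup>2 \<le> L2\<^sup>2" using assms by (intro power_mono) auto
    ultimately have "(R\<^sup>2 - x\<^sup>2) * max 0 (x\<^sup>2 - L2\<^sup>2) \<le> (R\<^sup>2 - x\<^sup>2) * max 0 (x\<^sup>2 - L1\<^sup>2)"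
      by (intro mult_left_mono) auto
    then show "kmax R L2 x \<le> kmax R L1 x"
      unfolding kmax_def using x by (intro divide_right_mono real_sqrt_le_mono) auto
  qed
  then show ?thesis using assms by (simp add: KI_kmax)
qed

lemma continuous_on_KI:
  assumes R: "1 \<le> R"
  shows "continuous_on {0..1} (\<lambda>L. KI L R)"
proof -
  have "continuous_on {0..1} (\<lambda>L. integral (cbox 0 R) (kmax R L))"
  proof (rule integral_continuous_on_param)
    show "continuous_on ({0..1} \<times> cbox 0 R) (\<lambda>(L, x). kmax R L x)"
      unfolding kmax_def case_prod_unfold by (intro continuous_intros) auto
  qed
  then have "continuous_on {0..1} (\<lambda>L. integral {0..R} (kmax R L))" by simp
  then show ?thesis
    by (rule continuous_on_eq) (use R in \<open>auto simp: KI_kmax\<close>)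
qed

text \<open>Supplies the sign at L = 1 for the intermediate value argument. The root is at most its
  radius (R^2 - 1) / 2, x + 1 is at least 2, and R - 1 < 2 <= pi.\<close>

lemma KI_one_less:
  assumes R: "1 < R" "R < 3"
  shows "KI 1 R < pi * (R\<^sup>2 - 1) / 4"
proof -
  have R2: "R\<^sup>2 > 1" using R by (simp add: one_less_power)
  have "((\<lambda>x. kr 1 R x / (x + 1)) has_integral KI 1 R) {1..R}"
    unfolding KI_def by (intro integrable_integral kr_integrable) auto
  moreover have "((\<lambda>x. (R\<^sup>2 - 1) / 4) has_integral (R - 1) * ((R\<^sup>2 - 1) / 4)) {1..R}"
    using has_integral_const_real[of "(R\<^sup>2 - 1) / 4" 1 R] R by simp
  ultimately have "KI 1 R \<le> (R - 1) * ((R\<^sup>2 - 1) / 4)"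
  proof (rule has_integral_le)
    fix x assume x: "x \<in> {1..R}"
    have "kr 1 R x \<le> sqrt (((R\<^sup>2 - 1\<^sup>2) / 2)\<^sup>2)"
      unfolding kr_circle by (rule real_sqrt_le_mono) simp
    also have "\<dots> = (R\<^sup>2 - 1) / 2" using R2 by simp
    finally have "kr 1 R x / (x + 1) \<le> ((R\<^sup>2 - 1) / 2) / 2"
      using x R2 by (intro frac_le) auto
    then show "kr 1 R x / (x + 1) \<le> (R\<^sup>2 - 1) / 4" by simp
  qed
  also have "\<dots> < pi * ((R\<^sup>2 - 1) / 4)"
    using R R2 pi_ge_two by (intro mult_strict_right_mono) auto
  finally show ?thesis by simp
qed

text \<open>\<open>ph\<close>, which is Phi / pi for L < 1, strictly increases in L: the quadratic
  term grows and KI does not. At 0 it is hR R, negative for R < Rc, and at 1 it is positive.\<close>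

lemma Lof_props:
  assumes R: "1 < R" "R < Rc"
  shows "0 < Lof R" "Lof R < 1" "Phi (Lof R) R = 0"
proof -
  define ph where "ph L = pi * (R\<^sup>2 + L\<^sup>2 - 2) / 4 - KI L R" for L
  have R3: "R < 3" using R Rc_props by linarith
  have Phi_ph: "Phi L R = 0 \<longleftrightarrow> ph L = 0" if "0 \<le> L" "L < 1" for L
    using Phi_eq[OF that R(1)] by (simp add: ph_def)
  have mono: "ph L1 < ph L2" if "0 \<le> L1" "L1 < L2" "L2 \<le> 1" for L1 L2
  proof -
    have "L1\<^sup>2 < L2\<^sup>2" using that by (intro power_strict_mono) auto
    then have "pi * (R\<^sup>2 + L1\<^sup>2 - 2) / 4 < pi * (R\<^sup>2 + L2\<^sup>2 - 2) / 4" by simp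
    moreover have "KI L2 R \<le> KI L1 R" using that R by (intro KI_antimono) auto
    ultimately show ?thesis unfolding ph_def by linarith
  qed
  have p0: "ph 0 < 0"
    using KI_zero[OF R(1)] hR_strict_mono[OF R] Rc_props(3) by (simp add: ph_def)
  have p1: "ph 1 > 0" using KI_one_less[OF R(1) R3] by (simp add: ph_def)
  have "continuous_on {0..1} ph"
    unfolding ph_def using R by (intro continuous_intros continuous_on_KI) auto
  then obtain L where L: "0 \<le> L" "L \<le> 1" "ph L = 0"
    using IVT'[of ph 0 0 1] p0 p1 by auto
  moreover have "L \<noteq> 0" "L \<noteq> 1" using L p0 p1 by auto
  ultimately have L': "0 < L" "L < 1" by auto
  have ex1: "\<exists>!L. 0 < L \<and> L < 1 \<and> Phi L R = 0"
  proof (rule ex1I[of _ L])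
    show "0 < L \<and> L < 1 \<and> Phi L R = 0" using L L' Phi_ph by auto
    fix M assume M: "0 < M \<and> M < 1 \<and> Phi M R = 0"
    then have "ph M = 0" using Phi_ph by auto
    then show "M = L" using mono[of M L] mono[of L M] M L L' by (metis less_eq_real_def less_irrefl linorder_neqE)
  qed
  from theI'[OF ex1] show "0 < Lof R" "Lof R < 1" "Phi (Lof R) R = 0"
    unfolding Lof_def by auto
qed

text \<open>Phi = 0 reads KI = pi s / 4. \<open>KI_lower\<close> turns this into (R^2 - L^2)^2 <= s
  (8 + 3 s), which forces s > 0 and feeds \<open>pi_mass_gap_lt\<close>; \<open>KI_upper\<close>
  turns it into L R <= 1.\<close>

lemma Lof_inequalities:
  assumes R: "1 < R" "R < Rc"
  shows "R\<^sup>2 + (Lof R)\<^sup>2 - 2 > 0" "Lof R * R \<le> 1"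
    "pi * (sqrt ((R\<^sup>2 - 1) * (1 - (Lof R)\<^sup>2)) - sqrt (R\<^sup>2 + (Lof R)\<^sup>2 - 2)) < 2 * (1 - Lof R)"
proof -
  define L where "L = Lof R"
  have L: "0 < L" "L < 1" "Phi L R = 0" using Lof_props[OF R] by (auto simp: L_def)
  define s where "s = R\<^sup>2 + L\<^sup>2 - 2"
  have KI: "KI L R = pi * s / 4"
    using Phi_eq[of L R] L R by (simp add: s_def)
  have R2: "R\<^sup>2 > 1" using R by (simp add: one_less_power)
  have k: "8 + 3 * s > 0" 
  proof -
    have "8 + 3 * (q + p - 2) > 0" if "q > 1" "p \<ge> 0" for q p :: real using that by simp
    from this[OF R2 zero_le_power2[of L]] show ?thesis by (simp only: s_def)
  qed
  have "L\<^sup>2 < R\<^sup>2" using L R by (intro power_strict_mono) auto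
  have "pi * (R\<^sup>2 - L\<^sup>2)\<^sup>2 / (8 * (3 * ((R\<^sup>2 + L\<^sup>2) / 2) + 1)) \<le> pi * s / 4"
    using KI_lower[of L R] L R KI by simp
  moreover have "8 * (3 * ((R\<^sup>2 + L\<^sup>2) / 2) + 1) = 4 * (8 + 3 * s)" by (simp add: s_def field_simps)
  ultimately have "pi * (R\<^sup>2 - L\<^sup>2)\<^sup>2 / (4 * (8 + 3 * s)) \<le> pi * s / 4" by (simp only:)
  then have "pi * (R\<^sup>2 - L\<^sup>2)\<^sup>2 \<le> pi * (s * (8 + 3 * s))" using k by (simp add: divide_le_eq algebra_simps)
  then have c0: "(R\<^sup>2 - L\<^sup>2)\<^sup>2 \<le> s * (8 + 3 * s)" by simp
  have "0 < (R\<^sup>2 - L\<^sup>2)\<^sup>2" using \<open>L\<^sup>2 < R\<^sup>2\<close> by simp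
  then have "0 < s * (8 + 3 * s)" using c0 by linarith
  then have s: "s > 0" using k by (simp add: zero_less_mult_iff)
  have "R\<^sup>2 - L\<^sup>2 = s + 2 * (1 - L\<^sup>2)" by (simp add: s_def)
  then have c: "(s + 2 * (1 - L\<^sup>2))\<^sup>2 \<le> s * (8 + 3 * s)" using c0 by (simp only:)
  have "pi * (sqrt ((1 - L\<^sup>2 + s) * (1 - L\<^sup>2)) - sqrt s) < 2 * (1 - L)"
    using pi_mass_gap_lt[OF _ L(2) s c] L by simp
  moreover have "1 - L\<^sup>2 + s = R\<^sup>2 - 1" by (simp add: s_def)
  ultimately show "pi * (sqrt ((R\<^sup>2 - 1) * (1 - (Lof R)\<^sup>2)) - sqrt (R\<^sup>2 + (Lof R)\<^sup>2 - 2)) < 2 * (1 - Lof R)"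
    by (simp add: L_def s_def)
  show "R\<^sup>2 + (Lof R)\<^sup>2 - 2 > 0" using s by (simp add: L_def s_def)
  have "pi * s / 4 \<le> pi / 2 * ((R\<^sup>2 + L\<^sup>2) / 2 - L * R)" using KI_upper[of L R] L R KI by simp
  then have "pi * (L * R) \<le> pi * 1" by (simp add: s_def field_simps)
  then show "Lof R * R \<le> 1" unfolding L_def[symmetric] by simp
qed

text \<open>With s^2 = R^2 - 1 the last claim follows from 4 + pi^2 < 4 pi s, that is, s above about
  1.104. The equation of Rc gives ln (Rc + sc) = Rc / sc > 1, hence R + s > e, which is
  enough.\<close>

lemma typeII_inequalities:
  assumes R: "R \<ge> Rc"
  shows "R > 1" "R\<^sup>2 - 2 > 0" "pi * (sqrt (R\<^sup>2 - 1) - sqrt (R\<^sup>2 - 2)) < 2"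
proof -
  show R1: "R > 1" using R Rc_props by linarith
  define s where "s = sqrt (R\<^sup>2 - 1)"
  define sc where "sc = sqrt (Rc\<^sup>2 - 1)"
  have R2: "R\<^sup>2 > 1" "Rc\<^sup>2 > 1" using R1 Rc_props by (auto simp: one_less_power)
  have s: "s > 0" "s\<^sup>2 = R\<^sup>2 - 1" and sc: "sc > 0" "sc\<^sup>2 = Rc\<^sup>2 - 1" using R2 by (auto simp: s_def sc_def)
  have "sc\<^sup>2 < Rc\<^sup>2" using sc by simp
  then have "sc < Rc" using Rc_props by (metis power_less_imp_less_base less_trans zero_less_one less_imp_le)
  moreover have "sc * ln (Rc + sc) = Rc" using Rc_props(3) by (simp add: hR_def sc_def)
  ultimately have "sc * 1 < sc * ln (Rc + sc)" by simp
  then have "1 < ln (Rc + sc)" using sc by (subst (asm) mult_less_cancel_left_pos) auto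
  then have "exp 1 < Rc + sc" using sc Rc_props(1) by (metis add_pos_pos exp_less_cancel_iff exp_ln less_trans zero_less_one)
  moreover have "sc \<le> s" unfolding s_def sc_def using R Rc_props by (intro real_sqrt_le_mono) (simp add: power_mono)
  moreover have "27 / 10 \<le> exp (1::real)"
  proof -
    have "\<bar>exp (1::real) - 5837465777 / 2147483648\<bar> \<le> 1 / 100" using e_approx_32 by simp
    then show ?thesis unfolding abs_le_iff by linarith
  qed
  ultimately have e: "27 / 10 < R + s" using R by linarith
  \<comment> \<open>Otherwise R <= 1.53 and R + s <= 2.68, below 2.7 < e.\<close>
  have s115: "s > 115 / 100"
  proof (rule ccontr)
    assume "\<not> s > 115 / 100"
    then have le: "s \<le> 115 / 100" by simp
    then have "s\<^sup>2 \<le> (115 / 100)\<^sup>2" using s by (intro power_mono) auto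
    then have "R\<^sup>2 \<le> (153 / 100)\<^sup>2" using s(2) by (simp add: power2_eq_square)
    then have "R \<le> 153 / 100" by (rule power2_le_imp_le) simp
    then show False using le e by linarith
  qed
  have "(115 / 100)\<^sup>2 < s\<^sup>2" using s115 by (intro power_strict_mono) auto
  then have s1: "s\<^sup>2 - 1 > 0" by (simp add: power2_eq_square)
  then show "R\<^sup>2 - 2 > 0" using s(2) by simp
  have p: "314 / 100 \<le> pi" "pi \<le> 3142 / 1000" using pi_approx by auto
  have "pi\<^sup>2 \<le> (3142 / 1000)\<^sup>2" using p by (intro power_mono) auto
  moreover have "(314 / 100) * (115 / 100) \<le> pi * s" using p s115 by (intro mult_mono) auto
  ultimately have "4 + pi\<^sup>2 < 4 * (pi * s)" by (simp add: power2_eq_square)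
  then have "(pi * s - 2)\<^sup>2 < pi\<^sup>2 * (s\<^sup>2 - 1)" by (simp add: power2_eq_square algebra_simps)
  also have "\<dots> = (pi * sqrt (s\<^sup>2 - 1))\<^sup>2" using s1 by (simp add: power_mult_distrib)
  finally have "pi * s - 2 < pi * sqrt (s\<^sup>2 - 1)" by (rule power2_less_imp_less) (use s1 in simp)
  moreover have "s\<^sup>2 - 1 = R\<^sup>2 - 2" using s(2) by simp
  ultimately have "pi * s - 2 < pi * sqrt (R\<^sup>2 - 2)" by (simp only:)
  then show "pi * (sqrt (R\<^sup>2 - 1) - sqrt (R\<^sup>2 - 2)) < 2"
    unfolding s_def[symmetric] right_diff_distrib by linarith
qed

section \<open>The energy ratio\<close>

text \<open>For L = 0 the inner interval is the single point 0, where the root vanishes.\<close>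

lemma muII_eq_muIII: "R > 0 \<Longrightarrow> muII R = muIII 0 R"
proof -
  assume "R > 0"
  then have "fst (muII R) x = fst (muIII 0 R) x" for x
    by (cases "x = 0") (auto simp: muII_def muIII_def)
  then show ?thesis by (simp add: prod_eq_iff fun_eq_iff) (simp add: muII_def muIII_def)
qed

lemma sm_interval_scale:
  assumes lam: "lam > 0"
  shows "sm_interval (sm_scale lam \<mu>) (- lam) lam = lam * sm_interval \<mu> (- 1) 1"
proof -
  obtain f ats where mu: "\<mu> = (f, ats)" by (cases \<mu>)
  have iff: "- lam \<le> lam * p \<and> lam * p \<le> lam \<longleftrightarrow> - 1 \<le> p \<and> p \<le> 1" for p
    using mult_le_cancel_left_pos[OF lam, of "- 1" p] mult_le_cancel_left_pos[OF lam, of p 1] by simp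
  have "(LINT y:{- lam..lam}|lborel. f (y / lam)) = lam * (\<integral>y. indicat_real {- lam..lam} (lam * y) * f y \<partial>lborel)"
    using lborel_integral_real_affine[of lam "\<lambda>y. indicat_real {- lam..lam} y * f (y / lam)" 0] lam
    by (simp add: set_lebesgue_integral_def)
  moreover have "indicat_real {- lam..lam} (lam * y) = indicat_real {- 1..1} y" for y
    using iff[of y] by (simp add: indicator_def)
  ultimately have 1: "(LINT y:{- lam..lam}|lborel. f (y / lam)) = lam * (LINT y:{- 1..1}|lborel. f y)"
    by (simp add: set_lebesgue_integral_def)
  have 2: "sum_list (map (\<lambda>(m, p). if p \<in> {- lam..lam} then m else 0) (map (\<lambda>(m, p). (lam * m, lam * p)) ats))
      = lam * sum_list (map (\<lambda>(m, p). if p \<in> {- 1..1} then m else 0) ats)"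
    by (induction ats) (auto simp: iff distrib_left)
  show ?thesis
    unfolding sm_interval_def sm_scale_def mu fst_conv snd_conv 1 2 by (simp only: distrib_left)
qed

lemma sm_interval_singleton:
  "sm_interval \<mu> a a = sum_list (map (\<lambda>(m, p). if p = a then m else 0) (snd \<mu>))"
proof -
  have "(LINT y:{a..a}|lborel. fst \<mu> y) = 0"
    unfolding set_lebesgue_integral_def
  proof (rule integral_eq_zero_AE)
    show "AE y in lborel. indicat_real {a..a} y *\<^sub>R fst \<mu> y = 0"
      using AE_lborel_singleton[of a] by eventually_elim simp
  qed
  then show ?thesis by (simp add: sm_interval_def)
qed

text \<open>Only type I has an atom at 0, and the degenerate interval {0..0} detects it.\<close>

lemma muIII_not_sm_eq_muI:
  assumes "lam > 0" "lam' > 0"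
  shows "\<not> sm_eq (sm_scale lam (muIII L R)) (sm_scale lam' muI)"
proof
  assume "sm_eq (sm_scale lam (muIII L R)) (sm_scale lam' muI)"
  then have "sm_interval (sm_scale lam (muIII L R)) 0 0 = sm_interval (sm_scale lam' muI) 0 0"
    by (simp add: sm_eq_def)
  then show False using assms
    unfolding sm_interval_singleton by (simp add: sm_scale_def muI_def muIII_def)
qed

section \<open>Central mass and the strict inequality\<close>

context
  fixes L R s m :: real
  assumes L: "0 \<le> L" "L < 1" and R: "1 < R"
    and s_pos: "R\<^sup>2 + L\<^sup>2 - 2 > 0" and LR: "L * R \<le> 1"
  defines "s \<equiv> R\<^sup>2 + L\<^sup>2 - 2" and "m \<equiv> sqrt ((R\<^sup>2 - 1) * (1 - L\<^sup>2))"
begin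

private abbreviation "f \<equiv> fst (muIII L R)"

text \<open>(y^2 - 1)^2 exceeds the radicand by s y^2 + 1 - (L R)^2, which is nonnegative because s
  > 0 and L R <= 1.\<close>

private lemma density_nonpos: "f y \<le> 0"
proof -
  have "(L * R)\<^sup>2 \<le> 1" using LR L R by (intro power_le_one) auto
  moreover have "0 \<le> (R\<^sup>2 + L\<^sup>2 - 2) * y\<^sup>2" using s_pos by (intro mult_nonneg_nonneg) auto
  moreover have "(y\<^sup>2 - 1)\<^sup>2 - (y\<^sup>2 - R\<^sup>2) * (y\<^sup>2 - L\<^sup>2) = (R\<^sup>2 + L\<^sup>2 - 2) * y\<^sup>2 + 1 - (L * R)\<^sup>2"
    by algebra
  ultimately have "(y\<^sup>2 - R\<^sup>2) * (y\<^sup>2 - L\<^sup>2) \<le> (y\<^sup>2 - 1)\<^sup>2" by linarith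
  then have "sqrt ((y\<^sup>2 - R\<^sup>2) * (y\<^sup>2 - L\<^sup>2)) \<le> \<bar>y\<^sup>2 - 1\<bar>"
    using real_sqrt_le_mono by fastforce
  \<comment> \<open>Where y^2 = 1 the quotient is 0 by the convention for division by 0.\<close>
  then have "sqrt ((y\<^sup>2 - R\<^sup>2) * (y\<^sup>2 - L\<^sup>2)) / \<bar>y\<^sup>2 - 1\<bar> \<le> 1"
    by (cases "y\<^sup>2 - 1 = 0") (auto simp: divide_le_eq)
  then show ?thesis by (simp add: muIII_def)
qed

private lemma density_gap: "L < \<bar>y\<bar> \<Longrightarrow> \<bar>y\<bar> < R \<Longrightarrow> f y = - 1"
  by (simp add: muIII_def)

private lemma integrable_density: "integrable lborel f"
  using muIII_half_plane_density[OF L R] half_plane_density.integrable_f by blast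

private lemma neutral_density: "(\<integral>y. f y \<partial>lborel) + pi * m = 0"
proof -
  have "(\<integral>y. f y \<partial>lborel) + sum_list (map fst (snd (muIII L R))) = 0"
    using muIII_half_plane_density[OF L R] half_plane_density.neutral by blast
  then show ?thesis by (simp add: muIII_def m_def)
qed

private lemma set_integrable_density: "A \<in> sets borel \<Longrightarrow> set_integrable lborel A f"
  unfolding set_integrable_def by (intro integrable_mult_indicator integrable_density) auto

private lemma central_mass: "sm_interval (muIII L R) (- 1) 1 = (LINT y:{- 1..1}|lborel. f y) + pi * m"
  by (simp add: sm_interval_def) (simp add: muIII_def m_def)

text \<open>The density is -1 on both gaps L < |y| <= 1 and at most 0 on {-L..L}; the atoms add pi
  m.\<close>

lemma central_mass_le: "sm_interval (muIII L R) (- 1) 1 \<le> pi * m - 2 * (1 - L)"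
proof -
  have i: "set_integrable lborel {- 1..1} (\<lambda>y. indicat_real {- L..L} y)"
    unfolding set_integrable_def
    using set_integrable_const_Icc[of "- L" L 1] by (intro integrable_mult_indicator) (auto simp: set_integrable_def)
  have "(LINT y:{- 1..1}|lborel. f y) \<le> (LINT y:{- 1..1}|lborel. indicat_real {- L..L} y - 1)"
  proof (rule set_integral_mono)
    show "set_integrable lborel {- 1..1} (\<lambda>y. indicat_real {- L..L} y - 1)"
      by (intro set_integral_diff(1) i set_integrable_const_Icc)
    fix y :: real assume y: "y \<in> {- 1..1}"
    show "f y \<le> indicat_real {- L..L} y - 1"
    proof (cases "\<bar>y\<bar> \<le> L")
      case True
      then show ?thesis using density_nonpos[of y] by (simp add: abs_le_iff)
    next
      case False
      then have "f y = - 1" using y R by (intro density_gap) auto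
      then show ?thesis by simp
    qed
  qed (simp add: set_integrable_density)
  also have "\<dots> = (LINT y:{- 1..1}|lborel. indicat_real {- L..L} y) - (LINT y:{- 1..1::real}|lborel. 1)"
    by (intro set_integral_diff(2) i set_integrable_const_Icc)
  also have "(LINT y:{- 1..1}|lborel. indicat_real {- L..L} y) = (\<integral>y. indicat_real {- L..L} y \<partial>lborel)"
    unfolding set_lebesgue_integral_def
    by (rule Bochner_Integration.integral_cong) (use L in \<open>auto simp: indicator_def\<close>)
  also have "\<dots> = 2 * L" using L by simp
  also have "(LINT y:{- 1..1::real}|lborel. 1) = (2::real)" by (simp add: set_lebesgue_integral_def)
  finally show ?thesis unfolding central_mass by simp
qed

text \<open>By neutrality the central mass is minus the integral of the density outside {-1..1}, and
  the interval (1, R) alone makes this at least R - 1.\<close>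

lemma central_mass_pos: "sm_interval (muIII L R) (- 1) 1 > 0"
proof -
  have "(LINT y:{- 1..1} \<union> - {- 1..1}|lborel. f y) = (LINT y:{- 1..1}|lborel. f y) + (LINT y:- {- 1..1}|lborel. f y)"
    by (intro set_integral_Un set_integrable_density) auto
  then have eq: "(\<integral>y. f y \<partial>lborel) = (LINT y:{- 1..1}|lborel. f y) + (LINT y:- {- 1..1}|lborel. f y)"
    by (simp add: set_lebesgue_integral_def)
  have "(LINT y:- {- 1..1}|lborel. f y) \<le> (\<integral>y. - indicat_real {1<..<R} y \<partial>lborel)"
    unfolding set_lebesgue_integral_def
  proof (rule integral_mono)
    show "integrable lborel (\<lambda>y. indicat_real (- {- 1..1}) y *\<^sub>R f y)"
      using set_integrable_density[of "- {- 1..1}"] by (simp add: set_integrable_def)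
    show "integrable lborel (\<lambda>y. - indicat_real {1<..<R} y)" using R by (simp add: integrable_indicator_iff)
    fix y
    show "indicat_real (- {- 1..1}) y *\<^sub>R f y \<le> - indicat_real {1<..<R} y"
      using density_nonpos[of y] density_gap[of y] L by (auto simp: indicator_def)
  qed
  also have "\<dots> = - (R - 1)" using R by simp
  finally show ?thesis unfolding central_mass using eq neutral_density R by linarith
qed

text \<open>Energy and squared mass both scale like lam^2, so the ratio is pi^2 s / (2 D^2) and the
  claim amounts to D < pi sqrt s for the positive mass D.\<close>

lemma Hfun_ratio_gt_half:
  assumes lam: "lam > 0" and gap: "pi * (m - sqrt s) < 2 * (1 - L)"
  shows "Hfun (sm_scale lam (muIII L R)) / (sm_interval (sm_scale lam (muIII L R)) (- lam) lam)\<^sup>2 > 1 / 2"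
proof -
  obtain g where g: "half_plane_density g f (snd (muIII L R)) (- s / 2) R"
    using muIII_half_plane_density[OF L R] by (auto simp: s_def)
  have H: "Hfun (sm_scale lam (muIII L R)) = lam\<^sup>2 * (pi\<^sup>2 * s / 2)"
    using half_plane_density.Hfun_scale[OF g _ lam] R by simp
  define D where "D = sm_interval (muIII L R) (- 1) 1"
  have D: "0 < D" using central_mass_pos by (simp add: D_def)
  have "D < pi * sqrt s" using central_mass_le gap by (simp add: D_def right_diff_distrib)
  then have "D\<^sup>2 < (pi * sqrt s)\<^sup>2" using D by (intro power_strict_mono) auto
  also have "\<dots> = pi\<^sup>2 * s" using s_pos by (simp add: power_mult_distrib s_def)
  finally have lt: "D\<^sup>2 < pi\<^sup>2 * s" .
  have "Hfun (sm_scale lam (muIII L R)) / (sm_interval (sm_scale lam (muIII L R)) (- lam) lam)\<^sup>2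
      = (lam\<^sup>2 * (pi\<^sup>2 * s / 2)) / (lam\<^sup>2 * D\<^sup>2)"
    unfolding H sm_interval_scale[OF lam] D_def by (simp add: power_mult_distrib)
  also have "\<dots> = (pi\<^sup>2 * s / 2) / D\<^sup>2" using lam by simp
  also have "\<dots> > 1 / 2" using lt D by (simp add: less_divide_eq)
  finally show ?thesis .
qed

end

theorem theorem5p1:
  assumes "admissible a"
  shows "Gfun a \<ge> 1 / 2 \<and>
         (Gfun a = 1 / 2 \<longleftrightarrow> (\<exists>lam>0. sm_eq (adm_sm a) (sm_scale lam muI)))"
proof (cases a)
  case (AdmI lam)
  then have lam: "lam > 0" using assms by simp
  obtain g where g: "half_plane_density g (fst muI) (snd muI) (- (1 / pi)\<^sup>2 / 2) (1 / pi)"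
    using muI_half_plane_density by blast
  have "Hfun (sm_scale lam muI) = lam\<^sup>2 * (1 / 2)"
    using half_plane_density.Hfun_scale[OF g _ lam] by (simp add: power_divide)
  then have "Gfun a = 1 / 2" using lam by (simp add: Gfun_def AdmI)
  moreover have "sm_eq (adm_sm a) (sm_scale lam muI)" by (simp add: AdmI sm_eq_def)
  ultimately show ?thesis using lam by auto
next
  case (AdmII lam R)
  then have lam: "lam > 0" and R: "R \<ge> Rc" using assms by auto
  note ineq = typeII_inequalities[OF R]
  have eq: "muII R = muIII 0 R" using ineq(1) by (intro muII_eq_muIII) simp
  have "Gfun a > 1 / 2"
    using Hfun_ratio_gt_half[of 0 R lam] ineq lam by (simp add: Gfun_def AdmII eq)
  moreover have "\<not> (\<exists>lam>0. sm_eq (adm_sm a) (sm_scale lam muI))"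
    using muIII_not_sm_eq_muI[OF lam] by (auto simp: AdmII eq)
  ultimately show ?thesis by auto
next
  case (AdmIII lam R)
  then have lam: "lam > 0" and R: "1 < R" "R < Rc" using assms by auto
  have "Gfun a > 1 / 2"
    using Hfun_ratio_gt_half[of "Lof R" R lam] Lof_props[OF R] Lof_inequalities[OF R] lam R
    by (simp add: Gfun_def AdmIII)
  moreover have "\<not> (\<exists>lam>0. sm_eq (adm_sm a) (sm_scale lam muI))"
    using muIII_not_sm_eq_muI[OF lam] by (auto simp: AdmIII)
  ultimately show ?thesis by auto
qed

end
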